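(* For any $z_1,z_2\in\mathbb{C}\setminus\mathbb{R}$, the spectrum of the linear operator $$T_{\{z_1e_{11}-\gamma_0,\,z_2e_{11}-\gamma_0\}}:M_m(\mathbb{C})\otimes M_m(\mathbb{C})\to M_m(\mathbb{C})\otimes M_m(\mathbb{C})$$ is included in the open disk of radius $\sigma^{-2}$ centred at $0$.
   Context: Setting. $P\in\mathbb{C}\langle t_1,t_2\rangle$ is a selfadjoint polynomial in two noncommuting indeterminates (the involution is antilinear with $(t_{i_1}\cdots t_{i_l})^*=t_{i_l}\cdots t_{i_1}$), $\sigma>0$, and $\nu$ is a compactly supported Borel probability measure on $\mathbb{R}$ (it arises as the weak limit of the spectral measures of uniformly bounded real diagonal matrices $D_N$). Linearization. A linearization of $P$ is an element $L_P=\begin{pmatrix}0&u\\ v&Q\end{pmatrix}\in M_m(\mathbb{C})\otimes\mathbb{C}\langle t_1,t_2\rangle$ with $u$ a row and $v$ a column of size $m-1$, $Q$ of size $(m-1)\times(m-1)$ invertible in $M_{m-1}(\mathbb{C})\otimes\mathbb{C}\langle t_1,t_2\rangle$, all entries of degree $\le1$, and $P=-uQ^{-1}v$. The canonical selfadjoint linearization is built as follows. A monomial $ct_{i_1}\cdots t_{i_l}$, $l\ge2$, is linearized by the $l\times l$ matrix whose antidiagonal, read from top right to bottom left, is $ct_{i_1},t_{i_2},\dots,t_{i_l}$, whose entries immediately below and to the right of that antidiagonal (positions $(i,j)$ with $i+j=l+2$) equal $-1$, and whose other entries are $0$; a monomial $q$ of degree $0$ or $1$ is linearized by $\begin{pmatrix}0&q\\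 1&-1\end{pmatrix}$. If $\begin{pmatrix}0&u_j\\ v_j&Q_j\end{pmatrix}$ linearizes $P_j$, $j=1,2$, then $\begin{pmatrix}0&u_1&u_2\\ v_1&Q_1&0\\ v_2&0&Q_2\end{pmatrix}$ linearizes $P_1+P_2$. Finally write $P=P_0+P_0^*$ (for instance $P_0=P/2$), let $\begin{pmatrix}0&u_0\\ v_0&Q_0\end{pmatrix}$ be the linearization of $P_0$ so obtained, and set $L_P=\begin{pmatrix}0&u_0&v_0^*\\ u_0^*&0&Q_0^*\\ v_0&Q_0&0\end{pmatrix}$. Write $L_P=\gamma_0\otimes1+\gamma_1\otimes t_1+\gamma_2\otimes t_2$; $\gamma_0,\gamma_1,\gamma_2$ are selfadjoint matrices in $M_m(\mathbb{C})$. Free probability. In a $W^*$-probability space $(\mathcal{A},\varphi)$ (von Neumann algebra with a normal faithful tracial state) let $s$ be a semicircular element of mean $0$ and variance $\sigma^2$, freely independent from a selfadjoint $d$ with distribution $\nu$. Let $$\omega(b)=b-\sigma^2\gamma_1(\mathrm{id}_m\otimes\varphi)\big[(b\otimes1_{\mathcal A}-\gamma_1\otimes s-\gamma_2\otimes d)^{-1}\big]\gamma_1$$ for every $b\in M_m(\mathbb{C})$ such that $b\otimes1_{\mathcal A}-\gamma_1\otimes s-\gamma_2\otimes d$ is invertible; this includes $b=ze_{11}-\gamma_0$, $z\in\mathbb{C}\setminus\mathbb{R}$, where $e_{11}$ is the $(1,1)$ matrix unit. For $\beta_1,\beta_2$ such that $\omega(\beta_j)\otimes1_{\mathcal A}-\gamma_2\otimes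 d$ is invertible, $T_{\{\beta_1,\beta_2\}}$ is the operator on $M_m(\mathbb{C})\otimes M_m(\mathbb{C})$ $$T_{\{\beta_1,\beta_2\}}(x)=\int_{\mathbb{R}}\big((\omega(\beta_1)-t\gamma_2)^{-1}\gamma_1\otimes I_m\big)\,x\,\big(I_m\otimes\gamma_1(\omega(\beta_2)-t\gamma_2)^{-1}\big)\,d\nu(t).$$ *)

theory Defs
  imports
    "HOL-Probability.Probability"
    "HOL-Library.Poly_Mapping"
    "HOL-Library.Nonpos_Ints"
    "Jordan_Normal_Form.Matrix"
begin

section \<open>Noncommutative polynomials and the canonical selfadjoint linearization\<close>

datatype indet = T1 | T2

text \<open>An element of \<open>\<complex>\<langle>t\<^sub>1, t\<^sub>2\<rangle>\<close> is a finitely supported family of coefficients indexed by words;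
  only its vector space structure and its involution are used below.\<close>

type_synonym ncpoly = "indet list \<Rightarrow>\<^sub>0 complex"

lift_definition nc_adjoint :: "ncpoly \<Rightarrow> ncpoly" is
  "\<lambda>p w. cnj (p (rev w))"
proof -
  fix p :: "indet list \<Rightarrow> complex"
  assume "finite {w. p w \<noteq> 0}"
  moreover have "{w. cnj (p (rev w)) \<noteq> 0} = rev ` {w. p w \<noteq> 0}"
    by (auto simp: image_iff intro!: exI[of _ "rev w" for w])
  ultimately show "finite {w. cnj (p (rev w)) \<noteq> 0}" by simp
qed

definition mat_nc_adjoint :: "ncpoly mat \<Rightarrow> ncpoly mat" where
  "mat_nc_adjoint X = map_mat nc_adjoint (transpose_mat X)"

text \<open>Matrix indices start at 0, so the antidiagonal of an \<open>l \<times> l\<close> matrix is \<open>i + j = l - 1\<close>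
  and the positions just below it are \<open>i + j = l\<close>.\<close>

definition lin_monomial :: "complex \<Rightarrow> indet list \<Rightarrow> ncpoly mat" where
  "lin_monomial c w = (let l = length w in
     if l \<le> 1 then
       mat_of_rows_list 2
         [[0, Poly_Mapping.single w c],
          [Poly_Mapping.single [] 1, Poly_Mapping.single [] (- 1)]]
     else
       Matrix.mat l l (\<lambda>(i, j).
         if i + j = l - 1 then Poly_Mapping.single [w ! i] (if i = 0 then c else 1)
         else if i + j = l then Poly_Mapping.single [] (- 1)
         else 0))"

definition append_cols :: "'a::zero mat \<Rightarrow> 'a mat \<Rightarrow> 'a mat" where
  "append_cols A B = four_block_mat A B (0\<^sub>m 0 (dim_col A)) (0\<^sub>m 0 (dim_col B))"

definition lin_add :: "ncpoly mat \<Rightarrow> ncpoly mat \<Rightarrow> ncpoly mat" where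
  "lin_add L1 L2 =
    (case split_block L1 1 1 of (_, u1, v1, Q1) \<Rightarrow>
     case split_block L2 1 1 of (_, u2, v2, Q2) \<Rightarrow>
       four_block_mat (0\<^sub>m 1 1) (append_cols u1 u2) (v1 @\<^sub>r v2) (diag_block_mat [Q1, Q2]))"

text \<open>The \<open>1 \<times> 1\<close> zero matrix, with empty \<open>u\<close>, \<open>v\<close>, \<open>Q\<close>, is neutral for \<open>lin_add\<close>
  and is the linearization of the empty sum.\<close>

definition lin_sum :: "(complex \<times> indet list) list \<Rightarrow> ncpoly mat" where
  "lin_sum ms = foldr (\<lambda>(c, w). lin_add (lin_monomial c w)) ms (0\<^sub>m 1 1)"

definition monomial_sum :: "(complex \<times> indet list) list \<Rightarrow> ncpoly" where
  "monomial_sum ms = (\<Sum>(c, w)\<leftarrow>ms. Poly_Mapping.single w c)"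

definition lin_symmetrize :: "ncpoly mat \<Rightarrow> ncpoly mat" where
  "lin_symmetrize L0 =
    (case split_block L0 1 1 of (_, u, v, Q) \<Rightarrow>
     let k = dim_row Q in
       four_block_mat (0\<^sub>m 1 1)
         (append_cols u (mat_nc_adjoint v))
         (mat_nc_adjoint u @\<^sub>r v)
         (four_block_mat (0\<^sub>m k k) (mat_nc_adjoint Q) Q (0\<^sub>m k k)))"

text \<open>The construction depends on the choice of \<open>P\<^sub>0\<close> with \<open>P = P\<^sub>0 + P\<^sub>0\<^sup>*\<close> and on the way
  \<open>P\<^sub>0\<close> is written as an ordered sum of monomials; every choice is allowed.\<close>

definition canonical_sa_linearization :: "ncpoly \<Rightarrow> ncpoly mat \<Rightarrow> bool" where
  "canonical_sa_linearization P L \<longleftrightarrow>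
    (\<exists>ms. P = monomial_sum ms + nc_adjoint (monomial_sum ms) \<and>
          L = lin_symmetrize (lin_sum ms))"

definition mat_coeff :: "ncpoly mat \<Rightarrow> indet list \<Rightarrow> complex mat" where
  "mat_coeff L w = map_mat (\<lambda>p. Poly_Mapping.lookup p w) L"


section \<open>Bounded operators on a complex Hilbert space\<close>

class scaleC =
  fixes scaleC :: "complex \<Rightarrow> 'a \<Rightarrow> 'a"  (infixr \<open>*\<^sub>C\<close> 75)

text \<open>The inner product is linear in its first argument. The zero space is excluded so that
  the bounded operators form a \<open>ring_1\<close>; it carries no state anyway.\<close>

class complex_hilbert_space = banach + scaleC +
  fixes cinner :: "'a \<Rightarrow> 'a \<Rightarrow> complex"
  assumes scaleC_add_right: "c *\<^sub>C (x + y) = c *\<^sub>C x + c *\<^sub>C y"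
    and scaleC_add_left: "(b + c) *\<^sub>C x = b *\<^sub>C x + c *\<^sub>C x"
    and scaleC_scaleC: "b *\<^sub>C c *\<^sub>C x = (b * c) *\<^sub>C x"
    and scaleC_of_real: "complex_of_real r *\<^sub>C x = r *\<^sub>R x"
    and cinner_add_left: "cinner (x + y) z = cinner x z + cinner y z"
    and cinner_scaleC_left: "cinner (c *\<^sub>C x) y = c * cinner x y"
    and cinner_commute: "cinner x y = cnj (cinner y x)"
    and cinner_self: "cinner x x = complex_of_real ((norm x)\<^sup>2)"
    and nontrivial: "\<exists>x. x \<noteq> 0"

instantiation complex :: complex_hilbert_space
begin

definition "c *\<^sub>C (x::complex) = c * x"
definition "cinner (x::complex) y = x * cnj y"

instance
proof
  show "cinner x x = complex_of_real ((norm x)\<^sup>2)" for x :: complex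
    by (simp only: cinner_complex_def complex_norm_square)
  show "\<exists>x::complex. x \<noteq> 0" by (rule exI[of _ 1]) simp
qed (simp_all add: scaleC_complex_def cinner_complex_def algebra_simps scaleR_conv_of_real)

end

lemma scaleC_minus_right:
  "c *\<^sub>C (- x) = - (c *\<^sub>C (x::'a::complex_hilbert_space))"
proof -
  have "- x = complex_of_real (- 1) *\<^sub>C x"
    by (simp only: scaleC_of_real) simp
  then have "c *\<^sub>C (- x) = complex_of_real (- 1) *\<^sub>C c *\<^sub>C x"
    by (simp only: scaleC_scaleC mult.commute)
  also have "\<dots> = - (c *\<^sub>C x)"
    by (simp only: scaleC_of_real) simp
  finally show ?thesis .
qed

lemma scaleC_zero_right: "c *\<^sub>C (0::'a::complex_hilbert_space) = 0"
  using scaleC_add_right[of c "0::'a" 0] by simp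

lemma norm_scaleC:
  "norm (c *\<^sub>C (x::'a::complex_hilbert_space)) = cmod c * norm x"
proof -
  have "complex_of_real ((norm (c *\<^sub>C x))\<^sup>2) = cinner (c *\<^sub>C x) (c *\<^sub>C x)"
    by (simp only: cinner_self)
  also have "\<dots> = c * cnj (cinner (c *\<^sub>C x) x)"
    by (subst cinner_scaleC_left, subst cinner_commute, simp)
  also have "\<dots> = c * cnj c * cnj (cinner x x)"
    by (simp add: cinner_scaleC_left)
  also have "\<dots> = complex_of_real ((cmod c)\<^sup>2) * complex_of_real ((norm x)\<^sup>2)"
    by (simp only: cinner_self complex_norm_square complex_cnj_complex_of_real)
  also have "\<dots> = complex_of_real ((cmod c * norm x)\<^sup>2)"
    by (simp only: power_mult_distrib of_real_mult)
  finally have "(norm (c *\<^sub>C x))\<^sup>2 = (cmod c * norm x)\<^sup>2"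
    by (simp only: of_real_eq_iff)
  then show ?thesis by (rule power2_eq_imp_eq) simp_all
qed

lemma bounded_linear_scaleC:
  "bounded_linear (\<lambda>x::'a::complex_hilbert_space. c *\<^sub>C x)"
proof (rule bounded_linear_intro[of _ "cmod c"])
  fix r :: real and x :: 'a
  show "c *\<^sub>C (r *\<^sub>R x) = r *\<^sub>R (c *\<^sub>C x)"
    by (simp only: scaleC_of_real[symmetric] scaleC_scaleC mult.commute)
qed (simp_all add: scaleC_add_right norm_scaleC mult.commute)

typedef (overloaded) 'h bop =
  "{f :: 'h::complex_hilbert_space \<Rightarrow> 'h. bounded_linear f \<and> (\<forall>c x. f (c *\<^sub>C x) = c *\<^sub>C f x)}"
  morphisms app Bop
  by (rule exI[of _ id]) (auto simp: id_def bounded_linear_ident)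

setup_lifting type_definition_bop

instantiation bop :: (complex_hilbert_space) "{ring_1, scaleC}"
begin

lift_definition zero_bop :: "'a bop" is "\<lambda>x. 0"
  by (simp add: scaleC_zero_right)
lift_definition one_bop :: "'a bop" is "\<lambda>x. x"
  by (auto simp: bounded_linear_ident)
lift_definition plus_bop :: "'a bop \<Rightarrow> 'a bop \<Rightarrow> 'a bop" is "\<lambda>f g x. f x + g x"
  by (auto simp: bounded_linear_add scaleC_add_right)
lift_definition uminus_bop :: "'a bop \<Rightarrow> 'a bop" is "\<lambda>f x. - f x"
  by (auto simp: bounded_linear_minus scaleC_minus_right)
lift_definition minus_bop :: "'a bop \<Rightarrow> 'a bop \<Rightarrow> 'a bop" is "\<lambda>f g x. f x - g x"
  by (simp add: bounded_linear_add bounded_linear_minus diff_conv_add_uminus scaleC_add_right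
      scaleC_minus_right del: add_uminus_conv_diff)
lift_definition times_bop :: "'a bop \<Rightarrow> 'a bop \<Rightarrow> 'a bop" is "\<lambda>f g x. f (g x)"
  by (auto intro: bounded_linear_compose)
lift_definition scaleC_bop :: "complex \<Rightarrow> 'a bop \<Rightarrow> 'a bop" is "\<lambda>c f x. c *\<^sub>C f x"
  by (auto intro: bounded_linear_compose[OF bounded_linear_scaleC] simp: scaleC_scaleC mult.commute)

instance
proof
  fix a b c :: "'a bop"
  note defs = app_inject[symmetric] fun_eq_iff plus_bop.rep_eq uminus_bop.rep_eq minus_bop.rep_eq
    times_bop.rep_eq zero_bop.rep_eq one_bop.rep_eq
  have lin: "app f (x + y) = app f x + app f y" for f :: "'a bop" and x y
    using app[of f] by (auto simp: linear_simps)
  show "a * b * c = a * (b * c)" "1 * a = a" "a * 1 = a"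
    "a + b + c = a + (b + c)" "a + b = b + a" "0 + a = a" "- a + a = 0" "a - b = a + - b"
    "(a + b) * c = a * c + b * c" "a * (b + c) = a * b + a * c"
    by (simp_all add: defs lin add_ac)
  show "(0 :: 'a bop) \<noteq> 1"
    using nontrivial by (auto simp: defs)
qed

end

definition is_adjoint :: "'h::complex_hilbert_space bop \<Rightarrow> 'h bop \<Rightarrow> bool" where
  "is_adjoint a b \<longleftrightarrow> (\<forall>x y. cinner (app a x) y = cinner x (app b y))"

definition selfadjoint :: "'h::complex_hilbert_space bop \<Rightarrow> bool" where
  "selfadjoint a \<longleftrightarrow> is_adjoint a a"

definition op_le :: "'h::complex_hilbert_space bop \<Rightarrow> 'h bop \<Rightarrow> bool" where
  "op_le a b \<longleftrightarrow> (\<forall>x. cinner (app (b - a) x) x \<in> \<real>\<^sub>\<ge>\<^sub>0)"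


section \<open>Von Neumann algebras with a normal faithful tracial state\<close>

definition commutant :: "'a::times set \<Rightarrow> 'a set" where
  "commutant S = {x. \<forall>y\<in>S. x * y = y * x}"

definition von_neumann_algebra :: "'h::complex_hilbert_space bop set \<Rightarrow> bool" where
  "von_neumann_algebra M \<longleftrightarrow>
    (\<forall>a\<in>M. \<exists>b\<in>M. is_adjoint a b) \<and> commutant (commutant M) = M"

definition state_on ::
    "'h::complex_hilbert_space bop set \<Rightarrow> ('h bop \<Rightarrow> complex) \<Rightarrow> bool" where
  "state_on M \<phi> \<longleftrightarrow>
    (\<forall>a\<in>M. \<forall>b\<in>M. \<phi> (a + b) = \<phi> a + \<phi> b) \<and>
    (\<forall>c. \<forall>a\<in>M. \<phi> (c *\<^sub>C a) = c * \<phi> a) \<and>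
    (\<forall>a\<in>M. \<forall>b\<in>M. is_adjoint a b \<longrightarrow> \<phi> (b * a) \<in> \<real>\<^sub>\<ge>\<^sub>0) \<and>
    \<phi> 1 = 1"

definition faithful_on ::
    "'h::complex_hilbert_space bop set \<Rightarrow> ('h bop \<Rightarrow> complex) \<Rightarrow> bool" where
  "faithful_on M \<phi> \<longleftrightarrow>
    (\<forall>a\<in>M. \<forall>b\<in>M. is_adjoint a b \<longrightarrow> \<phi> (b * a) = 0 \<longrightarrow> a = 0)"

definition tracial_on ::
    "'h::complex_hilbert_space bop set \<Rightarrow> ('h bop \<Rightarrow> complex) \<Rightarrow> bool" where
  "tracial_on M \<phi> \<longleftrightarrow> (\<forall>a\<in>M. \<forall>b\<in>M. \<phi> (a * b) = \<phi> (b * a))"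

text \<open>\<open>x\<close> is the least upper bound of \<open>D\<close> among the selfadjoint elements of \<open>M\<close>.\<close>

definition sa_lub ::
    "'h::complex_hilbert_space bop set \<Rightarrow> 'h bop set \<Rightarrow> 'h bop \<Rightarrow> bool" where
  "sa_lub M D x \<longleftrightarrow>
    x \<in> M \<and> selfadjoint x \<and> (\<forall>a\<in>D. op_le a x) \<and>
    (\<forall>y\<in>M. selfadjoint y \<longrightarrow> (\<forall>a\<in>D. op_le a y) \<longrightarrow> op_le x y)"

text \<open>A state is normal if it preserves suprema of upward directed sets of selfadjoint elements.
  A directed set with a supremum is bounded above, and its image is bounded above by the value
  at the supremum.\<close>

definition normal_on ::
    "'h::complex_hilbert_space bop set \<Rightarrow> ('h bop \<Rightarrow> complex) \<Rightarrow> bool" where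
  "normal_on M \<phi> \<longleftrightarrow>
    (\<forall>D x. D \<noteq> {} \<longrightarrow> D \<subseteq> {a\<in>M. selfadjoint a} \<longrightarrow>
       (\<forall>a\<in>D. \<forall>b\<in>D. \<exists>c\<in>D. op_le a c \<and> op_le b c) \<longrightarrow> sa_lub M D x \<longrightarrow>
       Re (\<phi> x) = (SUP a\<in>D. Re (\<phi> a)))"

definition wstar_probability_space ::
    "'h::complex_hilbert_space bop set \<Rightarrow> ('h bop \<Rightarrow> complex) \<Rightarrow> bool" where
  "wstar_probability_space M \<phi> \<longleftrightarrow>
    von_neumann_algebra M \<and> state_on M \<phi> \<and> normal_on M \<phi> \<and> faithful_on M \<phi> \<and> tracial_on M \<phi>"


section \<open>Distributions and freeness\<close>

text \<open>Used only for compactly supported \<open>\<mu>\<close>, which are determined by their moments.\<close>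

definition has_distribution ::
    "('h::complex_hilbert_space bop \<Rightarrow> complex) \<Rightarrow> 'h bop \<Rightarrow> real measure \<Rightarrow> bool" where
  "has_distribution \<phi> a \<mu> \<longleftrightarrow>
    selfadjoint a \<and> (\<forall>k::nat. \<phi> (a ^ k) = complex_of_real (\<integral>t. t ^ k \<partial>\<mu>))"

text \<open>The semicircle law of mean 0 and variance \<open>\<sigma>\<^sup>2\<close>.\<close>

definition semicircle :: "real \<Rightarrow> real measure" where
  "semicircle \<sigma> = density lborel
    (\<lambda>t. ennreal (indicator {- 2 * \<sigma> .. 2 * \<sigma>} t * sqrt (4 * \<sigma>\<^sup>2 - t\<^sup>2) / (2 * pi * \<sigma>\<^sup>2)))"

inductive_set star_algebra_generated ::
    "'h::complex_hilbert_space bop set \<Rightarrow> 'h bop set" for S where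
  gen: "a \<in> S \<Longrightarrow> a \<in> star_algebra_generated S"
| unit: "1 \<in> star_algebra_generated S"
| add: "a \<in> star_algebra_generated S \<Longrightarrow> b \<in> star_algebra_generated S \<Longrightarrow>
    a + b \<in> star_algebra_generated S"
| scale: "a \<in> star_algebra_generated S \<Longrightarrow> c *\<^sub>C a \<in> star_algebra_generated S"
| mult: "a \<in> star_algebra_generated S \<Longrightarrow> b \<in> star_algebra_generated S \<Longrightarrow>
    a * b \<in> star_algebra_generated S"
| star: "a \<in> star_algebra_generated S \<Longrightarrow> is_adjoint a b \<Longrightarrow> b \<in> star_algebra_generated S"

definition free_algebras ::
    "('a::monoid_mult \<Rightarrow> complex) \<Rightarrow> ('i \<Rightarrow> 'a set) \<Rightarrow> bool" where
  "free_algebras \<phi> B \<longleftrightarrow>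
    (\<forall>xs. xs \<noteq> [] \<longrightarrow> (\<forall>(i, a)\<in>set xs. a \<in> B i \<and> \<phi> a = 0) \<longrightarrow>
       successively (\<noteq>) (map fst xs) \<longrightarrow> \<phi> (prod_list (map snd xs)) = 0)"

definition freely_independent ::
    "('h::complex_hilbert_space bop \<Rightarrow> complex) \<Rightarrow> 'h bop \<Rightarrow> 'h bop \<Rightarrow> bool" where
  "freely_independent \<phi> a b \<longleftrightarrow>
    free_algebras \<phi> (\<lambda>i::bool. star_algebra_generated {if i then a else b})"


section \<open>The map \<open>\<omega>\<close> and the operator \<open>T\<close>\<close>

text \<open>The inverse of a square matrix in the algebra of matrices with entries in \<open>S\<close>
  (arbitrary if there is none).\<close>

definition inverse_in :: "'a::semiring_1 set \<Rightarrow> 'a mat \<Rightarrow> 'a mat" where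
  "inverse_in S X =
    (THE Y. Y \<in> carrier_mat (dim_row X) (dim_row X) \<and> elements_mat Y \<subseteq> S \<and>
       inverts_mat X Y \<and> inverts_mat Y X)"

abbreviation mat_inv :: "complex mat \<Rightarrow> complex mat" where
  "mat_inv \<equiv> inverse_in UNIV"

text \<open>\<open>b \<otimes> a\<close> as a matrix with operator entries.\<close>

definition mat_tensor_op :: "complex mat \<Rightarrow> 'a::scaleC \<Rightarrow> 'a mat" where
  "mat_tensor_op b a = map_mat (\<lambda>c. c *\<^sub>C a) b"

definition omega ::
    "'h::complex_hilbert_space bop set \<Rightarrow> ('h bop \<Rightarrow> complex) \<Rightarrow> 'h bop \<Rightarrow> 'h bop \<Rightarrow> real \<Rightarrow>
     complex mat \<Rightarrow> complex mat \<Rightarrow> complex mat \<Rightarrow> complex mat" where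
  "omega M \<phi> s d \<sigma> \<gamma>1 \<gamma>2 b =
    b - complex_of_real (\<sigma>\<^sup>2) \<cdot>\<^sub>m
      (\<gamma>1 * map_mat \<phi> (inverse_in M
         (mat_tensor_op b 1 - mat_tensor_op \<gamma>1 s - mat_tensor_op \<gamma>2 d)) * \<gamma>1)"

text \<open>Kronecker product; it identifies \<open>M\<^sub>m(\<complex>) \<otimes> M\<^sub>m(\<complex>)\<close> with the \<open>m\<^sup>2 \<times> m\<^sup>2\<close> matrices.\<close>

definition kron :: "complex mat \<Rightarrow> complex mat \<Rightarrow> complex mat" where
  "kron A B = Matrix.mat (dim_row A * dim_row B) (dim_col A * dim_col B)
    (\<lambda>(i, j). A $$ (i div dim_row B, j div dim_col B) * B $$ (i mod dim_row B, j mod dim_col B))"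

text \<open>Here \<open>w1\<close> and \<open>w2\<close> stand for \<open>\<omega>(\<beta>\<^sub>1)\<close> and \<open>\<omega>(\<beta>\<^sub>2)\<close>; the integral is taken entrywise.\<close>

definition T_op ::
    "nat \<Rightarrow> real measure \<Rightarrow> complex mat \<Rightarrow> complex mat \<Rightarrow> complex mat \<Rightarrow> complex mat \<Rightarrow>
     complex mat \<Rightarrow> complex mat" where
  "T_op m \<nu> \<gamma>1 \<gamma>2 w1 w2 x =
    Matrix.mat (m * m) (m * m) (\<lambda>ij.
      \<integral>t. (kron (mat_inv (w1 - complex_of_real t \<cdot>\<^sub>m \<gamma>2) * \<gamma>1) (1\<^sub>m m) * x *
           kron (1\<^sub>m m) (\<gamma>1 * mat_inv (w2 - complex_of_real t \<cdot>\<^sub>m \<gamma>2))) $$ ij \<partial>\<nu>)"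

definition e11 :: "nat \<Rightarrow> complex mat" where
  "e11 m = Matrix.mat m m (\<lambda>(i, j). if i = 0 \<and> j = 0 then 1 else 0)"

text \<open>The spectrum of a linear operator on the space of \<open>n \<times> n\<close> matrices.\<close>

definition mat_op_spectrum :: "nat \<Rightarrow> (complex mat \<Rightarrow> complex mat) \<Rightarrow> complex set" where
  "mat_op_spectrum n F =
    {l. \<not> bij_betw (\<lambda>x. l \<cdot>\<^sub>m x - F x) (carrier_mat n n) (carrier_mat n n)}"

end

theory Submission
  imports Defs "Jordan_Normal_Form.Determinant"
begin

text \<open>
  Only the row index of the first tensor factor and the column index of the second one are affected
  by \<open>T\<close>. Its eigenvalues are therefore those of \<open>y \<mapsto> \<integral> F\<^sub>1(t) \<gamma>\<^sub>1 y \<gamma>\<^sub>1 F\<^sub>2(t) d\<nu>(t)\<close> on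
  \<open>m \<times> m\<close> matrices, where \<open>F\<^sub>j(t) = (\<omega>(z\<^sub>j e\<^sub>1\<^sub>1 - \<gamma>\<^sub>0) - t \<gamma>\<^sub>2)\<^sup>-\<^sup>1\<close>, and passing from \<open>z\<close> to its
  conjugate replaces \<open>F\<close> by its adjoint.

  The decisive case is \<open>z\<^sub>2 = cnj z\<^sub>1\<close>. Then \<open>y \<mapsto> \<sigma>\<^sup>2 \<gamma>\<^sub>1 (\<integral> F y F\<^sup>* d\<nu>) \<gamma>\<^sub>1\<close> is positive, and it contracts
  every \<open>u \<ge> 1\<close> that satisfies \<open>\<sigma>\<^sup>2 \<gamma>\<^sub>1 (\<integral> F u F\<^sup>* d\<nu>) \<gamma>\<^sub>1 = u - 1\<close>, because \<open>u - 1 \<le> (1 - 1/U) u\<close> as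
  soon as \<open>u \<le> U\<close>. Such a \<open>u\<close> exists: with the resolvent \<open>R\<close> of the linearized
  operator, \<open>u = 1 + \<sigma>\<^sup>2 \<gamma>\<^sub>1 (id \<otimes> \<phi>)(R R\<^sup>*) \<gamma>\<^sub>1\<close> (\<open>potential\<close>, \<open>form_pull\<close>). For arbitrary \<open>z\<^sub>1\<close>, \<open>z\<^sub>2\<close> an
  eigenvector \<open>y\<close> is measured by constants \<open>C\<close> with
  \<open>\<bar>\<langle>\<gamma>\<^sub>1 y \<gamma>\<^sub>1 \<eta>, \<xi>\<rangle>\<bar> \<le> C (\<langle>u\<^sub>1 \<xi>, \<xi>\<rangle> + \<langle>u\<^sub>2 \<eta>, \<eta>\<rangle>)\<close>, with \<open>u\<^sub>1\<close> taken at \<open>z\<^sub>1\<close> and \<open>u\<^sub>2\<close> at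
  \<open>cnj z\<^sub>2\<close>. An eigenvalue of modulus at least \<open>\<sigma>\<^sup>-\<^sup>2\<close> would let \<open>C\<close> be replaced by a fixed fraction of itself,
  so \<open>\<gamma>\<^sub>1 y \<gamma>\<^sub>1 = 0\<close> and \<open>y = 0\<close> (\<open>no_large_eigenvalue\<close>).

  The equation for \<open>u\<close> is an instance of subordination. Freeness and the moments of the semicircle law
  give the Schwinger--Dyson equation \<open>\<phi> (s x) = \<sigma>\<^sup>2 (\<phi> \<otimes> \<phi>)(\<partial> x)\<close> for polynomials \<open>x\<close> in \<open>s\<close>, \<open>d\<close>. For a
  resolvent, \<open>\<partial> R = R \<gamma>\<^sub>1 \<otimes> R\<close>, and the equation becomes \<open>(\<omega> - \<gamma>\<^sub>2 d) E[R | d] = 1\<close>; hence \<open>\<omega> - t \<gamma>\<^sub>2\<close>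
  is invertible on the support of \<open>\<nu>\<close> and \<open>(id \<otimes> \<phi>)(R) = \<integral> (\<omega> - t \<gamma>\<^sub>2)\<^sup>-\<^sup>1 d\<nu>(t)\<close>
  (\<open>subordination_invertible\<close>, \<open>subordination_integral\<close>). This holds for matrices of any
  size that need not be selfadjoint. The equation for \<open>u\<close> is the upper right block of this formula for the
  block matrix with rows \<open>(R, R R\<^sup>*)\<close>, \<open>(0, R\<^sup>*)\<close>, which is itself a resolvent.

  Two analytic points remain. The resolvent exists because the \<open>Q\<close> block of the
  linearization is invertible and the linearization is selfadjoint; this is used as a lower bound for the pencil.
  The imaginary part \<open>Im z e\<^sub>1\<^sub>1\<close> is only semidefinite, so the Neumann series that
  carries the Schwinger--Dyson equation from polynomials to resolvents is applied after adding \<open>\<plusminus> \<i> y\<close>, and then \<open>y\<close>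
  tends to \<open>0\<close> (\<open>Schwinger_Dyson_pair\<close>).
\<close>

section \<open>Bounded operators as a Banach algebra\<close>

lemmas bop_eq_iff = app_inject[symmetric] fun_eq_iff
lemmas app_simps [simp] = plus_bop.rep_eq uminus_bop.rep_eq minus_bop.rep_eq
    times_bop.rep_eq zero_bop.rep_eq one_bop.rep_eq scaleC_bop.rep_eq

lemma bop_eqI: "(\<And>x. app a x = app b x) \<Longrightarrow> a = b"
  by (simp add: bop_eq_iff)

lemma bounded_linear_app: "bounded_linear (app a)"
  using app[of a] by simp

lemma app_scaleC: "app a (c *\<^sub>C x) = c *\<^sub>C app a x"
  using app[of a] by simp

lemma app_zero [simp]: "app a 0 = 0"
  and app_sum: "app a (sum f I) = (\<Sum>i\<in>I. app a (f i))"
  using bounded_linear_app[of a] by (simp_all add: linear_simps bounded_linear.linear linear_sum)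

lemma scaleC_zero_left [simp]: "0 *\<^sub>C (x::'a::complex_hilbert_space) = 0"
  using scaleC_of_real[of 0 x] by simp

lemma scaleC_one [simp]: "1 *\<^sub>C (x::'a::complex_hilbert_space) = x"
  using scaleC_of_real[of 1 x] by simp

lemma scaleC_minus1: "(- 1) *\<^sub>C (x::'a::complex_hilbert_space) = - x"
  using scaleC_of_real[of "-1" x] by simp

lemma scaleC_minus_left: "(- c) *\<^sub>C (x::'a::complex_hilbert_space) = - (c *\<^sub>C x)"
  using scaleC_scaleC[of "-1" c x] by (simp add: scaleC_minus1)

lemma scaleC_bop_simps:
  fixes a b :: "'h::complex_hilbert_space bop"
  shows "c *\<^sub>C (a + b) = c *\<^sub>C a + c *\<^sub>C b" "(c + e) *\<^sub>C a = c *\<^sub>C a + e *\<^sub>C a"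
    "c *\<^sub>C (e *\<^sub>C a) = (c * e) *\<^sub>C a" "(c *\<^sub>C a) * b = c *\<^sub>C (a * b)" "a * (c *\<^sub>C b) = c *\<^sub>C (a * b)"
    "1 *\<^sub>C a = a" "0 *\<^sub>C a = 0" "c *\<^sub>C (0::'h bop) = 0"
    "(- c) *\<^sub>C a = - (c *\<^sub>C a)" "c *\<^sub>C (- a) = - (c *\<^sub>C a)"
    "(c - e) *\<^sub>C a = c *\<^sub>C a - e *\<^sub>C a" "c *\<^sub>C (a - b) = c *\<^sub>C a - c *\<^sub>C b"
proof -
  show 1: "c *\<^sub>C (a + b) = c *\<^sub>C a + c *\<^sub>C b" for c and a b :: "'h bop"
    by (rule bop_eqI) (simp add: scaleC_add_right)
  show 2: "(c + e) *\<^sub>C a = c *\<^sub>C a + e *\<^sub>C a" for c e and a :: "'h bop"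
    by (rule bop_eqI) (simp add: scaleC_add_left)
  show 3: "(- c) *\<^sub>C a = - (c *\<^sub>C a)" for c and a :: "'h bop"
    by (rule bop_eqI) (simp add: scaleC_minus_left)
  show 4: "c *\<^sub>C (- a) = - (c *\<^sub>C a)" for c and a :: "'h bop"
    by (rule bop_eqI) (simp add: scaleC_minus_right)
  show "(c - e) *\<^sub>C a = c *\<^sub>C a - e *\<^sub>C a" using 2[of c "-e" a] 3 by simp
  show "c *\<^sub>C (a - b) = c *\<^sub>C a - c *\<^sub>C b" using 1[of c a "-b"] 4 by simp
qed (rule bop_eqI; simp add: scaleC_scaleC app_scaleC scaleC_zero_right)+

lemma scaleC_sum_right: "c *\<^sub>C (\<Sum>i\<in>I. f i) = (\<Sum>i\<in>I. c *\<^sub>C (f i :: 'h::complex_hilbert_space bop))"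
  by (induction I rule: infinite_finite_induct) (simp_all add: scaleC_bop_simps)

lemma app_sum_left: "app (\<Sum>i\<in>I. f i) x = (\<Sum>i\<in>I. app (f i) x)"
  by (induction I rule: infinite_finite_induct) simp_all

instantiation bop :: (complex_hilbert_space) real_normed_algebra_1
begin

definition scaleR_bop :: "real \<Rightarrow> 'a bop \<Rightarrow> 'a bop" where
  "scaleR_bop r a = complex_of_real r *\<^sub>C a"
definition norm_bop :: "'a bop \<Rightarrow> real" where
  "norm_bop a = onorm (app a)"
definition dist_bop :: "'a bop \<Rightarrow> 'a bop \<Rightarrow> real" where
  "dist_bop a b = norm (a - b)"
definition sgn_bop :: "'a bop \<Rightarrow> 'a bop" where
  "sgn_bop a = inverse (norm a) *\<^sub>R a"
definition uniformity_bop :: "('a bop \<times> 'a bop) filter" where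
  "uniformity_bop = (INF e\<in>{0<..}. principal {(x, y). dist x y < e})"
definition open_bop :: "'a bop set \<Rightarrow> bool" where
  "open_bop U = (\<forall>x\<in>U. \<forall>\<^sub>F (x', y) in uniformity. x' = x \<longrightarrow> y \<in> U)"

instance
proof
  fix a b c :: "'a bop" and r q :: real
  have le: "norm (app a x) \<le> norm a * norm x" for a :: "'a bop" and x
    unfolding norm_bop_def by (rule onorm[OF bounded_linear_app])
  show "r *\<^sub>R (a + b) = r *\<^sub>R a + r *\<^sub>R b" "(r + q) *\<^sub>R a = r *\<^sub>R a + q *\<^sub>R a"
    "r *\<^sub>R q *\<^sub>R a = (r * q) *\<^sub>R a" "1 *\<^sub>R a = a"
    "r *\<^sub>R a * b = r *\<^sub>R (a * b)" "a * r *\<^sub>R b = r *\<^sub>R (a * b)"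
    by (simp_all add: scaleR_bop_def scaleC_bop_simps)
  show "dist a b = norm (a - b)" by (rule dist_bop_def)
  show "sgn a = inverse (norm a) *\<^sub>R a" by (rule sgn_bop_def)
  show "uniformity = (INF e\<in>{0<..}. principal {(x::'a bop, y). dist x y < e})"
    by (rule uniformity_bop_def)
  show "open U = (\<forall>x\<in>U. \<forall>\<^sub>F (x', y) in uniformity. x' = x \<longrightarrow> y \<in> U)" for U :: "'a bop set"
    by (rule open_bop_def)
  show "(norm a = 0) = (a = 0)"
    unfolding norm_bop_def onorm_eq_0[OF bounded_linear_app] by (simp add: bop_eq_iff)
  show "norm (a + b) \<le> norm a + norm b"
  proof -
    have "onorm (\<lambda>x. app a x + app b x) \<le> onorm (app a) + onorm (app b)"
      by (rule onorm_triangle[OF bounded_linear_app bounded_linear_app])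
    moreover have "app (a + b) = (\<lambda>x. app a x + app b x)" by (simp add: fun_eq_iff)
    ultimately show ?thesis by (simp add: norm_bop_def)
  qed
  show "norm (r *\<^sub>R a) = \<bar>r\<bar> * norm a"
  proof -
    have "app (r *\<^sub>R a) = (\<lambda>x. r *\<^sub>R app a x)" by (simp add: scaleR_bop_def fun_eq_iff scaleC_of_real)
    then show ?thesis using onorm_scaleR[OF bounded_linear_app[of a], of r] by (simp add: norm_bop_def)
  qed
  show "norm (a * b) \<le> norm a * norm b"
  proof -
    have "app (a * b) = app a \<circ> app b" by (simp add: fun_eq_iff)
    then show ?thesis using onorm_compose[OF bounded_linear_app bounded_linear_app, of a b]
      by (simp add: norm_bop_def)
  qed
  obtain x0 :: 'a where x0: "x0 \<noteq> 0" using nontrivial by blast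
  show "norm (1 :: 'a bop) = 1"
  proof (rule antisym)
    show "norm (1 :: 'a bop) \<le> 1" unfolding norm_bop_def by (rule onorm_bound) simp_all
    show "1 \<le> norm (1 :: 'a bop)" using le[of 1 x0] x0 by simp
  qed
qed

end

text \<open>Completeness is inherited from the bounded linear maps: a norm limit of complex linear maps is
  complex linear.\<close>

instance bop :: (complex_hilbert_space) banach
proof
  fix X :: "nat \<Rightarrow> 'a bop" assume X: "Cauchy X"
  have bl: "blinfun_apply (Blinfun (app a)) = app a" for a :: "'a bop"
    by (rule bounded_linear_Blinfun_apply[OF bounded_linear_app])
  have nb: "norm (Blinfun (app a) - Blinfun (app b)) = norm (a - b)" for a b :: "'a bop"
  proof -
    have "blinfun_apply (Blinfun (app a) - Blinfun (app b)) = app (a - b)"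
      by (simp add: fun_eq_iff blinfun.bilinear_simps bl)
    then show ?thesis by (simp add: norm_bop_def norm_blinfun.rep_eq)
  qed
  have "Cauchy (\<lambda>n. Blinfun (app (X n)))"
    using X unfolding Cauchy_def dist_norm nb .
  then obtain F where F: "(\<lambda>n. Blinfun (app (X n))) \<longlonglongrightarrow> F"
    using Cauchy_convergent convergent_def by blast
  have pt: "(\<lambda>n. app (X n) x) \<longlonglongrightarrow> blinfun_apply F x" for x
    using bounded_linear.tendsto[OF blinfun.bounded_linear_left F, of x]
    by (simp add: bl)
  have hom: "blinfun_apply F (c *\<^sub>C x) = c *\<^sub>C blinfun_apply F x" for c x
  proof (rule LIMSEQ_unique[OF pt])
    show "(\<lambda>n. app (X n) (c *\<^sub>C x)) \<longlonglongrightarrow> c *\<^sub>C blinfun_apply F x"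
      unfolding app_scaleC by (rule bounded_linear.tendsto[OF bounded_linear_scaleC pt])
  qed
  define A where "A = Bop (blinfun_apply F)"
  have A: "app A = blinfun_apply F"
    unfolding A_def by (rule Bop_inverse) (simp add: blinfun.bounded_linear_right hom)
  have "Blinfun (app A) = F" by (simp add: A blinfun_apply_inverse)
  then have "(\<lambda>n. norm (X n - A)) \<longlonglongrightarrow> 0"
    using F unfolding tendsto_iff dist_norm nb[symmetric] by (simp)
  then have "X \<longlonglongrightarrow> A"
    unfolding tendsto_iff dist_norm by simp
  then show "convergent X" by (auto simp: convergent_def)
qed

lemma norm_app: "norm (app a x) \<le> norm a * norm x"
  unfolding norm_bop_def by (rule onorm[OF bounded_linear_app])

lemma norm_bop_le:
  fixes a :: "'h::complex_hilbert_space bop"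
  assumes "\<And>x. norm (app a x) \<le> K * norm x"
  shows "norm a \<le> K"
proof -
  obtain x0 :: 'h where x0: "x0 \<noteq> 0" using nontrivial by blast
  have "0 \<le> K * norm x0" using assms[of x0] norm_ge_zero[of "app a x0"] by linarith
  then have "0 \<le> K" using x0 by (simp add: zero_le_mult_iff)
  then show ?thesis unfolding norm_bop_def by (rule onorm_bound) (rule assms)
qed

lemma norm_scaleC_bop: "norm (c *\<^sub>C a) = cmod c * norm (a::'h::complex_hilbert_space bop)"
proof -
  have le: "norm (c *\<^sub>C a) \<le> cmod c * norm a" for c and a :: "'h bop"
    by (rule norm_bop_le) (simp add: norm_scaleC mult.assoc mult_left_mono norm_app)
  show ?thesis
  proof (cases "c = 0")
    case False
    have "norm a = norm (inverse c *\<^sub>C (c *\<^sub>C a))" using False by (simp add: scaleC_bop_simps)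
    also have "\<dots> \<le> cmod (inverse c) * norm (c *\<^sub>C a)" by (rule le)
    finally have "cmod c * norm a \<le> norm (c *\<^sub>C a)" using False by (simp add: norm_inverse norm_divide field_simps)
    then show ?thesis using le[of c a] by simp
  qed (simp add: scaleC_bop_simps)
qed

lemma bounded_linear_app_left: "bounded_linear (\<lambda>a. app a x)"
  by (rule bounded_linear_intro[of _ "norm x"])
    (simp_all add: scaleR_bop_def scaleC_of_real norm_app)

section \<open>Inner product and adjoints\<close>

lemma cinner_add_right: "cinner x (y + z) = cinner x y + cinner x z"
  by (metis cinner_add_left cinner_commute complex_cnj_add)

lemma cinner_scaleC_right: "cinner x (c *\<^sub>C y) = cnj c * cinner x y"
  by (metis cinner_commute cinner_scaleC_left complex_cnj_mult)

lemma cinner_zero_left [simp]: "cinner 0 y = 0"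
  using cinner_add_left[of 0 0 y] by simp

lemma cinner_zero_right [simp]: "cinner y 0 = 0"
  using cinner_add_right[of y 0 0] by simp

lemma cinner_minus_left: "cinner (- x) y = - cinner x y"
  using cinner_add_left[of x "-x" y] by (simp add: add_eq_0_iff2 add_eq_0_iff)

lemma cinner_minus_right: "cinner y (- x) = - cinner y x"
  using cinner_add_right[of y x "-x"] by (simp add: add_eq_0_iff2 add_eq_0_iff)

lemma cinner_diff_left: "cinner (x - z) y = cinner x y - cinner z y"
  using cinner_add_left[of x "-z" y] by (simp add: cinner_minus_left)

lemma cinner_diff_right: "cinner y (x - z) = cinner y x - cinner y z"
  using cinner_add_right[of y x "-z"] by (simp add: cinner_minus_right)

lemma cinner_sum_left: "cinner (\<Sum>i\<in>I. f i) y = (\<Sum>i\<in>I. cinner (f i) y)"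
  by (induction I rule: infinite_finite_induct) (simp_all add: cinner_add_left)

lemma cmod_cinner_le: "cmod (cinner x y) \<le> norm x * norm y"
proof (cases "y = 0")
  case False
  define c where "c = cinner x y / complex_of_real ((norm y)\<^sup>2)"
  have ny: "complex_of_real ((norm y)\<^sup>2) \<noteq> 0" using False by simp
  have "cinner (x - c *\<^sub>C y) (x - c *\<^sub>C y)
    = cinner x x - cnj c * cinner x y - c * (cnj (cinner x y) - cnj c * cinner y y)"
    by (simp add: cinner_diff_left cinner_diff_right cinner_scaleC_left cinner_scaleC_right
        cinner_commute[of y x] algebra_simps)
  also have "cnj c * cinner y y = cnj (cinner x y)"
    using ny by (simp add: c_def cinner_self)
  also have "cnj c * cinner x y = complex_of_real ((cmod (cinner x y))\<^sup>2 / (norm y)\<^sup>2)"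
    by (simp only: c_def of_real_divide complex_norm_square) (simp add: mult.commute)
  finally have "complex_of_real ((norm (x - c *\<^sub>C y))\<^sup>2) =
      complex_of_real ((norm x)\<^sup>2 - (cmod (cinner x y))\<^sup>2 / (norm y)\<^sup>2)"
    by (simp only: cinner_self) simp
  then have "(norm (x - c *\<^sub>C y))\<^sup>2 = (norm x)\<^sup>2 - (cmod (cinner x y))\<^sup>2 / (norm y)\<^sup>2"
    by (simp only: of_real_eq_iff)
  then have "(cmod (cinner x y))\<^sup>2 / (norm y)\<^sup>2 \<le> (norm x)\<^sup>2"
    by (smt (verit) zero_le_power2)
  then have "(cmod (cinner x y))\<^sup>2 \<le> (norm x * norm y)\<^sup>2"
    using False by (simp add: field_simps power_mult_distrib)
  then show ?thesis by (rule power2_le_imp_le) simp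
qed simp

lemma cinner_ext: "(\<And>y. cinner x y = cinner z y) \<Longrightarrow> x = (z::'h::complex_hilbert_space)"
proof -
  assume "\<And>y. cinner x y = cinner z y"
  then have "cinner (x - z) (x - z) = 0" by (simp only: cinner_diff_left) simp
  then show "x = z" by (simp add: cinner_self)
qed

lemma is_adjoint_sym: "is_adjoint a b \<Longrightarrow> is_adjoint b a"
  unfolding is_adjoint_def by (metis cinner_commute)

lemma is_adjoint_unique: "is_adjoint a b \<Longrightarrow> is_adjoint a c \<Longrightarrow> b = c"
proof (rule bop_eqI, rule cinner_ext)
  fix x y assume "is_adjoint a b" "is_adjoint a c"
  then have "cinner (app b x) y = cnj (cinner (app a y) x)" "cinner (app c x) y = cnj (cinner (app a y) x)"
    unfolding is_adjoint_def by (metis cinner_commute)+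
  then show "cinner (app b x) y = cinner (app c x) y" by simp
qed

lemma is_adjoint_add: "is_adjoint a b \<Longrightarrow> is_adjoint c e \<Longrightarrow> is_adjoint (a + c) (b + e)"
  by (simp add: is_adjoint_def cinner_add_left cinner_add_right)
lemma is_adjoint_diff: "is_adjoint a b \<Longrightarrow> is_adjoint c e \<Longrightarrow> is_adjoint (a - c) (b - e)"
  by (simp add: is_adjoint_def cinner_diff_left cinner_diff_right)
lemma is_adjoint_mult: "is_adjoint a b \<Longrightarrow> is_adjoint c e \<Longrightarrow> is_adjoint (a * c) (e * b)"
  by (simp add: is_adjoint_def)
lemma is_adjoint_scaleC: "is_adjoint a b \<Longrightarrow> is_adjoint (c *\<^sub>C a) (cnj c *\<^sub>C b)"
  by (simp add: is_adjoint_def cinner_scaleC_left cinner_scaleC_right)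
lemma is_adjoint_one: "is_adjoint 1 1"
  and is_adjoint_zero: "is_adjoint 0 0"
  by (simp_all add: is_adjoint_def)
lemma is_adjoint_sum: "(\<And>i. i \<in> I \<Longrightarrow> is_adjoint (f i) (g i)) \<Longrightarrow> is_adjoint (sum f I) (sum g I)"
  by (induction I rule: infinite_finite_induct) (simp_all add: is_adjoint_zero is_adjoint_add)
lemma is_adjoint_norm_le: assumes "is_adjoint a b" shows "norm b \<le> norm a"
proof (rule norm_bop_le)
  fix x
  have "complex_of_real ((norm (app b x))\<^sup>2) = cinner (app a (app b x)) x"
    using assms by (simp only: cinner_self[symmetric] is_adjoint_def)
  then have "(norm (app b x))\<^sup>2 = cmod (cinner (app a (app b x)) x)"
    by (metis norm_of_real abs_of_nonneg zero_le_power2)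
  also have "\<dots> \<le> norm (app a (app b x)) * norm x" by (rule cmod_cinner_le)
  also have "\<dots> \<le> norm a * norm (app b x) * norm x" by (intro mult_right_mono norm_app) simp
  finally have "norm (app b x) * norm (app b x) \<le> norm (app b x) * (norm a * norm x)"
    by (simp add: power2_eq_square mult_ac)
  then show "norm (app b x) \<le> norm a * norm x"
    by (cases "app b x = 0") (simp_all add: mult_nonneg_nonneg)
qed

lemma closed_selfadjoint: "closed (Collect selfadjoint)"
unfolding closed_sequential_limits
proof safe
  fix X :: "nat \<Rightarrow> 'a bop" and A assume X: "\<forall>n. X n \<in> Collect selfadjoint" and lim: "X \<longlonglongrightarrow> A"
  have c1: "bounded_linear (\<lambda>x. cinner x y)" for y :: 'a
    by (rule bounded_linear_intro[of _ "norm y"])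
      (simp_all add: cinner_add_left cmod_cinner_le scaleR_conv_of_real cinner_scaleC_left flip: scaleC_of_real[where 'a='a])
  have c2: "bounded_linear (\<lambda>y. cinner x y)" for x :: 'a
    by (rule bounded_linear_intro[of _ "norm x"])
      (simp_all add: cinner_add_right cmod_cinner_le[THEN order_trans[OF _ eq_refl[OF mult.commute]]]
        cinner_scaleC_right scaleR_conv_of_real flip: scaleC_of_real[where 'a='a])
  show "selfadjoint A" unfolding selfadjoint_def is_adjoint_def
  proof (intro allI)
    fix x y
    have "(\<lambda>n. app (X n) z) \<longlonglongrightarrow> app A z" for z
      by (rule bounded_linear.tendsto[OF bounded_linear_app_left lim])
    then have "(\<lambda>n. cinner (app (X n) x) y) \<longlonglongrightarrow> cinner (app A x) y"
      "(\<lambda>n. cinner x (app (X n) y)) \<longlonglongrightarrow> cinner x (app A y)"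
      by (auto intro: bounded_linear.tendsto[OF c1] bounded_linear.tendsto[OF c2])
    moreover have "cinner (app (X n) x) y = cinner x (app (X n) y)" for n
      using X by (auto simp: selfadjoint_def is_adjoint_def)
    ultimately show "cinner (app A x) y = cinner x (app A y)"
      using LIMSEQ_unique by fastforce
  qed
qed

section \<open>States on von Neumann algebras\<close>

locale wstar_space =
  fixes M :: "'h::complex_hilbert_space bop set" and \<phi> :: "'h bop \<Rightarrow> complex"
  assumes wstar: "wstar_probability_space M \<phi>"
begin

lemma M_bicommutant: "M = commutant (commutant M)"
  using wstar unfolding wstar_probability_space_def von_neumann_algebra_def by simp

lemma M_iff: "x \<in> M \<longleftrightarrow> (\<forall>y\<in>commutant M. x * y = y * x)"
  by (subst M_bicommutant) (simp add: commutant_def)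

lemma M_one [simp]: "1 \<in> M" and M_zero [simp]: "0 \<in> M"
  by (simp_all add: M_iff)

lemma M_add [simp]: "a \<in> M \<Longrightarrow> b \<in> M \<Longrightarrow> a + b \<in> M"
  by (simp add: M_iff algebra_simps)
lemma M_minus [simp]: "a \<in> M \<Longrightarrow> - a \<in> M"
  by (simp add: M_iff)
lemma M_diff [simp]: "a \<in> M \<Longrightarrow> b \<in> M \<Longrightarrow> a - b \<in> M"
  by (simp add: M_iff algebra_simps)
lemma M_scaleC [simp]: "a \<in> M \<Longrightarrow> c *\<^sub>C a \<in> M"
  by (simp add: M_iff scaleC_bop_simps)
lemma M_mult [simp]:
  assumes "a \<in> M" "b \<in> M" shows "a * b \<in> M"
  unfolding M_iff
proof
  fix y assume "y \<in> commutant M"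
  then have "a * y = y * a" "b * y = y * b" using assms by (auto simp: M_iff)
  then show "a * b * y = y * (a * b)" by (metis mult.assoc)
qed
lemma M_power [simp]: "a \<in> M \<Longrightarrow> a ^ k \<in> M"
  by (induction k) simp_all
lemma M_sum [simp]: "(\<And>i. i \<in> I \<Longrightarrow> f i \<in> M) \<Longrightarrow> sum f I \<in> M"
  by (induction I rule: infinite_finite_induct) simp_all

lemma closed_M: "closed M"
proof -
  have "M = (\<Inter>y\<in>commutant M. {x. x * y = y * x})" by (auto simp: M_iff)
  moreover have "closed (\<Inter>y\<in>commutant M. {x. x * y = y * x})"
    by (intro closed_INT ballI closed_Collect_eq continuous_intros)
  ultimately show ?thesis by simp
qed

lemma M_adjoint: "a \<in> M \<Longrightarrow> \<exists>b\<in>M. is_adjoint a b"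
  using wstar unfolding wstar_probability_space_def von_neumann_algebra_def by blast

lemma phi_add: "a \<in> M \<Longrightarrow> b \<in> M \<Longrightarrow> \<phi> (a + b) = \<phi> a + \<phi> b"
  and phi_scaleC: "a \<in> M \<Longrightarrow> \<phi> (c *\<^sub>C a) = c * \<phi> a"
  and phi_pos: "a \<in> M \<Longrightarrow> b \<in> M \<Longrightarrow> is_adjoint a b \<Longrightarrow> \<phi> (b * a) \<in> \<real>\<^sub>\<ge>\<^sub>0"
  and phi_one [simp]: "\<phi> 1 = 1"
  and phi_trace: "a \<in> M \<Longrightarrow> b \<in> M \<Longrightarrow> \<phi> (a * b) = \<phi> (b * a)"
  using wstar unfolding wstar_probability_space_def state_on_def tracial_on_def by blast+

lemma phi_zero [simp]: "\<phi> 0 = 0"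
  using phi_scaleC[of 0 0] by (simp add: scaleC_bop_simps)
lemma phi_minus: "a \<in> M \<Longrightarrow> \<phi> (- a) = - \<phi> a"
  using phi_scaleC[of a "-1"] by (simp add: scaleC_bop_simps)
lemma phi_diff: "a \<in> M \<Longrightarrow> b \<in> M \<Longrightarrow> \<phi> (a - b) = \<phi> a - \<phi> b"
  using phi_add[of a "- b"] by (simp add: phi_minus)
lemma phi_sum: "(\<And>i. i \<in> I \<Longrightarrow> f i \<in> M) \<Longrightarrow> \<phi> (sum f I) = (\<Sum>i\<in>I. \<phi> (f i))"
  by (induction I rule: infinite_finite_induct) (simp_all add: phi_add)

lemma phi_pos_Re:
  assumes "a \<in> M" "b \<in> M" "is_adjoint a b"
  shows "\<phi> (b * a) = complex_of_real (Re (\<phi> (b * a)))" "0 \<le> Re (\<phi> (b * a))"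
  using phi_pos[OF assms] by (auto simp: complex_nonneg_Reals_iff complex_eq_iff)

lemma phi_adjoint:
  assumes "a \<in> M" "b \<in> M" "is_adjoint a b"
  shows "\<phi> b = cnj (\<phi> a)"
proof -
  have im: "Im (\<phi> (b * a)) = 0" by (subst phi_pos_Re[OF assms]) simp
  have "is_adjoint (1 + a) (1 + b)" by (intro is_adjoint_add is_adjoint_one assms)
  then have "Im (\<phi> ((1 + b) * (1 + a))) = 0"
    using phi_pos_Re(1)[of "1 + a" "1 + b"] assms by (metis Im_complex_of_real M_add M_one)
  then have 1: "Im (\<phi> a) + Im (\<phi> b) = 0"
    using assms im by (simp add: algebra_simps phi_add)
  have "is_adjoint (1 + \<i> *\<^sub>C a) (1 + cnj \<i> *\<^sub>C b)"
    by (intro is_adjoint_add is_adjoint_one is_adjoint_scaleC assms)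
  then have "Im (\<phi> ((1 + cnj \<i> *\<^sub>C b) * (1 + \<i> *\<^sub>C a))) = 0"
    using phi_pos_Re(1)[of "1 + \<i> *\<^sub>C a" "1 + cnj \<i> *\<^sub>C b"] assms
    by (metis Im_complex_of_real M_add M_one M_scaleC)
  moreover have "(1 + cnj \<i> *\<^sub>C b) * (1 + \<i> *\<^sub>C a) = 1 + \<i> *\<^sub>C a - \<i> *\<^sub>C b + b * a"
    by (simp add: algebra_simps scaleC_bop_simps)
  ultimately have "Re (\<phi> a) - Re (\<phi> b) = 0"
    using assms im by (simp add: phi_add phi_diff phi_scaleC)
  with 1 show ?thesis by (simp add: complex_eq_iff)
qed

text \<open>The positive quadratic polynomial is \<open>t \<mapsto> \<phi> ((a - t w b)\<^sup>* (a - t w b))\<close> with \<open>w = \<phi> (b\<^sup>* a)\<close>.\<close>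

lemma phi_Cauchy_Schwarz:
  assumes M: "a \<in> M" "a' \<in> M" "b \<in> M" "b' \<in> M" and adj: "is_adjoint a a'" "is_adjoint b b'"
  shows "(cmod (\<phi> (b' * a)))\<^sup>2 \<le> Re (\<phi> (b' * b)) * Re (\<phi> (a' * a))"
proof -
  define w A B where "w = \<phi> (b' * a)" and "A = Re (\<phi> (a' * a))" and "B = Re (\<phi> (b' * b))"
  have w': "\<phi> (a' * b) = cnj w"
    unfolding w_def using M adj by (intro phi_adjoint is_adjoint_mult) (auto intro: is_adjoint_sym)
  have A: "\<phi> (a' * a) = of_real A" "0 \<le> A" and B: "\<phi> (b' * b) = of_real B" "0 \<le> B"
    unfolding A_def B_def using phi_pos_Re[of a a'] phi_pos_Re[of b b'] M adj by auto
  have q: "0 \<le> A - 2 * t * (cmod w)\<^sup>2 + t\<^sup>2 * (cmod w)\<^sup>2 * B" for t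
  proof -
    define c where "c = of_real t * w"
    have "is_adjoint (a - c *\<^sub>C b) (a' - cnj c *\<^sub>C b')"
      by (intro is_adjoint_diff is_adjoint_scaleC adj)
    then have 0: "0 \<le> Re (\<phi> ((a' - cnj c *\<^sub>C b') * (a - c *\<^sub>C b)))"
      using M by (intro phi_pos_Re) auto
    have "(a' - cnj c *\<^sub>C b') * (a - c *\<^sub>C b)
      = a' * a - c *\<^sub>C (a' * b) - cnj c *\<^sub>C (b' * a) + (cnj c * c) *\<^sub>C (b' * b)"
      by (simp add: algebra_simps scaleC_bop_simps)
    then have "\<phi> ((a' - cnj c *\<^sub>C b') * (a - c *\<^sub>C b))
      = of_real A - c * cnj w - cnj c * w + cnj c * c * of_real B"
      using M by (simp add: phi_add phi_diff phi_scaleC w' A B w_def[symmetric])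
    also have "\<dots> = of_real (A - 2 * t * (cmod w)\<^sup>2 + t\<^sup>2 * (cmod w)\<^sup>2 * B)"
      unfolding of_real_add of_real_diff of_real_mult complex_norm_square
      by (simp add: c_def power2_eq_square algebra_simps)
    finally show ?thesis using 0 by simp
  qed
  have "(cmod w)\<^sup>2 \<le> B * A"
  proof (cases "B = 0")
    case True
    show ?thesis
    proof (rule ccontr)
      assume "\<not> ?thesis"
      then have "(cmod w)\<^sup>2 > 0" using True by auto
      then show False using q[of "(A + 1) / (2 * (cmod w)\<^sup>2)"] True by (simp add: field_simps)
    qed
  next
    case False
    then show ?thesis using q[of "1 / B"] B(2) by (simp add: field_simps power2_eq_square)
  qed
  then show ?thesis by (simp add: w_def A_def B_def)
qed

text \<open>For \<open>b = 1 - y\<close> the equation \<open>b b = 1 - h\<close> says that \<open>y\<close> is a fixed point of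
  \<open>y \<mapsto> (h + y y) / 2\<close>. On the ball of radius \<open>\<rho> = 1 - sqrt (1 - norm h)\<close> this map is a contraction with constant
  \<open>\<rho>\<close>, and it preserves the closed set of selfadjoint elements of \<open>M\<close>. Square roots are what turns the
  positivity of \<open>\<phi>\<close> on elements \<open>b\<^sup>* b\<close> into norm bounds.\<close>

lemma sqrt_one_minus:
  assumes h: "h \<in> M" "selfadjoint h" "norm h < 1"
  shows "\<exists>b\<in>M. selfadjoint b \<and> b * b = 1 - h"
proof -
  define \<rho> where "\<rho> = 1 - sqrt (1 - norm h)"
  have \<rho>: "0 \<le> \<rho>" "\<rho> < 1" using h(3) by (auto simp: \<rho>_def)
  have \<rho>2: "(norm h + \<rho>\<^sup>2) / 2 = \<rho>"
    using h(3) by (simp add: \<rho>_def power2_eq_square field_simps)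
  define S where "S = M \<inter> Collect selfadjoint \<inter> cball 0 \<rho>"
  define f where "f y = (1/2) *\<^sub>C (h + y * y)" for y :: "'h bop"
  have clS: "closed S" unfolding S_def
    by (intro closed_Int closed_M closed_selfadjoint closed_cball)
  have "\<exists>!y\<in>S. f y = y"
  proof (rule Banach_fix[OF complete_eq_closed[THEN iffD2, OF clS], where c = \<rho>])
    have "0 \<in> S" using \<rho> by (simp add: S_def selfadjoint_def is_adjoint_zero)
    then show "S \<noteq> {}" by blast
    show "0 \<le> \<rho>" "\<rho> < 1" by (fact \<rho>)+
    show "f ` S \<subseteq> S"
    proof (rule image_subsetI)
      fix y assume y: "y \<in> S"
      have sy: "is_adjoint y y" and ny: "norm y \<le> \<rho>" using y by (auto simp: S_def selfadjoint_def)
      have "is_adjoint (f y) (cnj (1/2) *\<^sub>C (h + y * y))" unfolding f_def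
        using h sy by (intro is_adjoint_scaleC is_adjoint_add is_adjoint_mult) (auto simp: selfadjoint_def)
      then have "selfadjoint (f y)" by (simp add: selfadjoint_def f_def)
      moreover have "norm (f y) \<le> \<rho>"
      proof -
        have "norm (y * y) \<le> \<rho>\<^sup>2" unfolding power2_eq_square
          using norm_mult_ineq[of y y] mult_mono[OF ny ny] \<rho> by simp
        then have "norm (h + y * y) \<le> norm h + \<rho>\<^sup>2" using norm_triangle_ineq[of h "y * y"] by simp
        then show ?thesis using \<rho>2 by (simp add: f_def norm_scaleC_bop)
      qed
      ultimately show "f y \<in> S" using y h by (auto simp: S_def f_def)
    qed
    show "dist (f x) (f y) \<le> \<rho> * dist x y" if "x \<in> S" "y \<in> S" for x y
    proof -
      have n: "norm x \<le> \<rho>" "norm y \<le> \<rho>" using that by (auto simp: S_def)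
      have "f x - f y = (1/2) *\<^sub>C (x * (x - y) + (x - y) * y)"
        by (simp add: f_def algebra_simps scaleC_bop_simps)
      moreover have "norm (x * (x - y) + (x - y) * y) \<le> \<rho> * norm (x - y) + norm (x - y) * \<rho>"
        by (intro norm_triangle_le add_mono order_trans[OF norm_mult_ineq] mult_mono n) (use \<rho> in auto)
      ultimately show ?thesis by (simp add: dist_norm norm_scaleC_bop)
    qed
  qed
  then obtain y where y: "y \<in> S" "f y = y" by blast
  have "y + y = 2 *\<^sub>C f y" using scaleC_bop_simps(2)[of 1 1 y] y by (simp add: scaleC_bop_simps)
  also have "\<dots> = h + y * y" by (simp add: f_def scaleC_bop_simps)
  finally have "(1 - y) * (1 - y) = 1 - h" by (simp add: algebra_simps)
  moreover have "selfadjoint (1 - y)" "1 - y \<in> M"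
    using y by (auto simp: S_def selfadjoint_def intro: is_adjoint_diff is_adjoint_one)
  ultimately show ?thesis by blast
qed

text \<open>For \<open>K > norm x\<close> the element \<open>1 - x\<^sup>* x / K\<^sup>2\<close> is a square \<open>b b\<close>, and \<open>\<phi> ((b p)\<^sup>* (b p)) \<ge> 0\<close> is the
  claim with \<open>K\<close> in place of \<open>norm x\<close>.\<close>

lemma phi_norm_bound:
  assumes M: "x \<in> M" "x' \<in> M" "p \<in> M" "p' \<in> M" and adj: "is_adjoint x x'" "is_adjoint p p'"
  shows "Re (\<phi> (p' * x' * x * p)) \<le> (norm x)\<^sup>2 * Re (\<phi> (p' * p))"
proof -
  have *: "Re (\<phi> (p' * x' * x * p)) \<le> K\<^sup>2 * Re (\<phi> (p' * p))" if K: "norm x < K" for K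
  proof -
    have K0: "0 < K" using K norm_ge_zero[of x] by linarith
    define h where "h = complex_of_real (1 / K\<^sup>2) *\<^sub>C (x' * x)"
    have "norm (x' * x) \<le> norm x * norm x"
      using norm_mult_ineq[of x' x] mult_right_mono[OF is_adjoint_norm_le[OF adj(1)], of "norm x"] by simp
    also have "\<dots> < K\<^sup>2" unfolding power2_eq_square using K by (intro mult_strict_mono) (use K0 in auto)
    finally have "norm h < 1" using K0 by (simp add: h_def norm_scaleC_bop norm_divide norm_power)
    moreover have "is_adjoint h (cnj (complex_of_real (1 / K\<^sup>2)) *\<^sub>C (x' * x))" unfolding h_def
      by (intro is_adjoint_scaleC is_adjoint_mult adj is_adjoint_sym[OF adj(1)])
    then have "selfadjoint h" by (simp add: selfadjoint_def h_def)
    moreover have hM: "h \<in> M" using M by (simp add: h_def)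
    ultimately obtain b where b: "b \<in> M" "selfadjoint b" "b * b = 1 - h"
      using sqrt_one_minus by blast
    have "is_adjoint (b * p) (p' * b)" using b adj by (intro is_adjoint_mult) (auto simp: selfadjoint_def)
    then have "0 \<le> Re (\<phi> ((p' * b) * (b * p)))" using b M by (intro phi_pos_Re) auto
    also have "(p' * b) * (b * p) = p' * (b * b) * p" by (simp add: mult.assoc)
    also have "\<dots> = p' * p - complex_of_real (1 / K\<^sup>2) *\<^sub>C (p' * x' * x * p)"
      unfolding b(3) h_def by (simp add: algebra_simps scaleC_bop_simps mult.assoc)
    finally show ?thesis using M K0 by (simp add: phi_diff phi_scaleC field_simps Re_divide_of_real)
  qed
  have "(\<lambda>n. (norm x + 1 / Suc n)\<^sup>2 * Re (\<phi> (p' * p))) \<longlonglongrightarrow> (norm x + 0)\<^sup>2 * Re (\<phi> (p' * p))"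
    by (intro tendsto_intros LIMSEQ_Suc[OF lim_inverse_n'])
  then show ?thesis
    by (rule LIMSEQ_le_const[where X="\<lambda>n. (norm x + 1 / Suc n)\<^sup>2 * Re (\<phi> (p' * p))", THEN order_trans[OF _ eq_refl]])
      (auto intro!: exI[of _ 0] *)
qed

lemma phi_sandwich_bound:
  assumes M: "x \<in> M" "p \<in> M" "p' \<in> M" "r \<in> M" "r' \<in> M" and adj: "is_adjoint p p'" "is_adjoint r r'"
  shows "(cmod (\<phi> (p' * x * r)))\<^sup>2 \<le> (norm x)\<^sup>2 * Re (\<phi> (p' * p)) * Re (\<phi> (r' * r))"
proof -
  obtain x' where x': "x' \<in> M" "is_adjoint x x'" using M_adjoint M by blast
  have "(cmod (\<phi> (p' * (x * r))))\<^sup>2 \<le> Re (\<phi> (p' * p)) * Re (\<phi> ((r' * x') * (x * r)))"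
    using M x' adj by (intro phi_Cauchy_Schwarz is_adjoint_mult) auto
  also have "\<dots> \<le> Re (\<phi> (p' * p)) * ((norm x)\<^sup>2 * Re (\<phi> (r' * r)))"
    using phi_norm_bound[OF M(1) x'(1) M(4,5) x'(2) adj(2)] phi_pos_Re(2)[OF M(2,3) adj(1)]
    by (intro mult_left_mono) (simp_all add: mult.assoc)
  finally show ?thesis by (simp add: mult_ac)
qed

lemma cmod_phi_le: assumes "x \<in> M" shows "cmod (\<phi> x) \<le> norm x"
  using phi_sandwich_bound[of x 1 1 1 1] assms by (simp add: is_adjoint_one power2_le_iff_abs_le)

lemma phi_tendsto:
  assumes "\<And>n. X n \<in> M" "X \<longlonglongrightarrow> x" shows "(\<lambda>n. \<phi> (X n)) \<longlonglongrightarrow> \<phi> x" "x \<in> M"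
proof -
  show x: "x \<in> M" using closed_sequentially[OF closed_M] assms by blast
  have "(\<lambda>n. norm (X n - x)) \<longlonglongrightarrow> 0" using assms(2) by (simp add: tendsto_norm_zero LIM_zero)
  then have "(\<lambda>n. \<phi> (X n - x)) \<longlonglongrightarrow> 0"
    by (rule Lim_null_comparison[rotated]) (simp add: cmod_phi_le x assms)
  then show "(\<lambda>n. \<phi> (X n)) \<longlonglongrightarrow> \<phi> x"
    by (subst LIM_zero_iff[symmetric]) (simp add: phi_diff x assms)
qed

lemma phi_summable:
  assumes "\<And>n. X n \<in> M" "summable (\<lambda>n. norm (X n))"
  shows "summable (\<lambda>n. norm (\<phi> (X n)))" "suminf X \<in> M" "(\<lambda>n. \<phi> (X n)) sums \<phi> (suminf X)"
proof -
  show "summable (\<lambda>n. norm (\<phi> (X n)))"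
    by (rule summable_comparison_test'[OF assms(2)]) (simp add: cmod_phi_le assms)
  have "(\<lambda>n. \<Sum>k<n. X k) \<longlonglongrightarrow> suminf X"
    using summable_LIMSEQ[OF summable_norm_cancel[OF assms(2)]] .
  from phi_tendsto[OF _ this] show "suminf X \<in> M" "(\<lambda>n. \<phi> (X n)) sums \<phi> (suminf X)"
    using assms(1) by (simp_all add: phi_sum sums_def)
qed

end

section \<open>The Schwinger--Dyson equation for a semicircular element\<close>

text \<open>The semicircle law enters only through the recursion of its moments, which is the
  Schwinger--Dyson equation for the powers of \<open>s\<close>.\<close>

locale free_semicircular = wstar_space M \<phi>
  for M :: "'h::complex_hilbert_space bop set" and \<phi> :: "'h bop \<Rightarrow> complex" +
  fixes s d :: "'h bop" and \<sigma> :: real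
  assumes s_M [simp]: "s \<in> M" and d_M [simp]: "d \<in> M"
    and d_sa: "selfadjoint d"
    and free: "freely_independent \<phi> s d"
    and moments: "\<phi> (s ^ Suc k) = of_real (\<sigma>\<^sup>2) * (\<Sum>i<k. \<phi> (s ^ i) * \<phi> (s ^ (k - 1 - i)))"
begin

lemma phi_s [simp]: "\<phi> s = 0"
  using moments[of 0] by simp

text \<open>A polynomial \<open>x\<close> in \<open>s\<close> with a bilinear form that stands for its free difference quotient: if
  \<open>\<partial> x = \<Sum> a \<otimes> b\<close>, then \<open>\<beta> p q = \<Sum> \<phi> (p a) \<phi> (b q)\<close>. Operators may satisfy algebraic relations, so
  \<open>\<beta>\<close> is carried along with \<open>x\<close> and is not asserted to be a function of \<open>x\<close>.\<close>

inductive sblk :: "'h bop \<Rightarrow> ('h bop \<Rightarrow> 'h bop \<Rightarrow> complex) \<Rightarrow> bool" where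
  sblk_one: "sblk 1 (\<lambda>p q. 0)"
| sblk_s: "sblk x \<beta> \<Longrightarrow> sblk (s * x) (\<lambda>p q. \<phi> p * \<phi> (x * q) + \<beta> (p * s) q)"
| sblk_add: "sblk x \<beta> \<Longrightarrow> sblk y \<gamma> \<Longrightarrow> sblk (x + y) (\<lambda>p q. \<beta> p q + \<gamma> p q)"
| sblk_scale: "sblk x \<beta> \<Longrightarrow> sblk (c *\<^sub>C x) (\<lambda>p q. c * \<beta> p q)"

lemma star_algebra_M: "a \<in> star_algebra_generated S \<Longrightarrow> S \<subseteq> M \<Longrightarrow> a \<in> M"
proof (induction rule: star_algebra_generated.induct)
  case (star a b)
  then obtain b' where "b' \<in> M" "is_adjoint a b'" using M_adjoint by blast
  then show ?case using is_adjoint_unique[of a b b'] star.hyps by simp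
qed auto

lemma sblk_alg: "sblk x \<beta> \<Longrightarrow> x \<in> star_algebra_generated {s}"
  by (induction rule: sblk.induct) (auto intro: star_algebra_generated.intros)

lemma sblk_M: "sblk x \<beta> \<Longrightarrow> x \<in> M"
  using sblk_alg star_algebra_M[of x "{s}"] by simp

lemma sblk_linear:
  assumes "sblk x \<beta>" "p \<in> M" "p' \<in> M" "q \<in> M"
  shows "\<beta> (p + p') q = \<beta> p q + \<beta> p' q" "\<beta> (c *\<^sub>C p) q = c * \<beta> p q"
  using assms
  by (induction arbitrary: p p' q rule: sblk.induct)
    (simp_all add: algebra_simps phi_add phi_scaleC scaleC_bop_simps)

text \<open>Constants have derivative zero, so an element may be centred without changing its form.\<close>

lemma sblk_shift: "sblk x \<beta> \<Longrightarrow> sblk (x - c *\<^sub>C 1) \<beta>"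
  using sblk_add[OF _ sblk_scale[OF sblk_one, of "-c"], of x \<beta>] by (simp add: scaleC_bop_simps)

text \<open>In \<open>\<partial> x = \<Sum> a \<otimes> b\<close> all tensor factors are polynomials in \<open>s\<close>.\<close>

lemma sblk_null_left:
  assumes "sblk x \<beta>" "p \<in> M" "\<And>a \<alpha>. sblk a \<alpha> \<Longrightarrow> \<phi> (p * a) = 0"
  shows "\<beta> p q = 0"
  using assms
proof (induction arbitrary: p q rule: sblk.induct)
  case (sblk_s x \<beta>)
  have "\<beta> (p * s) q = 0"
    by (rule sblk_s.IH) (use sblk_s.prems sblk.sblk_s in \<open>auto simp: mult.assoc\<close>)
  moreover have "\<phi> p = 0" using sblk_s.prems(2)[OF sblk_one] by simp
  ultimately show ?case by simp
qed simp_all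

lemma sblk_null_right:
  assumes "sblk x \<beta>" "q \<in> M" "\<And>a \<alpha>. sblk a \<alpha> \<Longrightarrow> \<phi> (a * q) = 0"
  shows "\<beta> p q = 0"
  using assms by (induction arbitrary: p q rule: sblk.induct) (simp_all)

text \<open>The extra power of \<open>s\<close> makes the induction work: moving a factor \<open>s\<close> from \<open>x\<close> into the power
  transfers one term of the Leibniz rule from \<open>\<beta>\<close> to the sum. The base case is the recursion of the moments.\<close>

lemma sblk_Schwinger_Dyson:
  assumes "sblk x \<beta>"
  shows "\<phi> (s ^ Suc k * x) = of_real (\<sigma>\<^sup>2) * ((\<Sum>i<k. \<phi> (s ^ i) * \<phi> (s ^ (k - 1 - i) * x)) + \<beta> (s ^ k) 1)"
  using assms
proof (induction arbitrary: k rule: sblk.induct)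
  case sblk_one
  then show ?case using moments[of k] by simp
next
  case (sblk_s x \<beta>)
  have "s ^ Suc k * (s * x) = s ^ Suc (Suc k) * x"
    by (simp add: mult.assoc power_commutes) (metis mult.assoc power_commutes)
  moreover have "s ^ (k - 1 - i) * (s * x) = s ^ (k - i) * x" if "i < k" for i
    using that by (metis Suc_diff_Suc diff_Suc_1 diff_diff_left mult.assoc plus_1_eq_Suc power_Suc2 add.commute)
  moreover have "s ^ k * s = s ^ Suc k" by (simp add: power_commutes)
  ultimately show ?case using sblk_s.IH[of "Suc k"] by (simp add: ac_simps)
next
  case (sblk_add x \<beta> y \<gamma>)
  then show ?case by (simp add: algebra_simps phi_add sblk_M sum.distrib)
next
  case (sblk_scale x \<beta> c)
  then show ?case
    by (simp add: algebra_simps scaleC_bop_simps phi_scaleC sblk_M sum_distrib_left)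
qed

text \<open>A block is a polynomial in \<open>s\<close> (flag \<open>True\<close>) or in \<open>d\<close> (flag \<open>False\<close>) with the form of its
  derivative, which vanishes on polynomials in \<open>d\<close>. The function \<open>lder\<close> is the Leibniz rule for the
  product of a list of blocks, and the products of reduced lists are those on which freeness makes \<open>\<phi>\<close> vanish.\<close>

type_synonym 'a block = "bool \<times> 'a \<times> ('a \<Rightarrow> 'a \<Rightarrow> complex)"

fun lprod :: "'h bop block list \<Rightarrow> 'h bop" where
  "lprod [] = 1"
| "lprod ((i, x, \<beta>) # bs) = x * lprod bs"

fun lder :: "'h bop block list \<Rightarrow> 'h bop \<Rightarrow> 'h bop \<Rightarrow> complex" where
  "lder [] = (\<lambda>p q. 0)"
| "lder ((i, x, \<beta>) # bs) = (\<lambda>p q. \<beta> p (lprod bs * q) + lder bs (p * x) q)"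

fun centred :: "'h bop block \<Rightarrow> bool" where
  "centred (i, x, \<beta>) \<longleftrightarrow> \<phi> x = 0 \<and>
    (if i then sblk x \<beta> else x \<in> star_algebra_generated {d} \<and> \<beta> = (\<lambda>p q. 0))"

definition reduced :: "'h bop block list \<Rightarrow> bool" where
  "reduced bs \<longleftrightarrow> (\<forall>b\<in>set bs. centred b) \<and> successively (\<noteq>) (map fst bs)"

lemma dalg_M: "x \<in> star_algebra_generated {d} \<Longrightarrow> x \<in> M"
  using star_algebra_M[of x "{d}"] by simp

lemma centred_M: "centred (i, x, \<beta>) \<Longrightarrow> x \<in> M"
  by (auto split: if_splits intro: sblk_M dalg_M)

lemma reduced_Nil [simp]: "reduced []"
  by (simp add: reduced_def)

lemma reduced_Cons:
  "reduced (b # bs) \<longleftrightarrow> centred b \<and> reduced bs \<and> (bs \<noteq> [] \<longrightarrow> fst b \<noteq> fst (hd bs))"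
  by (cases bs) (auto simp: reduced_def)

lemma reduced_snoc:
  "reduced (bs @ [b]) \<longleftrightarrow> reduced bs \<and> centred b \<and> (bs \<noteq> [] \<longrightarrow> fst (last bs) \<noteq> fst b)"
  by (auto simp: reduced_def successively_append_iff last_map)

lemma reduced_appendD: "reduced (as @ bs) \<Longrightarrow> reduced as \<and> reduced bs"
  by (auto simp: reduced_def successively_append_iff)

lemma lprod_append: "lprod (as @ bs) = lprod as * lprod bs"
  by (induction as rule: lprod.induct) (simp_all add: mult.assoc)

lemma lprod_M: "reduced bs \<Longrightarrow> lprod bs \<in> M"
  by (induction bs rule: lprod.induct) (auto simp: reduced_Cons simp del: centred.simps dest: centred_M)

lemma lder_linear:
  assumes "reduced bs" "p \<in> M" "p' \<in> M" "q \<in> M"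
  shows "lder bs (p + p') q = lder bs p q + lder bs p' q \<and> lder bs (c *\<^sub>C p) q = c * lder bs p q"
  using assms
proof (induction bs arbitrary: p p' q rule: lprod.induct)
  case (2 i x \<beta> bs)
  have x: "x \<in> M" and r: "reduced bs" "lprod bs \<in> M"
    using 2(2) by (auto simp: reduced_Cons simp del: centred.simps dest: centred_M lprod_M)
  have \<beta>: "\<beta> (p + p') q = \<beta> p q + \<beta> p' q" "\<beta> (c *\<^sub>C p) q = c * \<beta> p q" if "p \<in> M" "p' \<in> M" "q \<in> M" for p p' q
    using 2(2) sblk_linear[of x \<beta>] that by (auto simp: reduced_Cons split: if_splits)
  show ?case using x r 2(3-) "2.IH"[of "p * x" "p' * x" q]
    by (simp add: \<beta> algebra_simps scaleC_bop_simps)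
qed simp_all

lemma phi_reduced: assumes "reduced bs" "bs \<noteq> []" shows "\<phi> (lprod bs) = 0"
proof -
  define xs where "xs = map (\<lambda>(i, x, \<beta>). (i, x)) bs"
  have "prod_list (map snd xs) = lprod bs" unfolding xs_def
    by (induction bs rule: lprod.induct) simp_all
  moreover have "map fst xs = map fst bs" unfolding xs_def by (auto simp: case_prod_beta)
  moreover have "\<forall>(i, a)\<in>set xs. a \<in> star_algebra_generated {if i then s else d} \<and> \<phi> a = 0"
  proof (clarify, goal_cases)
    case (1 i a)
    then obtain \<beta> where "(i, a, \<beta>) \<in> set bs" by (auto simp: xs_def)
    then have "centred (i, a, \<beta>)" using assms by (auto simp: reduced_def)
    then show ?case by (auto split: if_splits intro: sblk_alg)
  qed
  moreover have "xs \<noteq> []" using assms by (simp add: xs_def)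
  moreover have "successively (\<noteq>) (map fst bs)" using assms by (simp add: reduced_def)
  moreover have "\<phi> (prod_list (map snd xs)) = 0" if "xs \<noteq> []"
    "\<forall>(i, a)\<in>set xs. a \<in> star_algebra_generated {if i then s else d} \<and> \<phi> a = 0"
    "successively (\<noteq>) (map fst xs)"
    using free that unfolding freely_independent_def free_algebras_def by blast
  ultimately show ?thesis by simp
qed

text \<open>The linear span of the reduced products, with their derivatives. Two forms are identified if they agree on
  \<open>M\<close>, the only place where \<open>\<phi>\<close> is linear.\<close>

inductive spanned :: "'h bop \<Rightarrow> ('h bop \<Rightarrow> 'h bop \<Rightarrow> complex) \<Rightarrow> bool" where
  spanned_reduced: "reduced bs \<Longrightarrow> spanned (lprod bs) (lder bs)"
| spanned_add: "spanned x \<beta> \<Longrightarrow> spanned y \<gamma> \<Longrightarrow> spanned (x + y) (\<lambda>p q. \<beta> p q + \<gamma> p q)"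
| spanned_scale: "spanned x \<beta> \<Longrightarrow> spanned (c *\<^sub>C x) (\<lambda>p q. c * \<beta> p q)"
| spanned_cong: "spanned x \<beta> \<Longrightarrow> (\<And>p q. p \<in> M \<Longrightarrow> q \<in> M \<Longrightarrow> \<beta> p q = \<gamma> p q) \<Longrightarrow> spanned x \<gamma>"

lemma spanned_M: "spanned x \<beta> \<Longrightarrow> x \<in> M"
  by (induction rule: spanned.induct) (auto intro: lprod_M)

lemma spanned_one: "spanned 1 (\<lambda>p q. 0)"
  using spanned_reduced[of "[]"] by simp

text \<open>If the first block is already a polynomial \<open>x\<close> in \<open>s\<close>, it is replaced by the centred part of \<open>s x\<close>, and the
  constant that is split off leaves a shorter reduced product. With the analogous \<open>spanned_d\<close> this shows that
  all polynomials in \<open>s\<close> and \<open>d\<close> are spanned.\<close>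

lemma spanned_s:
  assumes "spanned x \<beta>"
  shows "spanned (s * x) (\<lambda>p q. \<phi> p * \<phi> (x * q) + \<beta> (p * s) q)"
  using assms
proof (induction rule: spanned.induct)
  case (spanned_reduced bs)
  show ?case
  proof (cases "bs \<noteq> [] \<and> fst (hd bs)")
    case False
    define b where "b = (True, s * 1, \<lambda>p q. \<phi> p * \<phi> (1 * q) + 0)"
    have "sblk (s * 1) (\<lambda>p q. \<phi> p * \<phi> (1 * q) + 0)" by (rule sblk_s[OF sblk_one])
    then have "reduced (b # bs)" using spanned_reduced False by (auto simp: reduced_Cons b_def)
    from spanned.spanned_reduced[OF this] show ?thesis by (simp add: b_def)
  next
    case True
    then obtain x \<beta> rest where bs: "bs = (True, x, \<beta>) # rest" by (cases bs) auto
    define c where "c = \<phi> (s * x)"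
    define y where "y = s * x - c *\<^sub>C 1"
    define \<gamma> where "\<gamma> = (\<lambda>p q. \<phi> p * \<phi> (x * q) + \<beta> (p * s) q)"
    have x: "sblk x \<beta>" "x \<in> M" and rest: "reduced rest" "lprod rest \<in> M"
      using spanned_reduced by (auto simp: bs reduced_Cons lprod_M sblk_M)
    have "sblk y \<gamma>" unfolding y_def \<gamma>_def by (intro sblk_shift sblk_s x)
    moreover have "\<phi> y = 0" using x by (simp add: y_def phi_diff phi_scaleC c_def)
    ultimately have "reduced ((True, y, \<gamma>) # rest)" using spanned_reduced by (auto simp: bs reduced_Cons)
    note spanned_add[OF spanned.spanned_reduced[OF this] spanned_scale[OF spanned.spanned_reduced[OF rest(1)], of c]]
    moreover have "lprod ((True, y, \<gamma>) # rest) + c *\<^sub>C lprod rest = s * lprod bs"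
      by (simp add: bs y_def algebra_simps scaleC_bop_simps)
    moreover have "lder ((True, y, \<gamma>) # rest) p q + c * lder rest p q
       = \<phi> p * \<phi> (lprod bs * q) + lder bs (p * s) q" if "p \<in> M" "q \<in> M" for p q
    proof -
      have "p * s * x = p * y + c *\<^sub>C p" by (simp add: y_def algebra_simps scaleC_bop_simps)
      moreover have "lder rest (p * y + c *\<^sub>C p) q = lder rest (p * y) q + c * lder rest p q"
        using that rest x by (simp add: lder_linear y_def)
      ultimately show ?thesis by (simp add: bs \<gamma>_def mult.assoc)
    qed
    ultimately show ?thesis by (auto intro: spanned_cong)
  qed
next
  case (spanned_add x \<beta> y \<gamma>)
  show ?case unfolding distrib_left
    by (rule spanned_cong[OF spanned.spanned_add[OF spanned_add.IH]])
      (simp add: algebra_simps phi_add spanned_M[OF spanned_add.hyps(1)] spanned_M[OF spanned_add.hyps(2)])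
next
  case (spanned_scale x \<beta> c)
  show ?case unfolding scaleC_bop_simps
    by (rule spanned_cong[OF spanned.spanned_scale[OF spanned_scale.IH]])
      (simp add: algebra_simps phi_scaleC spanned_M[OF spanned_scale.hyps(1)])
next
  case (spanned_cong x \<beta> \<gamma>)
  show ?case by (rule spanned.spanned_cong[OF spanned_cong.IH]) (simp add: spanned_cong.hyps)
qed

lemma spanned_d:
  assumes "spanned x \<beta>"
  shows "spanned (d * x) (\<lambda>p q. \<beta> (p * d) q)"
  using assms
proof (induction rule: spanned.induct)
  case (spanned_reduced bs)
  define x rest where "x = (if bs \<noteq> [] \<and> \<not> fst (hd bs) then fst (snd (hd bs)) else 1)"
    and "rest = (if bs \<noteq> [] \<and> \<not> fst (hd bs) then tl bs else bs)"
  define c where "c = \<phi> (d * x)"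
  define y where "y = d * x - c *\<^sub>C 1"
  have x: "x \<in> star_algebra_generated {d}"
  proof (cases "bs \<noteq> [] \<and> \<not> fst (hd bs)")
    case True
    then obtain y \<beta> bs' where "bs = (False, y, \<beta>) # bs'" by (cases bs) auto
    then show ?thesis using spanned_reduced by (simp add: x_def reduced_Cons)
  next
    case False
    then show ?thesis unfolding x_def by (simp only: if_False star_algebra_generated.unit)
  qed
  note xM = dalg_M[OF x]
  have rest: "reduced rest" "lprod rest \<in> M"
    using spanned_reduced lprod_M by (auto simp: rest_def neq_Nil_conv reduced_Cons)
  have l: "lprod bs = x * lprod rest \<and> (\<forall>p q. lder bs p q = lder rest (p * x) q)"
  proof (cases "bs \<noteq> [] \<and> \<not> fst (hd bs)")
    case True
    then obtain y \<beta> bs' where "bs = (False, y, \<beta>) # bs'" by (cases bs) auto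
    then show ?thesis using spanned_reduced by (simp add: x_def rest_def reduced_Cons)
  next
    case False
    then show ?thesis unfolding x_def rest_def by (simp only: if_False mult_1_left mult_1_right simp_thms)
  qed
  have "y = d * x + (- c) *\<^sub>C 1" by (simp add: y_def scaleC_bop_simps)
  then have "y \<in> star_algebra_generated {d}"
    using star_algebra_generated.add[OF star_algebra_generated.mult[OF star_algebra_generated.gen x]
        star_algebra_generated.scale[OF star_algebra_generated.unit], of d "- c"] by simp
  moreover have "\<phi> y = 0" using xM by (simp add: y_def phi_diff phi_scaleC c_def)
  moreover have "rest \<noteq> [] \<longrightarrow> fst (hd rest)"
    using spanned_reduced by (cases bs) (auto simp: rest_def reduced_Cons)
  ultimately have "reduced ((False, y, \<lambda>p q. 0) # rest)" using rest by (auto simp: reduced_Cons)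
  note spanned_add[OF spanned.spanned_reduced[OF this] spanned_scale[OF spanned.spanned_reduced[OF rest(1)], of c]]
  moreover have "lprod ((False, y, \<lambda>p q. 0) # rest) + c *\<^sub>C lprod rest = d * lprod bs"
    by (simp add: l y_def algebra_simps scaleC_bop_simps)
  moreover have "lder ((False, y, \<lambda>p q. 0) # rest) p q + c * lder rest p q = lder bs (p * d) q"
    if "p \<in> M" "q \<in> M" for p q
  proof -
    have "p * d * x = p * y + c *\<^sub>C p" by (simp add: y_def algebra_simps scaleC_bop_simps)
    moreover have "lder rest (p * y + c *\<^sub>C p) q = lder rest (p * y) q + c * lder rest p q"
      using that rest xM by (simp add: lder_linear y_def)
    ultimately show ?thesis by (simp add: l)
  qed
  ultimately show ?case by (auto intro: spanned_cong)
next
  case (spanned_add x \<beta> y \<gamma>)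
  show ?case unfolding distrib_left by (rule spanned.spanned_add[OF spanned_add.IH])
next
  case (spanned_scale x \<beta> c)
  show ?case unfolding scaleC_bop_simps by (rule spanned.spanned_scale[OF spanned_scale.IH])
next
  case (spanned_cong x \<beta> \<gamma>)
  show ?case by (rule spanned.spanned_cong[OF spanned_cong.IH]) (simp add: spanned_cong.hyps)
qed

lemma phi_reduced_s:
  assumes "reduced as" "as \<noteq> []" "\<not> fst (last as)" "sblk a \<alpha>"
  shows "\<phi> (lprod as * a) = 0"
proof -
  define y where "y = a - \<phi> a *\<^sub>C 1"
  have a: "a \<in> M" using assms sblk_M by blast
  have "sblk y \<alpha>" "\<phi> y = 0" unfolding y_def using assms a by (auto simp: phi_diff phi_scaleC intro: sblk_shift)
  then have "reduced (as @ [(True, y, \<alpha>)])" using assms by (auto simp: reduced_snoc)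
  then have "\<phi> (lprod (as @ [(True, y, \<alpha>)])) = 0" by (rule phi_reduced) simp
  then have "\<phi> (lprod as * y) = 0" by (simp add: lprod_append)
  moreover have "lprod as * a = lprod as * y + \<phi> a *\<^sub>C lprod as"
    by (simp add: y_def algebra_simps scaleC_bop_simps)
  ultimately show ?thesis
    using phi_reduced[OF assms(1,2)] lprod_M[OF assms(1)] a by (simp add: phi_add phi_scaleC y_def)
qed

lemma phi_s_reduced:
  assumes "reduced bs" "bs \<noteq> []" "\<not> fst (hd bs)" "sblk a \<alpha>"
  shows "\<phi> (a * lprod bs) = 0"
proof -
  define y where "y = a - \<phi> a *\<^sub>C 1"
  have a: "a \<in> M" using assms sblk_M by blast
  have "sblk y \<alpha>" "\<phi> y = 0" unfolding y_def using assms a by (auto simp: phi_diff phi_scaleC intro: sblk_shift)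
  then have "reduced ((True, y, \<alpha>) # bs)" using assms by (auto simp: reduced_Cons)
  then have "\<phi> (lprod ((True, y, \<alpha>) # bs)) = 0" by (rule phi_reduced) simp
  moreover have "a * lprod bs = y * lprod bs + \<phi> a *\<^sub>C lprod bs"
    by (simp add: y_def algebra_simps scaleC_bop_simps)
  ultimately show ?thesis
    using phi_reduced[OF assms(1,2)] lprod_M[OF assms(1)] a by (simp add: phi_add phi_scaleC y_def)
qed

text \<open>Each term of the Leibniz rule has as left factor \<open>\<phi>\<close> of a reduced product ending in a block of \<open>d\<close>, times a
  polynomial \<open>a\<close> in \<open>s\<close>; after centring \<open>a\<close> this is zero by freeness.\<close>

lemma lder_reduced_null:
  "reduced (as @ bs) \<Longrightarrow> as \<noteq> [] \<Longrightarrow> lder bs (lprod as) 1 = 0"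
proof (induction bs arbitrary: as rule: lprod.induct)
  case (2 i x \<beta> bs)
  have as: "reduced as" and c: "centred (i, x, \<beta>)" "i \<noteq> fst (last as)"
    using 2(2,3) reduced_appendD[of "as @ [(i, x, \<beta>)]" bs] by (auto simp: reduced_snoc)
  have "lder bs (lprod (as @ [(i, x, \<beta>)])) 1 = 0" using 2(2) by (intro "2.IH") auto
  moreover have "\<beta> (lprod as) (lprod bs * 1) = 0"
  proof (cases i)
    case True
    then show ?thesis using c phi_reduced_s[OF as 2(3)] lprod_M[OF as]
      by (intro sblk_null_left[of x \<beta>]) auto
  qed (use c in auto)
  ultimately show ?case by (simp add: lprod_append)
qed simp

text \<open>It suffices to consider reduced products. By freeness both sides vanish unless the product is empty or a
  single block of \<open>s\<close>: on the left after centring \<open>s x\<close> for the first block \<open>x\<close>, on the right because one of the two tensor factors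
  is, up to a constant, a nonempty reduced product.\<close>

lemma Schwinger_Dyson: "spanned x \<beta> \<Longrightarrow> \<phi> (s * x) = of_real (\<sigma>\<^sup>2) * \<beta> 1 1"
proof (induction rule: spanned.induct)
  case (spanned_reduced bs)
  show ?case
  proof (cases bs)
    case (Cons b rest)
    obtain i x \<beta> where b: "b = (i, x, \<beta>)" by (cases b)
    have 0: "lder rest (1 * x) 1 = 0"
      using lder_reduced_null[of "[b]" rest] spanned_reduced by (simp add: Cons b)
    have r: "reduced rest" "x \<in> M" "lprod rest \<in> M" and c: "centred (i, x, \<beta>)"
      using spanned_reduced centred_M lprod_M by (auto simp: Cons reduced_Cons b)
    show ?thesis
    proof (cases i)
      case False
      have "\<phi> (s * lprod bs) = 0"
        using phi_s_reduced[OF spanned_reduced _ _ sblk_s[OF sblk_one]] False by (simp add: Cons b)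
      then show ?thesis using c 0 False by (simp add: Cons b)
    next
      case True
      then have x: "sblk x \<beta>" using c by simp
      show ?thesis
      proof (cases "rest = []")
        case True
        then show ?thesis using sblk_Schwinger_Dyson[OF x, of 0] 0 by (simp add: Cons b)
      next
        case False
        have h: "\<not> fst (hd rest)" using spanned_reduced True False by (simp add: Cons b reduced_Cons)
        have "\<phi> (s * x * lprod rest) = 0" by (rule phi_s_reduced[OF r(1) False h sblk_s[OF x]])
        moreover have "\<beta> 1 (lprod rest) = 0"
          by (rule sblk_null_right[OF x r(3)]) (rule phi_s_reduced[OF r(1) False h])
        ultimately show ?thesis using 0 by (simp add: Cons b mult.assoc)
      qed
    qed
  qed simp
next
  case (spanned_add x \<beta> y \<gamma>)
  then show ?case by (simp add: algebra_simps phi_add spanned_M)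
next
  case (spanned_scale x \<beta> c)
  then show ?case by (simp add: scaleC_bop_simps phi_scaleC spanned_M)
qed simp

lemma spanned_sum:
  "finite I \<Longrightarrow> (\<And>i. i \<in> I \<Longrightarrow> spanned (f i) (\<beta> i)) \<Longrightarrow> spanned (\<Sum>i\<in>I. f i) (\<lambda>p q. \<Sum>i\<in>I. \<beta> i p q)"
proof (induction I rule: finite_induct)
  case empty
  show ?case using spanned_scale[OF spanned_one, of 0] by (simp add: scaleC_bop_simps)
qed (simp add: spanned_add)

end

section \<open>Moments of the semicircle law\<close>

context
  fixes \<sigma> :: real assumes \<sigma>: "\<sigma> > 0"
begin

lemma semicircle_moment:
  "(\<integral>t. t ^ k \<partial>semicircle \<sigma>)
    = integral {- 2 * \<sigma> .. 2 * \<sigma>} (\<lambda>t. t ^ k * sqrt (4 * \<sigma>\<^sup>2 - t\<^sup>2)) / (2 * pi * \<sigma>\<^sup>2)"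
proof -
  define f where "f t = indicator {- 2 * \<sigma> .. 2 * \<sigma>} t * sqrt (4 * \<sigma>\<^sup>2 - t\<^sup>2) / (2 * pi * \<sigma>\<^sup>2)" for t
  have sq: "t\<^sup>2 \<le> 4 * \<sigma>\<^sup>2" if "- 2 * \<sigma> \<le> t" "t \<le> 2 * \<sigma>" for t
  proof -
    have "\<bar>t\<bar> \<le> \<bar>2 * \<sigma>\<bar>" using that \<sigma> by auto
    then show ?thesis using abs_le_square_iff[of t "2 * \<sigma>"] by (simp add: power_mult_distrib)
  qed
  have f0: "0 \<le> f t" for t using sq[of t] by (auto simp: f_def indicator_def)
  have "(\<integral>t. t ^ k \<partial>semicircle \<sigma>) = (\<integral>t. f t *\<^sub>R t ^ k \<partial>lborel)"
    unfolding semicircle_def f_def[symmetric] by (rule integral_density) (simp_all add: f0, simp add: f_def[abs_def])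
  also have "\<dots> = (LBINT t:{- 2 * \<sigma> .. 2 * \<sigma>}. t ^ k * sqrt (4 * \<sigma>\<^sup>2 - t\<^sup>2) / (2 * pi * \<sigma>\<^sup>2))"
    unfolding set_lebesgue_integral_def by (intro Bochner_Integration.integral_cong) (auto simp: f_def indicator_def)
  also have "\<dots> = integral {- 2 * \<sigma> .. 2 * \<sigma>} (\<lambda>t. t ^ k * sqrt (4 * \<sigma>\<^sup>2 - t\<^sup>2) / (2 * pi * \<sigma>\<^sup>2))"
    by (rule set_borel_integral_eq_integral) (intro borel_integrable_atLeastAtMost' continuous_intros, use \<sigma> in auto)
  finally show ?thesis by simp
qed

text \<open>The derivative of \<open>t\<^sup>k (4 \<sigma>\<^sup>2 - t\<^sup>2)\<^bsup>3/2\<^esup>\<close> integrates to zero over \<open>[-2\<sigma>, 2\<sigma>]\<close>, and it is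
  \<open>sqrt (4 \<sigma>\<^sup>2 - t\<^sup>2)\<close> times a combination of \<open>t\<^bsup>k-1\<^esup>\<close> and \<open>t\<^bsup>k+1\<^esup>\<close>.\<close>

lemma semicircle_moment_rec:
  "real (k + 3) * (\<integral>t. t ^ (k + 1) \<partial>semicircle \<sigma>) = 4 * \<sigma>\<^sup>2 * (real k * (\<integral>t. t ^ (k - 1) \<partial>semicircle \<sigma>))"
proof -
  let ?I = "{- 2 * \<sigma> .. 2 * \<sigma>}"
  define g where "g t = 4 * \<sigma>\<^sup>2 - t\<^sup>2" for t
  \<comment> \<open>the factor is written without a fractional power so that it is continuous up to the end points\<close>
  define F where "F t = t ^ k * (g t * sqrt (g t))" for t
  define m where "m j = integral ?I (\<lambda>t. t ^ j * sqrt (g t))" for j :: nat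
  have int: "(\<lambda>t. t ^ j * sqrt (g t)) integrable_on ?I" for j
    unfolding g_def by (intro integrable_continuous_interval continuous_intros)
  have pos: "0 < g t" if "t \<in> {- 2 * \<sigma> <..< 2 * \<sigma>}" for t
  proof -
    have "\<bar>t\<bar> < \<bar>2 * \<sigma>\<bar>" using that \<sigma> by auto
    then have "\<bar>t\<bar>\<^sup>2 < \<bar>2 * \<sigma>\<bar>\<^sup>2" by (intro power_strict_mono) auto
    then show ?thesis by (simp add: g_def power_mult_distrib)
  qed
  define F' where "F' t = 4 * \<sigma>\<^sup>2 * real k * (t ^ (k - 1) * sqrt (g t)) - real (k + 3) * (t ^ (k + 1) * sqrt (g t))" for t
  have "(F' has_integral (F (2 * \<sigma>) - F (- 2 * \<sigma>))) ?I"
  proof (rule fundamental_theorem_of_calculus_interior)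
    show "continuous_on ?I F" unfolding F_def g_def by (intro continuous_intros)
    fix t assume t: "t \<in> {- 2 * \<sigma> <..< 2 * \<sigma>}"
    note p = pos[OF t]
    have dg: "(g has_real_derivative (- 2 * t)) (at t)"
      unfolding g_def by (auto intro!: derivative_eq_intros)
    have "(F has_real_derivative (real k * t ^ (k - 1) * (g t * sqrt (g t))
      + t ^ k * (- 2 * t * sqrt (g t) + g t * (- 2 * t * (inverse (sqrt (g t)) / 2))))) (at t)"
      unfolding F_def using p
      by (auto intro!: derivative_eq_intros dg DERIV_chain'[OF dg DERIV_real_sqrt] simp: algebra_simps)
    moreover have "g t * inverse (sqrt (g t)) = sqrt (g t)" using p by (simp add: field_simps)
    then have "real k * t ^ (k - 1) * (g t * sqrt (g t))
      + t ^ k * (- 2 * t * sqrt (g t) + g t * (- 2 * t * (inverse (sqrt (g t)) / 2)))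
      = real k * t ^ (k - 1) * (g t * sqrt (g t)) - 3 * t ^ (k + 1) * sqrt (g t)"
      by (simp add: algebra_simps)
    also have "\<dots> = F' t"
      by (cases k) (simp_all add: F'_def g_def power2_eq_square algebra_simps)
    ultimately show "(F has_vector_derivative F' t) (at t)"
      by (simp add: has_real_derivative_iff_has_vector_derivative)
  qed (use \<sigma> in simp)
  moreover have "F (2 * \<sigma>) = 0" "F (- 2 * \<sigma>) = 0" by (simp_all add: F_def g_def power_mult_distrib)
  ultimately have "integral ?I F' = 0" by (simp add: integral_unique)
  moreover have "integral ?I F' = 4 * \<sigma>\<^sup>2 * real k * m (k - 1) - real (k + 3) * m (k + 1)"
    unfolding F'_def m_def by (subst integral_diff) (intro integrable_on_mult_right int | simp only: integral_mult_right)+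
  ultimately have "real (k + 3) * m (k + 1) = 4 * \<sigma>\<^sup>2 * real k * m (k - 1)" by simp
  then show ?thesis unfolding semicircle_moment m_def g_def by (simp add: field_simps)
qed

text \<open>Let \<open>S n\<close> be the convolution. The symmetry \<open>i \<mapsto> n - i\<close> gives \<open>\<Sum> i C\<^sub>i C\<^bsub>n-i\<^esub> = (n/2) S n\<close>. Evaluating
  \<open>\<Sum> (i + 1) C\<^sub>i C\<^bsub>n+1-i\<^esub>\<close> once in this way and once with the recursion of \<open>C\<close> shows that \<open>S\<close> satisfies the
  recursion of the shifted sequence.\<close>

lemma Catalan_convolution:
  fixes C :: "nat \<Rightarrow> real"
  assumes C0: "C 0 = 1" and C: "\<And>n. real (n + 2) * C (Suc n) = real (4 * n + 2) * C n"
  shows "C (Suc n) = (\<Sum>i\<le>n. C i * C (n - i))"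
proof (induction n)
  case 0
  then show ?case using C[of 0] C0 by simp
next
  case (Suc n)
  define S where "S n = (\<Sum>i\<le>n. C i * C (n - i))" for n
  have sym: "(\<Sum>i\<le>n. real i * (C i * C (n - i))) = real n / 2 * S n" for n
  proof -
    have "(\<Sum>i\<le>n. real i * (C i * C (n - i))) = (\<Sum>i\<le>n. real (n - i) * (C (n - i) * C (n - (n - i))))"
      by (rule sum.reindex_bij_witness[of _ "\<lambda>i. n - i" "\<lambda>i. n - i"]) auto
    also have "\<dots> = (\<Sum>i\<le>n. real n * (C i * C (n - i)) - real i * (C i * C (n - i)))"
      by (intro sum.cong) (auto simp: of_nat_diff algebra_simps)
    finally show ?thesis by (simp add: sum_subtractf sum_distrib_left[symmetric] S_def)
  qed
  have "(real n + 3) / 2 * S (Suc n) = (\<Sum>i\<le>Suc n. real (i + 1) * (C i * C (Suc n - i)))"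
  proof -
    have "(\<Sum>i\<le>Suc n. real (i + 1) * (C i * C (Suc n - i)))
      = (\<Sum>i\<le>Suc n. real i * (C i * C (Suc n - i))) + S (Suc n)"
      unfolding S_def sum.distrib[symmetric] by (intro sum.cong) (auto simp: algebra_simps)
    then show ?thesis unfolding sym by (simp add: field_simps)
  qed
  also have "\<dots> = C (Suc n) + (\<Sum>i\<le>n. real (i + 2) * (C (Suc i) * C (n - i)))"
    by (subst sum.atMost_Suc_shift) (simp add: C0)
  also have "(\<Sum>i\<le>n. real (i + 2) * (C (Suc i) * C (n - i))) = (\<Sum>i\<le>n. real (4 * i + 2) * C i * C (n - i))"
    by (intro sum.cong refl) (metis C mult.assoc)
  also have "\<dots> = 4 * (\<Sum>i\<le>n. real i * (C i * C (n - i))) + 2 * S n"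
    by (simp add: S_def sum_distrib_left sum.distrib[symmetric] algebra_simps)
  also have "\<dots> = (2 * real n + 2) * C (Suc n)"
    unfolding sym using Suc by (simp add: S_def algebra_simps)
  finally have "(real n + 3) * S (Suc n) = (4 * real n + 6) * C (Suc n)" by (simp add: field_simps)
  also have "\<dots> = (real n + 3) * C (Suc (Suc n))" using C[of "Suc n"] by (simp add: algebra_simps)
  finally show ?case by (simp add: S_def)
qed

text \<open>Up to powers of \<open>\<sigma>\<close> the even moments are the Catalan numbers, and the odd ones vanish. The
  normalization is a hypothesis here; for the distribution of \<open>s\<close> it is \<open>\<phi> 1 = 1\<close>.\<close>

lemma semicircle_moment_convolution:
  assumes 0: "(\<integral>t. t ^ 0 \<partial>semicircle \<sigma>) = 1"
  defines "m \<equiv> \<lambda>k. (\<integral>t. t ^ k \<partial>semicircle \<sigma>)"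
  shows "m (Suc k) = \<sigma>\<^sup>2 * (\<Sum>i<k. m i * m (k - 1 - i))"
proof -
  have rec: "real (k + 3) * m (k + 1) = 4 * \<sigma>\<^sup>2 * (real k * m (k - 1))" for k
    unfolding m_def by (rule semicircle_moment_rec)
  have odd: "m (2 * n + 1) = 0" for n
  proof (induction n)
    case (Suc n)
    then show ?case using rec[of "2 * n + 2"] by simp
  qed (use rec[of 0] in simp)
  have odd': "m i = 0" if "odd i" for i
    using that by (elim oddE) (simp only: odd)
  define C where "C n = m (2 * n) / \<sigma>\<^sup>2 ^ n" for n
  have even: "m (2 * n) = C n * (\<sigma>\<^sup>2) ^ n" for n using \<sigma> by (simp add: C_def)
  have C: "C (Suc n) = (\<Sum>i\<le>n. C i * C (n - i))" for n
  proof (rule Catalan_convolution)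
    show "C 0 = 1" using 0 by (simp add: C_def m_def)
    show "real (n + 2) * C (Suc n) = real (4 * n + 2) * C n" for n
    proof -
      have "2 * (real (n + 2) * m (2 * Suc n)) = 2 * (\<sigma>\<^sup>2 * (real (4 * n + 2) * m (2 * n)))"
        using rec[of "2 * n + 1"] by (simp add: algebra_simps)
      then have "real (n + 2) * m (2 * Suc n) / \<sigma>\<^sup>2 = real (4 * n + 2) * m (2 * n)"
        using \<sigma> by (simp add: field_simps del: mult_Suc_right)
      then have "real (n + 2) * m (2 * Suc n) / \<sigma>\<^sup>2 / \<sigma>\<^sup>2 ^ n = real (4 * n + 2) * m (2 * n) / \<sigma>\<^sup>2 ^ n"
        by (simp only:)
      then show ?thesis by (simp add: C_def mult.commute del: mult_Suc_right)
    qed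
  qed
  show ?thesis
  proof (cases "even k")
    case True
    have z: "m i * m (k - 1 - i) = 0" if "i < k" for i
    proof (cases "even i")
      case True
      then have "odd (k - 1 - i)" using \<open>even k\<close> that by presburger
      then have "m (k - 1 - i) = 0" by (rule odd')
      then show ?thesis by simp
    next
      case False
      then have "m i = 0" by (rule odd')
      then show ?thesis by simp
    qed
    have m0: "m (Suc k) = 0" using True by (intro odd') simp
    have "(\<Sum>i<k. m i * m (k - 1 - i)) = 0" by (intro sum.neutral ballI z) simp
    then show ?thesis using m0 by (simp only: mult_zero_right)
  next
    case False
    then obtain n where n: "k = 2 * n + 1" by (metis oddE)
    have "(\<Sum>i<k. m i * m (k - 1 - i)) = (\<Sum>j\<le>n. m (2 * j) * m (2 * n - 2 * j))"
    proof (rule sum.mono_neutral_cong_right[THEN trans])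
      show "(\<Sum>i\<in>(\<lambda>j. 2 * j) ` {..n}. m i * m (k - 1 - i)) = (\<Sum>j\<le>n. m (2 * j) * m (2 * n - 2 * j))"
        by (subst sum.reindex) (auto simp: n inj_on_def)
      show "\<forall>i\<in>{..<k} - (\<lambda>j. 2 * j) ` {..n}. m i * m (k - 1 - i) = 0"
      proof
        fix i assume i: "i \<in> {..<k} - (\<lambda>j. 2 * j) ` {..n}"
        have "odd i"
        proof
          assume "even i"
          then obtain j where "i = 2 * j" by blast
          then show False using i n by auto
        qed
        then have "m i = 0" by (rule odd')
        then show "m i * m (k - 1 - i) = 0" by simp
      qed
    qed (auto simp: n)
    also have "\<dots> = (\<sigma>\<^sup>2) ^ n * (\<Sum>j\<le>n. C j * C (n - j))"
      unfolding sum_distrib_left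
    proof (intro sum.cong refl)
      fix j assume "j \<in> {..n}"
      then have "2 * n - 2 * j = 2 * (n - j)" "(\<sigma>\<^sup>2) ^ n = (\<sigma>\<^sup>2) ^ j * (\<sigma>\<^sup>2) ^ (n - j)"
        by (auto simp: power_add[symmetric])
      then show "m (2 * j) * m (2 * n - 2 * j) = (\<sigma>\<^sup>2) ^ n * (C j * C (n - j))"
        by (simp only: even) (simp add: mult_ac)
    qed
    finally show ?thesis using C[of n] even[of "Suc n"] n by simp
  qed
qed

end

section \<open>Square matrices as functions of two indices\<close>

text \<open>The size of a matrix changes inside the proofs (it is doubled), so matrices are functions, of which only the
  entries with both indices below \<open>n\<close> matter.\<close>

definition mmul :: "nat \<Rightarrow> (nat \<Rightarrow> nat \<Rightarrow> 'a::semiring_0) \<Rightarrow> (nat \<Rightarrow> nat \<Rightarrow> 'a) \<Rightarrow> nat \<Rightarrow> nat \<Rightarrow> 'a" where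
  "mmul n A B i j = (\<Sum>k<n. A i k * B k j)"

definition mone :: "nat \<Rightarrow> nat \<Rightarrow> 'a::zero_neq_one" where
  "mone i j = (if i = j then 1 else 0)"

primrec mpow :: "nat \<Rightarrow> (nat \<Rightarrow> nat \<Rightarrow> 'a::semiring_1) \<Rightarrow> nat \<Rightarrow> nat \<Rightarrow> nat \<Rightarrow> 'a" where
  "mpow n A 0 = mone"
| "mpow n A (Suc k) = mmul n A (mpow n A k)"

abbreviation (input) fmat :: "nat \<Rightarrow> (nat \<Rightarrow> nat \<Rightarrow> 'a) \<Rightarrow> 'a mat" where
  "fmat n A \<equiv> Matrix.mat n n (\<lambda>(i, j). A i j)"

definition is_minv :: "nat \<Rightarrow> (nat \<Rightarrow> nat \<Rightarrow> 'a::semiring_1) \<Rightarrow> (nat \<Rightarrow> nat \<Rightarrow> 'a) \<Rightarrow> bool" where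
  "is_minv n A B \<longleftrightarrow> (\<forall>i<n. \<forall>j<n. mmul n A B i j = mone i j \<and> mmul n B A i j = mone i j)"

lemma mmul_assoc: "mmul n (mmul n A B) C = mmul n A (mmul n B C)"
proof (intro ext)
  fix i j
  have "mmul n (mmul n A B) C i j = (\<Sum>k<n. \<Sum>l<n. A i l * B l k * C k j)"
    by (simp add: mmul_def sum_distrib_right)
  also have "\<dots> = (\<Sum>l<n. \<Sum>k<n. A i l * B l k * C k j)" by (rule sum.swap)
  also have "\<dots> = mmul n A (mmul n B C) i j"
    by (simp add: mmul_def sum_distrib_left mult.assoc)
  finally show "mmul n (mmul n A B) C i j = mmul n A (mmul n B C) i j" .
qed

lemma sum_mone_left: "i < n \<Longrightarrow> (\<Sum>k<n. mone i k * (f k :: 'a::semiring_1)) = f i"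
  unfolding mone_def by (simp add: if_distrib[of "\<lambda>x. x * _"] cong: if_cong)

lemma sum_mone_right: "j < n \<Longrightarrow> (\<Sum>k<n. (f k :: 'a::semiring_1) * mone k j) = f j"
  unfolding mone_def by (simp add: if_distrib[of "\<lambda>x. _ * x"] cong: if_cong)

lemma mmul_mone_left [simp]: "i < n \<Longrightarrow> mmul n mone (A :: nat \<Rightarrow> nat \<Rightarrow> 'a::semiring_1) i j = A i j"
  unfolding mmul_def by (rule sum_mone_left)

lemma mmul_mone_right [simp]: "j < n \<Longrightarrow> mmul n (A :: nat \<Rightarrow> nat \<Rightarrow> 'a::semiring_1) mone i j = A i j"
  unfolding mmul_def by (rule sum_mone_right)

lemma mmul_cong:
  "(\<And>k. k < n \<Longrightarrow> A i k = A' i k) \<Longrightarrow> (\<And>k. k < n \<Longrightarrow> B k j = B' k j) \<Longrightarrow> mmul n A B i j = mmul n A' B' i j"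
  unfolding mmul_def by (intro sum.cong) auto

lemma minv_unique:
  fixes L B R :: "nat \<Rightarrow> nat \<Rightarrow> 'a::semiring_1"
  assumes "\<And>i j. i < n \<Longrightarrow> j < n \<Longrightarrow> mmul n L B i j = mone i j"
    and "\<And>i j. i < n \<Longrightarrow> j < n \<Longrightarrow> mmul n B R i j = mone i j"
    and ij: "i < n" "j < n"
  shows "L i j = R i j"
proof -
  have "L i j = mmul n L (mmul n B R) i j"
    by (subst mmul_cong[where A'=L and B'=mone]) (use ij in \<open>auto simp: assms\<close>)
  also have "\<dots> = mmul n (mmul n L B) R i j" by (simp add: mmul_assoc)
  also have "\<dots> = R i j"
    by (subst mmul_cong[where A'=mone and B'=R]) (use ij in \<open>auto simp: assms\<close>)
  finally show ?thesis .
qed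

lemma is_minv_unique: "is_minv n B L \<Longrightarrow> is_minv n B R \<Longrightarrow> i < n \<Longrightarrow> j < n \<Longrightarrow> L i j = R i j"
  by (rule minv_unique[of n L B R]) (auto simp: is_minv_def)

lemma mpow_commute: "i < n \<Longrightarrow> j < n \<Longrightarrow> mmul n (mpow n A k) A i j = mpow n A (Suc k) i j"
proof (induction k arbitrary: i)
  case (Suc k)
  have "mmul n (mpow n A (Suc k)) A i j = mmul n A (mmul n (mpow n A k) A) i j"
    by (simp add: mmul_assoc)
  also have "\<dots> = mmul n A (mpow n A (Suc k)) i j"
    by (rule mmul_cong) (use Suc in auto)
  finally show ?case by simp
qed simp

lemma Neumann_series:
  fixes c :: "nat \<Rightarrow> nat \<Rightarrow> 'a::{real_normed_algebra_1, banach}"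
  assumes s: "\<And>i j. i < n \<Longrightarrow> j < n \<Longrightarrow> summable (\<lambda>k. norm (mpow n c k i j))"
  shows "is_minv n (\<lambda>i j. mone i j - c i j) (\<lambda>i j. suminf (\<lambda>k. mpow n c k i j))"
proof -
  define N where "N i j = (suminf (\<lambda>k. mpow n c k i j))" for i j
  have s': "summable (\<lambda>k. mpow n c k i j)" if "i < n" "j < n" for i j
    using s[OF that] by (rule summable_norm_cancel)
  have head: "(suminf (\<lambda>k. mpow n c (Suc k) i j)) = N i j - mone i j" if "i < n" "j < n" for i j
    using suminf_split_head[OF s'[OF that]] by (simp add: N_def)
  have "mmul n c N i j = N i j - mone i j" if "i < n" "j < n" for i j
  proof -
    have "mmul n c N i j = (\<Sum>u<n. suminf (\<lambda>k. c i u * mpow n c k u j))"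
      unfolding mmul_def N_def using that by (intro sum.cong refl suminf_mult[symmetric] s') auto
    also have "\<dots> = (suminf (\<lambda>k. \<Sum>u<n. c i u * mpow n c k u j))"
      using that by (intro suminf_sum[symmetric] summable_mult s') auto
    finally show ?thesis using head[OF that] by (simp add: mmul_def)
  qed
  moreover have "mmul n N c i j = N i j - mone i j" if "i < n" "j < n" for i j
  proof -
    have "mmul n N c i j = (\<Sum>u<n. suminf (\<lambda>k. mpow n c k i u * c u j))"
      unfolding mmul_def N_def using that by (intro sum.cong refl suminf_mult2 s') auto
    also have "\<dots> = (suminf (\<lambda>k. \<Sum>u<n. mpow n c k i u * c u j))"
      using that by (intro suminf_sum[symmetric] summable_mult2 s') auto
    also have "\<dots> = (suminf (\<lambda>k. mpow n c (Suc k) i j))"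
    proof -
      have "(\<Sum>u<n. mpow n c k i u * c u j) = mpow n c (Suc k) i j" for k
        using mpow_commute[OF that, of c k] by (simp only: mmul_def)
      then show ?thesis by (simp only:)
    qed
    finally show ?thesis using head[OF that] by simp
  qed
  moreover have "mmul n (\<lambda>i j. mone i j - c i j) N i j = N i j - mmul n c N i j"
    "mmul n N (\<lambda>i j. mone i j - c i j) i j = N i j - mmul n N c i j" if "i < n" "j < n" for i j
    using that by (simp_all add: mmul_def left_diff_distrib right_diff_distrib sum_subtractf
        sum_mone_left sum_mone_right)
  ultimately show ?thesis unfolding is_minv_def N_def[symmetric] by simp
qed

lemma mmul_scaleC:
  fixes A B :: "nat \<Rightarrow> nat \<Rightarrow> 'h::complex_hilbert_space bop"
  shows "mmul n (\<lambda>i j. \<kappa> i *\<^sub>C A i j) B i j = \<kappa> i *\<^sub>C mmul n A B i j"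
    "mmul n A (\<lambda>i j. \<kappa> j *\<^sub>C B i j) i j = \<kappa> j *\<^sub>C mmul n A B i j"
  by (simp_all add: mmul_def scaleC_sum_right scaleC_bop_simps)

text \<open>With \<open>c = 1 - \<kappa> B\<close>, the Neumann series of \<open>c\<close> is the inverse of \<open>\<kappa> B\<close>.\<close>

lemma preconditioned_inverse:
  fixes B :: "nat \<Rightarrow> nat \<Rightarrow> 'h::complex_hilbert_space bop"
  defines "c \<equiv> \<lambda>\<kappa> i j. mone i j - \<kappa> i *\<^sub>C B i j"
  assumes \<kappa>: "\<And>i. i < n \<Longrightarrow> \<kappa> i \<noteq> 0"
    and s: "\<And>i j. i < n \<Longrightarrow> j < n \<Longrightarrow> summable (\<lambda>k. norm (mpow n (c \<kappa>) k i j))"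
  shows "is_minv n B (\<lambda>i j. \<kappa> j *\<^sub>C (suminf (\<lambda>k. mpow n (c \<kappa>) k i j)))"
proof -
  define N where "N i j = (suminf (\<lambda>k. mpow n (c \<kappa>) k i j))" for i j
  have "is_minv n (\<lambda>i j. mone i j - c \<kappa> i j) N"
    unfolding N_def[abs_def] by (rule Neumann_series[OF s])
  then have N: "\<kappa> i *\<^sub>C mmul n B N i j = mone i j"
     "mmul n N (\<lambda>i j. \<kappa> i *\<^sub>C B i j) i j = mone i j" if "i < n" "j < n" for i j
    using that by (simp_all add: is_minv_def c_def mmul_scaleC)
  have "mmul n B (\<lambda>i j. \<kappa> j *\<^sub>C N i j) i j = mone i j" if ij: "i < n" "j < n" for i j
  proof -
    have "mmul n B N i j = inverse (\<kappa> i) *\<^sub>C (\<kappa> i *\<^sub>C mmul n B N i j)"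
      using \<kappa>[OF ij(1)] by (simp add: scaleC_bop_simps)
    also have "\<dots> = inverse (\<kappa> i) *\<^sub>C mone i j" by (simp add: N ij)
    finally show ?thesis using \<kappa>[OF ij(1)] by (auto simp: mmul_scaleC mone_def scaleC_bop_simps)
  qed
  moreover have "mmul n (\<lambda>i j. \<kappa> j *\<^sub>C N i j) B i j = mone i j" if ij: "i < n" "j < n" for i j
    using N(2)[OF ij] by (simp add: mmul_def scaleC_bop_simps)
  ultimately show ?thesis unfolding is_minv_def N_def[symmetric] by simp
qed

section \<open>The Schwinger--Dyson equation for resolvents\<close>

context free_semicircular
begin

text \<open>For \<open>R = (b - \<gamma>\<^sub>1 s - \<gamma>\<^sub>2 d)\<^sup>-\<^sup>1\<close> one has \<open>\<partial> R = R \<gamma>\<^sub>1 \<otimes> R\<close>. The predicate is the Schwinger--Dyson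
  equation for the entries of \<open>R x\<close> with this derivative, where \<open>x\<close> has derivative zero; later \<open>x\<close> is a
  polynomial in \<open>d\<close>.\<close>

definition Schwinger_Dyson_matrix ::
    "nat \<Rightarrow> (nat \<Rightarrow> nat \<Rightarrow> complex) \<Rightarrow> (nat \<Rightarrow> nat \<Rightarrow> 'h bop) \<Rightarrow> bool" where
  "Schwinger_Dyson_matrix n g1 R \<longleftrightarrow>
    (\<forall>i<n. \<forall>j<n. R i j \<in> M) \<and>
    (\<forall>i<n. \<forall>j<n. \<forall>x. spanned x (\<lambda>p q. 0) \<longrightarrow>
      \<phi> (s * (R i j * x)) = of_real (\<sigma>\<^sup>2) * (\<Sum>u<n. \<Sum>v<n. \<phi> (R i u) * g1 u v * \<phi> (R v j * x)))"

lemma mpow_M: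
  "(\<And>i j. i < n \<Longrightarrow> j < n \<Longrightarrow> A i j \<in> M) \<Longrightarrow> i < n \<Longrightarrow> j < n \<Longrightarrow> mpow n A k i j \<in> M"
  by (induction k arbitrary: i) (auto simp: mone_def mmul_def intro!: M_sum M_mult)

context
  fixes n :: nat and \<alpha> g1 g2 :: "nat \<Rightarrow> nat \<Rightarrow> complex" and \<kappa> :: "nat \<Rightarrow> complex"
    and c :: "nat \<Rightarrow> nat \<Rightarrow> 'h bop" and x :: "'h bop"
  assumes c: "\<And>i j. i < n \<Longrightarrow> j < n \<Longrightarrow>
      c i j = \<alpha> i j *\<^sub>C 1 + (\<kappa> i * g1 i j) *\<^sub>C s + (\<kappa> i * g2 i j) *\<^sub>C d"
    and x: "spanned x (\<lambda>p q. 0)"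
begin

lemma c_M: "i < n \<Longrightarrow> j < n \<Longrightarrow> c i j \<in> M"
  by (simp add: c)

text \<open>The Leibniz rule \<open>\<partial> (c\<^sup>k x) = \<Sum>\<^sub>a c\<^sup>a (\<kappa> \<gamma>\<^sub>1) \<otimes> c\<^bsup>k-1-a\<^esup> x\<close>, where \<open>\<kappa> \<gamma>\<^sub>1\<close> is the
  coefficient of \<open>s\<close> in \<open>c\<close>.\<close>

lemma spanned_mpow:
  "i < n \<Longrightarrow> j < n \<Longrightarrow> spanned (mpow n c k i j * x)
    (\<lambda>p q. \<Sum>a<k. \<Sum>u<n. \<Sum>v<n.
      \<phi> (p * mpow n c a i u) * (\<kappa> u * g1 u v) * \<phi> (mpow n c (k - 1 - a) v j * x * q))"
proof (induction k arbitrary: i)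
  case 0
  then show ?case using x spanned_scale[OF x, of 0] by (auto simp: mone_def scaleC_bop_simps)
next
  case (Suc k)
  define W where "W u = mpow n c k u j * x" for u
  define \<beta> where "\<beta> u p q = (\<Sum>a<k. \<Sum>w<n. \<Sum>v<n.
      \<phi> (p * mpow n c a u w) * (\<kappa> w * g1 w v) * \<phi> (mpow n c (k - 1 - a) v j * x * q))" for u p q
  have sp: "spanned (W u) (\<beta> u)" if "u < n" for u
    using Suc.IH[OF that Suc.prems(2)] unfolding W_def \<beta>_def[abs_def] .
  have eq: "mpow n c (Suc k) i j * x =
    (\<Sum>u<n. \<alpha> i u *\<^sub>C W u + ((\<kappa> i * g1 i u) *\<^sub>C (s * W u) + (\<kappa> i * g2 i u) *\<^sub>C (d * W u)))"
    using Suc.prems by (simp add: mmul_def sum_distrib_right c W_def algebra_simps scaleC_bop_simps)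
  show ?case unfolding eq
  proof (rule spanned_cong[OF spanned_sum[OF _ spanned_add[OF spanned_scale[OF sp]
          spanned_add[OF spanned_scale[OF spanned_s[OF sp]] spanned_scale[OF spanned_d[OF sp]]]]]])
    fix p q assume pq: "p \<in> M" "q \<in> M"
    define H where "H a w v = (\<kappa> w * g1 w v) * \<phi> (mpow n c (k - 1 - a) v j * x * q)" for a w v
    have lin: "\<alpha> i u * \<beta> u p q + (\<kappa> i * g1 i u * \<beta> u (p * s) q + \<kappa> i * g2 i u * \<beta> u (p * d) q)
      = (\<Sum>a<k. \<Sum>w<n. \<Sum>v<n. \<phi> (p * (c i u * mpow n c a u w)) * H a w v)" if u: "u < n" for u
    proof -
      have "\<phi> (p * (c i u * Y)) = \<alpha> i u * \<phi> (p * Y) + (\<kappa> i * g1 i u * \<phi> (p * s * Y) + \<kappa> i * g2 i u * \<phi> (p * d * Y))"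
        if "Y \<in> M" for Y
        using that pq u Suc.prems by (simp add: c algebra_simps scaleC_bop_simps phi_add phi_scaleC mult.assoc)
      then have "(\<Sum>a<k. \<Sum>w<n. \<Sum>v<n. \<phi> (p * (c i u * mpow n c a u w)) * H a w v)
        = (\<Sum>a<k. \<Sum>w<n. \<Sum>v<n. (\<alpha> i u * \<phi> (p * mpow n c a u w) + (\<kappa> i * g1 i u * \<phi> (p * s * mpow n c a u w)
            + \<kappa> i * g2 i u * \<phi> (p * d * mpow n c a u w))) * H a w v)"
        using u by (intro sum.cong refl) (simp add: mpow_M c_M)
      also have "\<dots> = \<alpha> i u * \<beta> u p q + (\<kappa> i * g1 i u * \<beta> u (p * s) q + \<kappa> i * g2 i u * \<beta> u (p * d) q)"
        by (simp add: \<beta>_def H_def distrib_right sum.distrib sum_distrib_left mult.assoc)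
      finally show ?thesis by simp
    qed
    have "(\<Sum>u<n. \<alpha> i u * \<beta> u p q + (\<kappa> i * g1 i u * (\<phi> p * \<phi> (W u * q) + \<beta> u (p * s) q) + \<kappa> i * g2 i u * \<beta> u (p * d) q))
      = (\<Sum>u<n. \<kappa> i * g1 i u * (\<phi> p * \<phi> (W u * q)))
        + (\<Sum>u<n. \<Sum>a<k. \<Sum>w<n. \<Sum>v<n. \<phi> (p * (c i u * mpow n c a u w)) * H a w v)"
      unfolding sum.distrib[symmetric]
    proof (intro sum.cong refl)
      fix u assume "u \<in> {..<n}"
      then show "\<alpha> i u * \<beta> u p q + (\<kappa> i * g1 i u * (\<phi> p * \<phi> (W u * q) + \<beta> u (p * s) q) + \<kappa> i * g2 i u * \<beta> u (p * d) q)
        = \<kappa> i * g1 i u * (\<phi> p * \<phi> (W u * q)) + (\<Sum>a<k. \<Sum>w<n. \<Sum>v<n. \<phi> (p * (c i u * mpow n c a u w)) * H a w v)"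
        by (subst lin[symmetric]) (simp_all add: distrib_left)
    qed
    also have "(\<Sum>u<n. \<Sum>a<k. \<Sum>w<n. \<Sum>v<n. \<phi> (p * (c i u * mpow n c a u w)) * H a w v)
      = (\<Sum>a<k. \<Sum>w<n. \<Sum>v<n. \<phi> (p * mpow n c (Suc a) i w) * H a w v)"
    proof -
      have "(\<Sum>u<n. \<Sum>a<k. \<Sum>w<n. \<Sum>v<n. \<phi> (p * (c i u * mpow n c a u w)) * H a w v)
        = (\<Sum>a<k. \<Sum>w<n. \<Sum>u<n. \<Sum>v<n. \<phi> (p * (c i u * mpow n c a u w)) * H a w v)"
        by (subst sum.swap) (intro sum.cong refl sum.swap)
      also have "\<dots> = (\<Sum>a<k. \<Sum>w<n. \<Sum>v<n. \<Sum>u<n. \<phi> (p * (c i u * mpow n c a u w)) * H a w v)"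
        by (intro sum.cong refl sum.swap)
      also have "\<dots> = (\<Sum>a<k. \<Sum>w<n. \<Sum>v<n. \<phi> (p * mpow n c (Suc a) i w) * H a w v)"
      proof (intro sum.cong refl)
        fix a w v assume w: "w \<in> {..<n}"
        have m: "p * (c i u * mpow n c a u w) \<in> M" if "u < n" for u
          using that w pq Suc.prems by (intro M_mult mpow_M c_M) auto
        have "p * mpow n c (Suc a) i w = (\<Sum>u<n. p * (c i u * mpow n c a u w))"
          by (simp add: mmul_def sum_distrib_left)
        then have "\<phi> (p * mpow n c (Suc a) i w) = (\<Sum>u<n. \<phi> (p * (c i u * mpow n c a u w)))"
          using m by (simp only:) (rule phi_sum, simp)
        then show "(\<Sum>u<n. \<phi> (p * (c i u * mpow n c a u w)) * H a w v) = \<phi> (p * mpow n c (Suc a) i w) * H a w v"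
          by (simp add: sum_distrib_right)
      qed
      finally show ?thesis .
    qed
    also have "(\<Sum>u<n. \<kappa> i * g1 i u * (\<phi> p * \<phi> (W u * q)))
      = (\<Sum>w<n. \<Sum>v<n. \<phi> (p * mpow n c 0 i w) * ((\<kappa> w * g1 w v) * \<phi> (mpow n c k v j * x * q)))"
    proof -
      have "(\<Sum>w<n. \<Sum>v<n. \<phi> (p * mpow n c 0 i w) * ((\<kappa> w * g1 w v) * \<phi> (mpow n c k v j * x * q)))
        = (\<Sum>w<n. mone i w * (\<Sum>v<n. \<phi> p * ((\<kappa> w * g1 w v) * \<phi> (mpow n c k v j * x * q))))"
        by (intro sum.cong refl) (simp add: mone_def)
      also have "\<dots> = (\<Sum>v<n. \<phi> p * ((\<kappa> i * g1 i v) * \<phi> (mpow n c k v j * x * q)))"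
        using Suc.prems by (simp only: sum_mone_left)
      finally show ?thesis by (simp add: W_def mult_ac)
    qed
    finally show "(\<Sum>u<n. \<alpha> i u * \<beta> u p q + (\<kappa> i * g1 i u * (\<phi> p * \<phi> (W u * q) + \<beta> u (p * s) q) + \<kappa> i * g2 i u * \<beta> u (p * d) q))
      = (\<Sum>a<Suc k. \<Sum>u<n. \<Sum>v<n. \<phi> (p * mpow n c a i u) * (\<kappa> u * g1 u v) * \<phi> (mpow n c (Suc k - 1 - a) v j * x * q))"
      by (simp only: sum.lessThan_Suc_shift) (simp add: H_def mult.assoc)
  qed simp_all
qed

lemma Schwinger_Dyson_mpow:
  assumes "i < n" "j < n"
  shows "\<phi> (s * (mpow n c k i j * x)) = of_real (\<sigma>\<^sup>2) *
    (\<Sum>a<k. \<Sum>u<n. \<Sum>v<n. \<phi> (mpow n c a i u) * (\<kappa> u * g1 u v) * \<phi> (mpow n c (k - 1 - a) v j * x))"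
  using Schwinger_Dyson[OF spanned_mpow[OF assms, of k]] by simp

end

text \<open>The resolvent is a Neumann series, and the Leibniz rule summed over its terms is a Cauchy product of two such
  series.\<close>

theorem Schwinger_Dyson_resolvent:
  fixes B :: "nat \<Rightarrow> nat \<Rightarrow> 'h bop"
  assumes B: "\<And>i j. i < n \<Longrightarrow> j < n \<Longrightarrow> B i j = b i j *\<^sub>C 1 - g1 i j *\<^sub>C s - g2 i j *\<^sub>C d"
    and \<kappa>: "\<And>i. i < n \<Longrightarrow> \<kappa> i \<noteq> 0"
    and summ: "\<And>i j. i < n \<Longrightarrow> j < n \<Longrightarrow> summable (\<lambda>k. norm (mpow n (\<lambda>i j. mone i j - \<kappa> i *\<^sub>C B i j) k i j))"
    and R: "is_minv n B R"
  shows "Schwinger_Dyson_matrix n g1 R"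
proof -
  define c where "c i j = mone i j - \<kappa> i *\<^sub>C B i j" for i j
  define N where "N i j = (suminf (\<lambda>k. mpow n c k i j))" for i j
  note summ = summ[folded c_def[abs_def]]
  have RN: "R i j = \<kappa> j *\<^sub>C N i j" if "i < n" "j < n" for i j
    using is_minv_unique[OF R preconditioned_inverse[of n \<kappa> B, folded c_def[abs_def], OF \<kappa> summ] that]
    by (simp add: N_def)
  have c: "c i j = (mone i j - \<kappa> i * b i j) *\<^sub>C 1 + (\<kappa> i * g1 i j) *\<^sub>C s + (\<kappa> i * g2 i j) *\<^sub>C d"
    if "i < n" "j < n" for i j
    using that by (simp add: c_def B scaleC_bop_simps mone_def algebra_simps)
  have cM: "mpow n c k i j \<in> M" if "i < n" "j < n" for k i j
    by (rule mpow_M) (use that in \<open>auto simp: c\<close>)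
  have N: "N i j \<in> M" "summable (\<lambda>k. norm (\<phi> (mpow n c k i j)))" "(\<lambda>k. \<phi> (mpow n c k i j)) sums \<phi> (N i j)"
    if "i < n" "j < n" for i j
    unfolding N_def by (rule phi_summable; use cM summ that in auto)+
  show ?thesis unfolding Schwinger_Dyson_matrix_def
  proof (intro conjI allI impI)
    show "R i j \<in> M" if "i < n" "j < n" for i j using that N by (simp add: RN)
    fix i j x assume ij: "i < n" "j < n" and x: "spanned x (\<lambda>p q. 0)"
    note xM = spanned_M[OF x]
    have Nx: "(\<lambda>k. \<phi> (y * (mpow n c k v j * x))) sums \<phi> (y * (N v j * x))"
      "summable (\<lambda>k. norm (\<phi> (y * (mpow n c k v j * x))))" if v: "v < n" and y: "y \<in> M" for v y
    proof -
      have bl: "bounded_linear (\<lambda>z. y * (z * x))"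
        by (intro bounded_linear_compose[OF bounded_linear_mult_right bounded_linear_mult_left])
      have s: "summable (\<lambda>k. norm (y * (mpow n c k v j * x)))"
      proof (rule summable_comparison_test'[OF summable_mult])
        show "summable (\<lambda>k. norm (mpow n c k v j))" using summ v ij by simp
        show "norm (norm (y * (mpow n c k v j * x))) \<le> (norm y * norm x) * norm (mpow n c k v j)" for k
        proof -
          have "norm (y * (mpow n c k v j * x)) \<le> norm y * (norm (mpow n c k v j) * norm x)"
            by (intro order_trans[OF norm_mult_ineq] mult_left_mono norm_mult_ineq) simp
          then show ?thesis by (simp add: mult_ac)
        qed
      qed
      have "(suminf (\<lambda>k. y * (mpow n c k v j * x))) = y * (N v j * x)"
        unfolding N_def by (rule bounded_linear.suminf[OF bl, symmetric])
          (use summ v ij in \<open>auto intro: summable_norm_cancel\<close>)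
      then show "(\<lambda>k. \<phi> (y * (mpow n c k v j * x))) sums \<phi> (y * (N v j * x))"
        "summable (\<lambda>k. norm (\<phi> (y * (mpow n c k v j * x))))"
        using phi_summable(1,3)[OF _ s] v ij y xM cM by auto
    qed
    define f where "f k = \<phi> (s * (mpow n c k i j * x))" for k
    have f: "f k = of_real (\<sigma>\<^sup>2) * (\<Sum>a<k. \<Sum>u<n. \<Sum>v<n. \<phi> (mpow n c a i u) * (\<kappa> u * g1 u v) * \<phi> (mpow n c (k - 1 - a) v j * x))" for k
      unfolding f_def by (rule Schwinger_Dyson_mpow[OF c x ij]) simp_all
    have "(\<lambda>k. \<Sum>a\<le>k. \<phi> (mpow n c a i u) * \<phi> (mpow n c (k - a) v j * x)) sums (\<phi> (N i u) * \<phi> (N v j * x))"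
      if "u < n" "v < n" for u v
    proof -
      have "(\<lambda>k. \<Sum>a\<le>k. \<phi> (mpow n c a i u) * \<phi> (mpow n c (k - a) v j * x)) sums
          ((suminf (\<lambda>k. \<phi> (mpow n c k i u))) * (suminf (\<lambda>k. \<phi> (mpow n c k v j * x))))"
        by (rule Cauchy_product_sums) (use N(2)[of i u] Nx(2)[of v 1] ij that in simp_all)
      then show ?thesis
        using sums_unique[OF N(3)[of i u]] sums_unique[OF Nx(1)[of v 1]] ij that by simp
    qed
    then have "(\<lambda>k. of_real (\<sigma>\<^sup>2) * (\<Sum>u<n. \<Sum>v<n. (\<kappa> u * g1 u v) *
        (\<Sum>a\<le>k. \<phi> (mpow n c a i u) * \<phi> (mpow n c (k - a) v j * x)))) sums
       (of_real (\<sigma>\<^sup>2) * (\<Sum>u<n. \<Sum>v<n. (\<kappa> u * g1 u v) * (\<phi> (N i u) * \<phi> (N v j * x))))"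
      by (intro sums_mult sums_sum) auto
    moreover have "of_real (\<sigma>\<^sup>2) * (\<Sum>u<n. \<Sum>v<n. (\<kappa> u * g1 u v) *
        (\<Sum>a\<le>k. \<phi> (mpow n c a i u) * \<phi> (mpow n c (k - a) v j * x))) = f (Suc k)" for k
    proof -
      have "(\<Sum>u<n. \<Sum>v<n. (\<kappa> u * g1 u v) * (\<Sum>a\<le>k. \<phi> (mpow n c a i u) * \<phi> (mpow n c (k - a) v j * x)))
        = (\<Sum>u<n. \<Sum>a\<le>k. \<Sum>v<n. \<phi> (mpow n c a i u) * (\<kappa> u * g1 u v) * \<phi> (mpow n c (k - a) v j * x))"
        unfolding sum_distrib_left by (subst (2) sum.swap) (intro sum.cong refl, simp add: mult_ac)
      also have "\<dots> = (\<Sum>a\<le>k. \<Sum>u<n. \<Sum>v<n. \<phi> (mpow n c a i u) * (\<kappa> u * g1 u v) * \<phi> (mpow n c (k - a) v j * x))"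
        by (rule sum.swap)
      finally show ?thesis by (simp add: f lessThan_Suc_atMost)
    qed
    ultimately have "(\<lambda>k. f (Suc k)) sums
       (of_real (\<sigma>\<^sup>2) * (\<Sum>u<n. \<Sum>v<n. (\<kappa> u * g1 u v) * (\<phi> (N i u) * \<phi> (N v j * x))))"
      by (simp only:)
    from sums_Suc[OF this] have "f sums
       (of_real (\<sigma>\<^sup>2) * (\<Sum>u<n. \<Sum>v<n. (\<kappa> u * g1 u v) * (\<phi> (N i u) * \<phi> (N v j * x))))"
      by (simp add: f[of 0])
    moreover have "f sums \<phi> (s * (N i j * x))" unfolding f_def by (rule Nx(1)) (use ij in auto)
    ultimately have eq: "\<phi> (s * (N i j * x)) =
        of_real (\<sigma>\<^sup>2) * (\<Sum>u<n. \<Sum>v<n. (\<kappa> u * g1 u v) * (\<phi> (N i u) * \<phi> (N v j * x)))"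
      by (rule sums_unique2[symmetric])
    have "\<phi> (s * (R i j * x)) = \<kappa> j * \<phi> (s * (N i j * x))"
      using ij xM N by (simp add: RN scaleC_bop_simps phi_scaleC)
    also have "\<dots> = of_real (\<sigma>\<^sup>2) * (\<Sum>u<n. \<Sum>v<n. \<phi> (R i u) * g1 u v * \<phi> (R v j * x))"
      unfolding eq using ij xM N
      by (simp add: RN scaleC_bop_simps phi_scaleC sum_distrib_left mult_ac)
    finally show "\<phi> (s * (R i j * x)) = of_real (\<sigma>\<^sup>2) * (\<Sum>u<n. \<Sum>v<n. \<phi> (R i u) * g1 u v * \<phi> (R v j * x))" .
  qed
qed

lemma Schwinger_Dyson_limit:
  assumes SD: "\<And>k. Schwinger_Dyson_matrix n g1 (X k)"
    and lim: "\<And>i j. i < n \<Longrightarrow> j < n \<Longrightarrow> (\<lambda>k. X k i j) \<longlonglongrightarrow> R i j"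
  shows "Schwinger_Dyson_matrix n g1 R"
  unfolding Schwinger_Dyson_matrix_def
proof (intro conjI allI impI)
  have XM: "X k i j \<in> M" if "i < n" "j < n" for k i j
    using SD that unfolding Schwinger_Dyson_matrix_def by blast
  have l: "(\<lambda>k. \<phi> (y * (X k i j * x))) \<longlonglongrightarrow> \<phi> (y * (R i j * x))" if "i < n" "j < n" "x \<in> M" "y \<in> M" for i j x y
    by (rule phi_tendsto(1)) (use that XM in simp, intro tendsto_intros lim that)
  show "R i j \<in> M" if "i < n" "j < n" for i j
    by (rule phi_tendsto(2)[OF _ lim[OF that]]) (use XM that in simp)
  fix i j x assume ij: "i < n" "j < n" and x: "spanned x (\<lambda>p q. 0)"
  note xM = spanned_M[OF x]
  show "\<phi> (s * (R i j * x)) = of_real (\<sigma>\<^sup>2) * (\<Sum>u<n. \<Sum>v<n. \<phi> (R i u) * g1 u v * \<phi> (R v j * x))"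
  proof (rule LIMSEQ_unique[OF l[OF ij xM s_M]])
    have "\<phi> (s * (X k i j * x)) = of_real (\<sigma>\<^sup>2) * (\<Sum>u<n. \<Sum>v<n. \<phi> (X k i u) * g1 u v * \<phi> (X k v j * x))" for k
      using SD ij x unfolding Schwinger_Dyson_matrix_def by blast
    moreover have "(\<lambda>k. of_real (\<sigma>\<^sup>2) * (\<Sum>u<n. \<Sum>v<n. \<phi> (X k i u) * g1 u v * \<phi> (X k v j * x)))
      \<longlonglongrightarrow> of_real (\<sigma>\<^sup>2) * (\<Sum>u<n. \<Sum>v<n. \<phi> (R i u) * g1 u v * \<phi> (R v j * x))"
      using l[where x=1 and y=1] l[where y=1] ij xM
      by (intro tendsto_intros tendsto_sum) auto
    ultimately show "(\<lambda>k. \<phi> (s * (X k i j * x))) \<longlonglongrightarrow>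
       of_real (\<sigma>\<^sup>2) * (\<Sum>u<n. \<Sum>v<n. \<phi> (R i u) * g1 u v * \<phi> (R v j * x))" by simp
  qed
qed

end

section \<open>Matrices of operators acting on tuples of vectors\<close>

definition mv :: "nat \<Rightarrow> (nat \<Rightarrow> nat \<Rightarrow> 'h::complex_hilbert_space bop) \<Rightarrow> (nat \<Rightarrow> 'h) \<Rightarrow> nat \<Rightarrow> 'h" where
  "mv n A v i = (\<Sum>j<n. app (A i j) (v j))"

definition nrm2 :: "nat \<Rightarrow> (nat \<Rightarrow> 'h::real_normed_vector) \<Rightarrow> real" where
  "nrm2 n v = (\<Sum>i<n. (norm (v i))\<^sup>2)"

lemma nrm2_nonneg [simp]: "0 \<le> nrm2 n v"
  unfolding nrm2_def by (intro sum_nonneg) simp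

lemma nrm2_cong: "(\<And>i. i < n \<Longrightarrow> v i = w i) \<Longrightarrow> nrm2 n v = nrm2 n w"
  unfolding nrm2_def by (intro sum.cong) auto

lemma mv_cong: "(\<And>j. j < n \<Longrightarrow> A i j = B i j) \<Longrightarrow> (\<And>j. j < n \<Longrightarrow> v j = w j) \<Longrightarrow> mv n A v i = mv n B w i"
  unfolding mv_def by (intro sum.cong) auto

lemma norm_le_nrm2: "i < n \<Longrightarrow> (norm (v i))\<^sup>2 \<le> nrm2 n v"
  unfolding nrm2_def by (rule member_le_sum) auto

lemma mv_mmul: "mv n (mmul n A B) v = mv n A (mv n B v)"
proof
  fix i
  have "mv n (mmul n A B) v i = (\<Sum>j<n. \<Sum>k<n. app (A i k) (app (B k j) (v j)))"
    by (simp add: mv_def mmul_def app_sum_left)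
  also have "\<dots> = (\<Sum>k<n. \<Sum>j<n. app (A i k) (app (B k j) (v j)))" by (rule sum.swap)
  finally show "mv n (mmul n A B) v i = mv n A (mv n B v) i" by (simp add: mv_def app_sum)
qed

lemma mv_mone [simp]: "i < n \<Longrightarrow> mv n mone v i = v i"
proof -
  assume "i < n"
  have "mv n mone v i = (\<Sum>j<n. if i = j then v j else 0)"
    unfolding mv_def mone_def by (intro sum.cong) auto
  then show ?thesis using \<open>i < n\<close> by simp
qed

lemma mv_diff: "mv n (\<lambda>i j. A i j - B i j) v i = mv n A v i - mv n B v i"
  and mv_add: "mv n (\<lambda>i j. A i j + B i j) v i = mv n A v i + mv n B v i"
  by (simp_all add: mv_def sum_subtractf sum.distrib)

lemma scaleC_sum_vec: "c *\<^sub>C (\<Sum>i\<in>I. f i) = (\<Sum>i\<in>I. c *\<^sub>C (f i :: 'h::complex_hilbert_space))"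
  by (induction I rule: infinite_finite_induct) (simp_all add: scaleC_add_right scaleC_zero_right)

lemma mv_scaleC: "mv n (\<lambda>i j. c *\<^sub>C A i j) v i = c *\<^sub>C mv n A v i"
  by (simp add: mv_def scaleC_sum_vec)

lemma nrm2_mv_le: "nrm2 n (mv n A v) \<le> (\<Sum>i<n. (\<Sum>j<n. norm (A i j))\<^sup>2) * nrm2 n v"
  unfolding nrm2_def[of n "mv n A v"] sum_distrib_right
proof (intro sum_mono)
  fix i assume "i \<in> {..<n}"
  have "norm (mv n A v i) \<le> (\<Sum>j<n. norm (A i j) * sqrt (nrm2 n v))"
    unfolding mv_def
  proof (intro sum_norm_le)
    fix j assume j: "j \<in> {..<n}"
    have "norm (v j) \<le> sqrt (nrm2 n v)" using norm_le_nrm2[of j n v] j by (simp add: real_le_rsqrt)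
    then show "norm (app (A i j) (v j)) \<le> norm (A i j) * sqrt (nrm2 n v)"
      by (intro order_trans[OF norm_app] mult_left_mono) auto
  qed
  also have "\<dots> = (\<Sum>j<n. norm (A i j)) * sqrt (nrm2 n v)" by (simp add: sum_distrib_right)
  finally have "(norm (mv n A v i))\<^sup>2 \<le> ((\<Sum>j<n. norm (A i j)) * sqrt (nrm2 n v))\<^sup>2"
    by (intro power_mono) auto
  then show "(norm (mv n A v i))\<^sup>2 \<le> (\<Sum>j<n. norm (A i j))\<^sup>2 * nrm2 n v"
    by (simp add: power_mult_distrib)
qed

lemma norm_entry_le:
  fixes A :: "nat \<Rightarrow> nat \<Rightarrow> 'h::complex_hilbert_space bop"
  assumes "\<And>v. nrm2 n (mv n A v) \<le> K\<^sup>2 * nrm2 n v" "0 \<le> K" and ij: "i < n" "j < n"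
  shows "norm (A i j) \<le> K"
proof (rule norm_bop_le)
  fix \<xi> :: 'h
  define v where "v k = (if k = j then \<xi> else 0)" for k
  have "mv n A v i = (\<Sum>k<n. if k = j then app (A i k) \<xi> else 0)"
    unfolding mv_def v_def by (intro sum.cong) auto
  also have "\<dots> = app (A i j) \<xi>" using ij by simp
  finally have "(norm (app (A i j) \<xi>))\<^sup>2 \<le> nrm2 n (mv n A v)"
    using norm_le_nrm2[of i n "mv n A v"] ij by simp
  also have "\<dots> \<le> K\<^sup>2 * nrm2 n v" by (rule assms)
  also have "nrm2 n v = (\<Sum>k<n. if k = j then (norm \<xi>)\<^sup>2 else 0)"
    unfolding nrm2_def v_def by (intro sum.cong) auto
  also have "\<dots> = (norm \<xi>)\<^sup>2" using ij by simp
  finally have "(norm (app (A i j) \<xi>))\<^sup>2 \<le> (K * norm \<xi>)\<^sup>2" by (simp add: power_mult_distrib)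
  then show "norm (app (A i j) \<xi>) \<le> K * norm \<xi>" by (rule power2_le_imp_le) (use assms in simp)
qed

lemma norm_mpow_le:
  assumes c: "\<And>v. nrm2 n (mv n c v) \<le> r\<^sup>2 * nrm2 n v" and r: "0 \<le> r" and ij: "i < n" "j < n"
  shows "norm (mpow n c k i j) \<le> r ^ k"
proof (rule norm_entry_le[OF _ _ ij])
  show "nrm2 n (mv n (mpow n c k) v) \<le> (r ^ k)\<^sup>2 * nrm2 n v" for v
  proof (induction k)
    case 0
    have "nrm2 n (mv n mone v) = nrm2 n v" by (rule nrm2_cong) simp
    then show ?case by simp
  next
    case (Suc k)
    have "nrm2 n (mv n (mpow n c (Suc k)) v) \<le> r\<^sup>2 * nrm2 n (mv n (mpow n c k) v)"
      by (simp add: mv_mmul c)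
    also have "\<dots> \<le> r\<^sup>2 * ((r ^ k)\<^sup>2 * nrm2 n v)" by (intro mult_left_mono Suc) simp
    finally show ?case by (simp add: power_mult_distrib mult_ac)
  qed
qed (use r in simp)

lemma summable_mpow:
  assumes "\<And>v. nrm2 n (mv n c v) \<le> r\<^sup>2 * nrm2 n v" "0 \<le> r" "r < 1" "i < n" "j < n"
  shows "summable (\<lambda>k. norm (mpow n c k i j))"
  by (rule summable_comparison_test'[OF summable_geometric[of r]])
    (use assms norm_mpow_le[of n c r i j] in auto)

lemma norm_diff_square:
  "(norm (x - w))\<^sup>2 = (norm x)\<^sup>2 - 2 * Re (cinner w x) + (norm (w::'h::complex_hilbert_space))\<^sup>2"
proof -
  have "complex_of_real ((norm (x - w))\<^sup>2) = cinner x x - (cinner w x + cnj (cinner w x)) + cinner w w"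
    unfolding cinner_self[symmetric]
    by (simp add: cinner_diff_left cinner_diff_right cinner_commute[of x w])
  also have "\<dots> = complex_of_real ((norm x)\<^sup>2 - 2 * Re (cinner w x) + (norm w)\<^sup>2)"
    unfolding cinner_self by (simp add: complex_eq_iff)
  finally show ?thesis by (simp only: of_real_eq_iff)
qed

text \<open>One has \<open>norm (v - \<kappa> B v)\<^sup>2 = norm v\<^sup>2 - 2 Re \<langle>\<kappa> B v, v\<rangle> + \<bar>\<kappa>\<bar>\<^sup>2 norm (B v)\<^sup>2\<close>. For \<open>\<kappa> = - \<i> sg \<tau>\<close> the middle
  term is at most \<open>- 2 \<tau> y norm v\<^sup>2\<close>, which for small \<open>\<tau>\<close> outweighs the last one.\<close>

lemma accretive_contraction:
  fixes B :: "nat \<Rightarrow> nat \<Rightarrow> 'h::complex_hilbert_space bop"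
  assumes y: "y > 0" and sg: "sg = 1 \<or> sg = (-1::real)"
    and acc: "\<And>v. y * nrm2 n v \<le> sg * Im (\<Sum>i<n. cinner (mv n B v i) (v i))"
  obtains \<kappa> :: complex and r :: real where "\<kappa> \<noteq> 0" "0 \<le> r" "r < 1"
    "\<And>v. nrm2 n (mv n (\<lambda>i j. mone i j - \<kappa> *\<^sub>C B i j) v) \<le> r\<^sup>2 * nrm2 n v"
proof -
  define C where "C = (\<Sum>i<n. (\<Sum>j<n. norm (B i j))\<^sup>2)"
  have C: "0 \<le> C" unfolding C_def by (intro sum_nonneg) simp
  define \<tau> where "\<tau> = y / (C + y\<^sup>2)"
  have den: "C + y\<^sup>2 > 0" using C y by (intro add_nonneg_pos) auto
  have \<tau>: "\<tau> > 0" using y den by (simp add: \<tau>_def)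
  have \<tau>y: "\<tau> * y \<le> 1" using den C by (simp add: \<tau>_def power2_eq_square)
  have "\<tau> * C \<le> y" using den C y by (simp add: \<tau>_def field_simps)
  then have \<tau>C: "\<tau>\<^sup>2 * C \<le> \<tau> * y" using \<tau> by (simp add: power2_eq_square mult.assoc)
  define \<kappa> where "\<kappa> = - \<i> * complex_of_real (sg * \<tau>)"
  define r where "r = sqrt (1 - \<tau> * y)"
  have "nrm2 n (mv n (\<lambda>i j. mone i j - \<kappa> *\<^sub>C B i j) v) \<le> r\<^sup>2 * nrm2 n v" for v
  proof -
    have cm: "(cmod \<kappa>)\<^sup>2 = \<tau>\<^sup>2" using sg by (auto simp: \<kappa>_def norm_mult)
    have "nrm2 n (mv n (\<lambda>i j. mone i j - \<kappa> *\<^sub>C B i j) v)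
      = (\<Sum>i<n. (norm (v i))\<^sup>2 - 2 * Re (\<kappa> * cinner (mv n B v i) (v i)) + \<tau>\<^sup>2 * (norm (mv n B v i))\<^sup>2)"
      unfolding nrm2_def
      by (intro sum.cong refl)
        (simp add: mv_diff mv_scaleC norm_diff_square cinner_scaleC_left norm_scaleC power_mult_distrib cm)
    also have "\<dots> = nrm2 n v - 2 * (\<tau> * (sg * Im (\<Sum>i<n. cinner (mv n B v i) (v i)))) + \<tau>\<^sup>2 * nrm2 n (mv n B v)"
      by (simp add: nrm2_def sum.distrib sum_subtractf sum_distrib_left \<kappa>_def mult_ac)
    also have "\<dots> \<le> nrm2 n v - 2 * (\<tau> * (y * nrm2 n v)) + \<tau>\<^sup>2 * (C * nrm2 n v)"
      using acc[of v] \<tau> nrm2_mv_le[of n B v]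
      by (intro add_mono diff_left_mono mult_left_mono) (auto simp: C_def)
    also have "\<dots> \<le> nrm2 n v - 2 * (\<tau> * (y * nrm2 n v)) + (\<tau> * y) * nrm2 n v"
      using mult_right_mono[OF \<tau>C, of "nrm2 n v"] by (simp add: mult.assoc)
    also have "\<dots> = r\<^sup>2 * nrm2 n v" using \<tau>y by (simp add: r_def algebra_simps)
    finally show ?thesis .
  qed
  moreover have "\<kappa> \<noteq> 0" using \<tau> sg by (auto simp: \<kappa>_def)
  moreover have "0 \<le> r" "r < 1" using \<tau>y \<tau> y by (auto simp: r_def)
  ultimately show ?thesis using that by blast
qed

section \<open>Resolvents at the boundary\<close>

lemma nrm2_add_le: "nrm2 n (\<lambda>i. v i + w i) \<le> 2 * nrm2 n v + 2 * nrm2 n w"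
  unfolding nrm2_def sum_distrib_left sum.distrib[symmetric]
proof (intro sum_mono)
  fix i
  have "(norm (v i + w i))\<^sup>2 \<le> (norm (v i) + norm (w i))\<^sup>2"
    by (intro power_mono norm_triangle_ineq) simp
  also have "\<dots> \<le> 2 * (norm (v i))\<^sup>2 + 2 * (norm (w i))\<^sup>2"
    using sum_squares_bound[of "norm (v i)" "norm (w i)"] by (simp add: power2_sum)
  finally show "(norm (v i + w i))\<^sup>2 \<le> 2 * (norm (v i))\<^sup>2 + 2 * (norm (w i))\<^sup>2" .
qed

lemma nrm2_scaleC: "nrm2 n (\<lambda>i. c *\<^sub>C (v i :: 'h::complex_hilbert_space)) = (cmod c)\<^sup>2 * nrm2 n v"
  by (simp add: nrm2_def norm_scaleC power_mult_distrib sum_distrib_left)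

lemma nrm2_inverse_le:
  assumes "is_minv n B R" "\<And>v. nrm2 n v \<le> K * nrm2 n (mv n B v)"
  shows "nrm2 n (mv n R v) \<le> K * nrm2 n v"
proof -
  have "mv n B (mv n R v) i = v i" if "i < n" for i
  proof -
    have "mv n (mmul n B R) v i = mv n mone v i"
      using assms(1) that by (intro mv_cong) (auto simp: is_minv_def)
    then show ?thesis using that by (simp add: mv_mmul)
  qed
  then have "nrm2 n (mv n B (mv n R v)) = nrm2 n v" by (rule nrm2_cong)
  then show ?thesis using assms(2)[of "mv n R v"] by simp
qed

text \<open>The shift moves the numerical range of \<open>B\<close> into an open half plane; \<open>sg\<close> is \<open>1\<close> for the upper and \<open>-1\<close> for the
  lower one.\<close>

definition shifted ::
    "(nat \<Rightarrow> nat \<Rightarrow> 'h::complex_hilbert_space bop) \<Rightarrow> real \<Rightarrow> real \<Rightarrow> nat \<Rightarrow> nat \<Rightarrow> 'h bop" where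
  "shifted B sg y i j = B i j + (\<i> * complex_of_real (sg * y)) *\<^sub>C mone i j"

context
  fixes n :: nat and B :: "nat \<Rightarrow> nat \<Rightarrow> 'h::complex_hilbert_space bop" and sg D :: real
  assumes D: "D > 0" and sg: "sg = 1 \<or> sg = -1"
    and lower: "\<And>v. nrm2 n v \<le> D\<^sup>2 * nrm2 n (mv n B v)"
    and acc: "\<And>v. 0 \<le> sg * Im (\<Sum>i<n. cinner (mv n B v i) (v i))"
begin

lemma mv_shifted: "i < n \<Longrightarrow> mv n (shifted B sg y) v i = mv n B v i + (\<i> * complex_of_real (sg * y)) *\<^sub>C v i"
  by (simp add: shifted_def[abs_def] mv_add mv_scaleC del: of_real_mult)

lemma shifted_accretive:
  "y * nrm2 n v \<le> sg * Im (\<Sum>i<n. cinner (mv n (shifted B sg y) v i) (v i))"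
proof -
  have "(\<Sum>i<n. cinner (mv n (shifted B sg y) v i) (v i))
     = (\<Sum>i<n. cinner (mv n B v i) (v i)) + \<i> * complex_of_real (sg * y * nrm2 n v)"
    by (simp add: mv_shifted cinner_add_left cinner_scaleC_left cinner_self sum.distrib nrm2_def
        sum_distrib_left mult.assoc)
  then have "sg * Im (\<Sum>i<n. cinner (mv n (shifted B sg y) v i) (v i))
     = sg * Im (\<Sum>i<n. cinner (mv n B v i) (v i)) + sg * (sg * (y * nrm2 n v))"
    by (simp add: distrib_left mult.assoc)
  moreover have "sg * (sg * (y * nrm2 n v)) = y * nrm2 n v" using sg by auto
  ultimately show ?thesis using acc[of v] by linarith
qed

lemma shifted_lower:
  assumes "0 < y" "y \<le> 1 / (4 * D)"
  shows "nrm2 n v \<le> (2 * D)\<^sup>2 * nrm2 n (mv n (shifted B sg y) v)"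
proof -
  have "nrm2 n (mv n B v) = nrm2 n (\<lambda>i. mv n (shifted B sg y) v i + (- (\<i> * complex_of_real (sg * y))) *\<^sub>C v i)"
    by (rule nrm2_cong) (simp add: mv_shifted scaleC_minus_left)
  also have "\<dots> \<le> 2 * nrm2 n (mv n (shifted B sg y) v) + 2 * (y\<^sup>2 * nrm2 n v)"
    using nrm2_add_le[of n "mv n (shifted B sg y) v" "\<lambda>i. (- (\<i> * complex_of_real (sg * y))) *\<^sub>C v i"] sg
    by (auto simp: nrm2_scaleC norm_mult)
  finally have bound: "nrm2 n v \<le> D\<^sup>2 * (2 * nrm2 n (mv n (shifted B sg y) v) + 2 * (y\<^sup>2 * nrm2 n v))"
    using order_trans[OF lower[of v] mult_left_mono] by simp
  moreover have "(D * y)\<^sup>2 \<le> (1/4)\<^sup>2" using assms D by (intro power_mono) (auto simp: field_simps)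
  moreover have "(1/4::real)\<^sup>2 \<le> 1/4" by (simp add: power2_eq_square)
  ultimately have "D\<^sup>2 * y\<^sup>2 \<le> 1/4" unfolding power_mult_distrib by linarith
  then have "D\<^sup>2 * y\<^sup>2 * nrm2 n v \<le> 1/4 * nrm2 n v"
    by (intro mult_right_mono) auto
  moreover note bound
  ultimately show ?thesis by (simp add: power_mult_distrib algebra_simps)
qed

lemma shifted_resolvent:
  assumes y: "0 < y" "y \<le> 1 / (4 * D)"
  obtains \<kappa> R where "\<kappa> \<noteq> 0" "is_minv n (shifted B sg y) R"
    "\<And>i j. i < n \<Longrightarrow> j < n \<Longrightarrow> summable (\<lambda>k. norm (mpow n (\<lambda>i j. mone i j - \<kappa> *\<^sub>C shifted B sg y i j) k i j))"
    "\<And>v. nrm2 n (mv n R v) \<le> (2 * D)\<^sup>2 * nrm2 n v"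
proof -
  obtain \<kappa> r where k: "\<kappa> \<noteq> 0" "0 \<le> r" "r < 1"
    "\<And>v. nrm2 n (mv n (\<lambda>i j. mone i j - \<kappa> *\<^sub>C shifted B sg y i j) v) \<le> r\<^sup>2 * nrm2 n v"
    using accretive_contraction[OF y(1) sg shifted_accretive] by blast
  have s: "summable (\<lambda>k. norm (mpow n (\<lambda>i j. mone i j - \<kappa> *\<^sub>C shifted B sg y i j) k i j))" if "i < n" "j < n" for i j
    by (rule summable_mpow[OF k(4,2,3) that])
  have R: "is_minv n (shifted B sg y) (\<lambda>i j. \<kappa> *\<^sub>C (suminf (\<lambda>k. mpow n (\<lambda>i j. mone i j - \<kappa> *\<^sub>C shifted B sg y i j) k i j)))"
    using preconditioned_inverse[of n "\<lambda>_. \<kappa>" "shifted B sg y"] k(1) s by simp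
  show ?thesis by (rule that[OF k(1) R s nrm2_inverse_le[OF R shifted_lower[OF y]]])
qed

lemma shifted_resolvents:
  assumes y: "\<And>k. 0 < y k" "\<And>k. y k \<le> 1 / (4 * D)"
  obtains \<kappa> X where "\<And>k. \<kappa> k \<noteq> 0" "\<And>k. is_minv n (shifted B sg (y k)) (X k)"
    "\<And>k i j. i < n \<Longrightarrow> j < n \<Longrightarrow>
       summable (\<lambda>l. norm (mpow n (\<lambda>i j. mone i j - \<kappa> k *\<^sub>C shifted B sg (y k) i j) l i j))"
    "\<And>k v. nrm2 n (mv n (X k) v) \<le> (2 * D)\<^sup>2 * nrm2 n v"
proof -
  define P where "P k \<kappa> X \<longleftrightarrow> \<kappa> \<noteq> 0 \<and> is_minv n (shifted B sg (y k)) X \<and>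
    (\<forall>i<n. \<forall>j<n. summable (\<lambda>l. norm (mpow n (\<lambda>i j. mone i j - \<kappa> *\<^sub>C shifted B sg (y k) i j) l i j))) \<and>
    (\<forall>v. nrm2 n (mv n X v) \<le> (2 * D)\<^sup>2 * nrm2 n v)" for k \<kappa> X
  have "\<exists>F. P k (fst F) (snd F)" for k
    by (rule shifted_resolvent[OF y[of k]]) (rule exI[of _ "(_, _)"], auto simp: P_def)
  then obtain F where "P k (fst (F k)) (snd (F k))" for k by metis
  then show ?thesis
    by (intro that[of "\<lambda>k. fst (F k)" "\<lambda>k. snd (F k)"]) (simp_all add: P_def)
qed

text \<open>The lower bound passes to small shifts, so the inverses of the shifted matrices are bounded uniformly, and
  \<open>B\<close> is an invertible perturbation of a shifted matrix.\<close>

lemma boundary_resolvent: "\<exists>R. is_minv n B R"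
proof -
  \<comment> \<open>small enough that the perturbation below has norm at most one half\<close>
  define y where "y = 1 / (4 * D)"
  have y: "0 < y" "y \<le> 1 / (4 * D)" using D by (auto simp: y_def)
  obtain R where R: "is_minv n (shifted B sg y) R" and nR: "\<And>v. nrm2 n (mv n R v) \<le> (2 * D)\<^sup>2 * nrm2 n v"
    using shifted_resolvent[OF y] by metis
  define \<eta> where "\<eta> = \<i> * complex_of_real (sg * y)"
  define c where "c i j = \<eta> *\<^sub>C R i j" for i j
  have "nrm2 n (mv n c v) \<le> (1/2)\<^sup>2 * nrm2 n v" for v
  proof -
    have "nrm2 n (mv n c v) = nrm2 n (\<lambda>i. \<eta> *\<^sub>C mv n R v i)"
      by (rule nrm2_cong) (simp add: c_def[abs_def] mv_scaleC)
    also have "\<dots> = y\<^sup>2 * nrm2 n (mv n R v)"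
      using sg by (auto simp: nrm2_scaleC \<eta>_def norm_mult)
    also have "\<dots> \<le> y\<^sup>2 * ((2 * D)\<^sup>2 * nrm2 n v)" by (intro mult_left_mono nR) simp
    also have "\<dots> = (1/2)\<^sup>2 * nrm2 n v" using D by (simp add: y_def power2_eq_square)
    finally show ?thesis .
  qed
  then have "\<And>i j. i < n \<Longrightarrow> j < n \<Longrightarrow> summable (\<lambda>k. norm (mpow n c k i j))"
    by (rule summable_mpow) auto
  from Neumann_series[OF this] obtain N where N: "is_minv n (\<lambda>i j. mone i j - c i j) N" by blast
  have BR: "B i j = mmul n (shifted B sg y) (\<lambda>i j. mone i j - c i j) i j" if ij: "i < n" "j < n" for i j
  proof -
    have "mmul n (shifted B sg y) (\<lambda>i j. mone i j - c i j) i j = shifted B sg y i j - \<eta> *\<^sub>C mmul n (shifted B sg y) R i j"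
      using ij by (simp add: mmul_def c_def right_diff_distrib sum_subtractf
          sum_mone_right scaleC_sum_right scaleC_bop_simps)
    then show ?thesis using R ij by (simp add: is_minv_def shifted_def \<eta>_def)
  qed
  have "is_minv n B (mmul n N R)" unfolding is_minv_def
  proof (intro allI impI conjI)
    fix i j assume ij: "i < n" "j < n"
    have "mmul n B (mmul n N R) i j = mmul n (mmul n (shifted B sg y) (\<lambda>i j. mone i j - c i j)) (mmul n N R) i j"
      by (rule mmul_cong) (use BR ij in auto)
    also have "\<dots> = mmul n (shifted B sg y) (mmul n (mmul n (\<lambda>i j. mone i j - c i j) N) R) i j"
      by (simp add: mmul_assoc)
    also have "\<dots> = mmul n (shifted B sg y) R i j"
    proof (rule mmul_cong)
      fix k assume "k < n"
      then have "mmul n (mmul n (\<lambda>i j. mone i j - c i j) N) R k j = mmul n mone R k j"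
        by (intro mmul_cong) (use N ij in \<open>auto simp: is_minv_def\<close>)
      then show "mmul n (mmul n (\<lambda>i j. mone i j - c i j) N) R k j = R k j" using \<open>k < n\<close> by simp
    qed simp
    finally show "mmul n B (mmul n N R) i j = mone i j" using R ij by (simp add: is_minv_def)
    have "mmul n (mmul n N R) B i j = mmul n (mmul n N R) (mmul n (shifted B sg y) (\<lambda>i j. mone i j - c i j)) i j"
      by (rule mmul_cong) (use BR ij in auto)
    also have "\<dots> = mmul n N (mmul n (mmul n R (shifted B sg y)) (\<lambda>i j. mone i j - c i j)) i j"
      by (simp add: mmul_assoc)
    also have "\<dots> = mmul n N (\<lambda>i j. mone i j - c i j) i j"
    proof (rule mmul_cong)
      fix k assume "k < n"
      then have "mmul n (mmul n R (shifted B sg y)) (\<lambda>i j. mone i j - c i j) k j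
        = mmul n mone (\<lambda>i j. mone i j - c i j) k j"
        by (intro mmul_cong) (use R ij in \<open>auto simp: is_minv_def\<close>)
      then show "mmul n (mmul n R (shifted B sg y)) (\<lambda>i j. mone i j - c i j) k j = mone k j - c k j"
        using \<open>k < n\<close> by simp
    qed simp
    finally show "mmul n (mmul n N R) B i j = mone i j" using N ij by (simp add: is_minv_def)
  qed
  then show ?thesis by blast
qed

text \<open>By the resolvent identity \<open>X\<^sub>k - R = - \<eta>\<^sub>k X\<^sub>k R\<close>, where \<open>\<eta>\<^sub>k\<close> is the shift.\<close>

lemma resolvent_tendsto:
  assumes R: "is_minv n B R" and X: "\<And>k. is_minv n (shifted B sg (y k)) (X k)"
    and nX: "\<And>k v. nrm2 n (mv n (X k) v) \<le> (2 * D)\<^sup>2 * nrm2 n v"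
    and y: "\<And>k. 0 < y k" "y \<longlonglongrightarrow> 0" and ij: "i < n" "j < n"
  shows "(\<lambda>k. X k i j) \<longlonglongrightarrow> R i j"
proof -
  define \<eta> where "\<eta> k = \<i> * complex_of_real (sg * y k)" for k
  have eq: "X k i j - R i j = - (\<eta> k *\<^sub>C mmul n (X k) R i j)" for k
  proof -
    have "R i j = mmul n (mmul n (X k) (shifted B sg (y k))) R i j"
    proof -
      have "mmul n (mmul n (X k) (shifted B sg (y k))) R i j = mmul n mone R i j"
        by (rule mmul_cong) (use X ij in \<open>auto simp: is_minv_def\<close>)
      then show ?thesis using ij by simp
    qed
    also have "\<dots> = mmul n (X k) (mmul n (shifted B sg (y k)) R) i j" by (simp add: mmul_assoc)
    also have "\<dots> = mmul n (X k) (\<lambda>i j. mone i j + \<eta> k *\<^sub>C R i j) i j"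
    proof (rule mmul_cong)
      fix l assume l: "l < n"
      have "mmul n (shifted B sg (y k)) R l j = mmul n B R l j + \<eta> k *\<^sub>C mmul n mone R l j"
        unfolding mmul_def shifted_def \<eta>_def
        by (simp add: distrib_right sum.distrib scaleC_sum_right scaleC_bop_simps)
      then show "mmul n (shifted B sg (y k)) R l j = mone l j + \<eta> k *\<^sub>C R l j"
        using R l ij by (simp add: is_minv_def)
    qed simp
    also have "\<dots> = X k i j + \<eta> k *\<^sub>C mmul n (X k) R i j"
      using ij by (simp add: mmul_def distrib_left sum.distrib sum_mone_right scaleC_sum_right scaleC_bop_simps)
    finally show ?thesis by simp
  qed
  have XB: "norm (X k i l) \<le> 2 * D" if "l < n" for k l
    by (rule norm_entry_le[OF nX]) (use D ij that in auto)
  have "norm (X k i j - R i j) \<le> y k * (2 * D * (\<Sum>l<n. norm (R l j)))" for k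
  proof -
    have "norm (mmul n (X k) R i j) \<le> (\<Sum>l<n. 2 * D * norm (R l j))" unfolding mmul_def
      by (intro sum_norm_le order_trans[OF norm_mult_ineq] mult_right_mono XB) auto
    moreover have "cmod (\<eta> k) = y k" using sg y(1)[of k] by (auto simp: \<eta>_def norm_mult)
    ultimately show ?thesis using y(1)[of k]
      by (simp add: eq norm_scaleC_bop sum_distrib_left[symmetric])
  qed
  moreover have "(\<lambda>k. y k * (2 * D * (\<Sum>l<n. norm (R l j)))) \<longlonglongrightarrow> 0"
    using tendsto_mult_right[OF y(2), of "2 * D * (\<Sum>l<n. norm (R l j))"] by simp
  ultimately have "(\<lambda>k. X k i j - R i j) \<longlonglongrightarrow> 0"
    by (rule Lim_null_comparison[OF always_eventually[OF allI]])
  then show ?thesis by (simp add: LIM_zero_iff)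
qed

end

section \<open>Upper triangular block matrices\<close>

text \<open>The block matrix with rows \<open>(A, E)\<close> and \<open>(0, C)\<close>, whose blocks have size \<open>n\<close>.\<close>

definition tri :: "nat \<Rightarrow> (nat \<Rightarrow> nat \<Rightarrow> 'a::zero) \<Rightarrow> (nat \<Rightarrow> nat \<Rightarrow> 'a) \<Rightarrow> (nat \<Rightarrow> nat \<Rightarrow> 'a) \<Rightarrow> nat \<Rightarrow> nat \<Rightarrow> 'a" where
  "tri n A E C i j = (if i < n then if j < n then A i j else E i (j - n) else if j < n then 0 else C (i - n) (j - n))"

lemma tri_simps [simp]:
  "i < n \<Longrightarrow> j < n \<Longrightarrow> tri n A E C i j = A i j" "i < n \<Longrightarrow> tri n A E C i (n + j) = E i j"
  "j < n \<Longrightarrow> tri n A E C (n + i) j = 0" "tri n A E C (n + i) (n + j) = C i j"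
  by (simp_all add: tri_def)

lemma sum_split_block: "(\<Sum>k<n + m. f k) = (\<Sum>k<n. f k) + (\<Sum>k<m. f (n + k :: nat))"
proof -
  have "{..<n + m} = {..<n} \<union> (\<lambda>k. n + k) ` {..<m}"
    unfolding set_eq_iff Un_iff image_iff Bex_def lessThan_iff by presburger
  moreover have "(\<Sum>k\<in>{..<n} \<union> (\<lambda>k. n + k) ` {..<m}. f k) = (\<Sum>k<n. f k) + (\<Sum>k\<in>(\<lambda>k. n + k) ` {..<m}. f k)"
    by (rule sum.union_disjoint) auto
  ultimately show ?thesis by (simp add: sum.reindex)
qed

lemma block_cases:
  fixes i n m :: nat
  assumes "i < n + m" obtains "i < n" | k where "i = n + k" "k < m"
proof (cases "i < n")
  case False
  then show ?thesis using assms that(2)[of "i - n"] by simp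
qed (rule that)

lemma tri_mone: "tri n mone (\<lambda>i j. 0) mone i j = mone i j"
  by (auto simp: tri_def mone_def)

lemma mone_block:
  "mone (n + i) (n + j) = mone i j" "i < n \<Longrightarrow> mone i (n + j) = 0" "j < n \<Longrightarrow> mone (n + i) j = 0"
  by (simp_all add: mone_def)

lemma mmul_tri:
  fixes A :: "nat \<Rightarrow> nat \<Rightarrow> 'a::semiring_0"
  assumes "i < n + n" "j < n + n"
  shows "mmul (n + n) (tri n A E C) (tri n A' E' C') i j
    = tri n (mmul n A A') (\<lambda>i j. mmul n A E' i j + mmul n E C' i j) (mmul n C C') i j"
  using assms
  by (auto elim!: block_cases simp: mmul_def sum_split_block)

text \<open>The upper right block of the \<open>k\<close>-th power of \<open>tri n A E C\<close>.\<close>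

fun corner :: "nat \<Rightarrow> (nat \<Rightarrow> nat \<Rightarrow> 'a::semiring_1) \<Rightarrow> (nat \<Rightarrow> nat \<Rightarrow> 'a) \<Rightarrow> (nat \<Rightarrow> nat \<Rightarrow> 'a) \<Rightarrow> nat \<Rightarrow> nat \<Rightarrow> nat \<Rightarrow> 'a" where
  "corner n A E C 0 = (\<lambda>i j. 0)"
| "corner n A E C (Suc k) = (\<lambda>i j. \<Sum>a\<le>k. mmul n (mpow n A a) (mmul n E (mpow n C (k - a))) i j)"

lemma corner_Suc:
  assumes "i < n" "j < n"
  shows "mmul n A (corner n A E C k) i j + mmul n E (mpow n C k) i j = corner n A E C (Suc k) i j"
proof (cases k)
  case 0
  then show ?thesis using assms by (simp add: mmul_def[of n A])
next
  case (Suc l)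
  have "mmul n A (corner n A E C k) i j
    = (\<Sum>u<n. \<Sum>a\<le>l. A i u * mmul n (mpow n A a) (mmul n E (mpow n C (l - a))) u j)"
    by (simp add: Suc mmul_def[of n A] sum_distrib_left)
  also have "\<dots> = (\<Sum>a\<le>l. mmul n A (mmul n (mpow n A a) (mmul n E (mpow n C (l - a)))) i j)"
    by (subst sum.swap) (simp add: mmul_def[of n A])
  finally have "mmul n A (corner n A E C k) i j
    = (\<Sum>a\<le>l. mmul n (mpow n A (Suc a)) (mmul n E (mpow n C (k - Suc a))) i j)"
    by (simp add: Suc mmul_assoc)
  moreover have "mmul n E (mpow n C k) i j = mmul n (mpow n A 0) (mmul n E (mpow n C (k - 0))) i j"
    using assms by simp
  moreover have "corner n A E C (Suc k) i j = mmul n (mpow n A 0) (mmul n E (mpow n C (k - 0))) i j +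
      (\<Sum>a\<le>l. mmul n (mpow n A (Suc a)) (mmul n E (mpow n C (k - Suc a))) i j)"
    by (simp only: corner.simps Suc sum.atMost_Suc_shift)
  ultimately show ?thesis by (simp add: add.commute)
qed

lemma mpow_tri:
  assumes "i < n + n" "j < n + n"
  shows "mpow (n + n) (tri n A E C) k i j = tri n (mpow n A k) (corner n A E C k) (mpow n C k) i j"
  using assms
proof (induction k arbitrary: i j)
  case (Suc k)
  have "mpow (n + n) (tri n A E C) (Suc k) i j
    = mmul (n + n) (tri n A E C) (tri n (mpow n A k) (corner n A E C k) (mpow n C k)) i j"
    unfolding mpow.simps by (rule mmul_cong) (use Suc in auto)
  also have "\<dots> = tri n (mpow n A (Suc k)) (corner n A E C (Suc k)) (mpow n C (Suc k)) i j"
    unfolding mmul_tri[OF Suc.prems]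
    using Suc.prems by (auto elim!: block_cases simp: corner_Suc simp del: corner.simps)
  finally show ?case .
qed (simp add: tri_mone)

lemma summable_corner:
  fixes A :: "nat \<Rightarrow> nat \<Rightarrow> 'a::{real_normed_algebra_1, banach}"
  assumes A: "\<And>i j. i < n \<Longrightarrow> j < n \<Longrightarrow> summable (\<lambda>k. norm (mpow n A k i j))"
    and C: "\<And>i j. i < n \<Longrightarrow> j < n \<Longrightarrow> summable (\<lambda>k. norm (mpow n C k i j))"
    and ij: "i < n" "j < n"
  shows "summable (\<lambda>k. norm (corner n A E C k i j))"
proof (subst summable_Suc_iff[symmetric], rule summable_comparison_test')
  show "summable (\<lambda>k. \<Sum>u<n. \<Sum>v<n. norm (E u v) * (\<Sum>a\<le>k. norm (mpow n A a i u) * norm (mpow n C (k - a) v j)))"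
    using A C ij by (intro summable_sum summable_mult summable_Cauchy_product) auto
  fix k
  have "norm (corner n A E C (Suc k) i j)
    \<le> (\<Sum>a\<le>k. \<Sum>u<n. norm (mpow n A a i u) * (\<Sum>v<n. norm (E u v) * norm (mpow n C (k - a) v j)))"
    unfolding corner.simps mmul_def[of n]
    by (intro sum_norm_le order_trans[OF norm_mult_ineq] mult_left_mono norm_mult_ineq) auto
  also have "\<dots> = (\<Sum>a\<le>k. \<Sum>u<n. \<Sum>v<n. norm (E u v) * (norm (mpow n A a i u) * norm (mpow n C (k - a) v j)))"
    by (simp add: sum_distrib_left mult_ac)
  also have "\<dots> = (\<Sum>u<n. \<Sum>v<n. norm (E u v) * (\<Sum>a\<le>k. norm (mpow n A a i u) * norm (mpow n C (k - a) v j)))"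
    unfolding sum_distrib_left
    by (rule trans[OF sum.swap], intro sum.cong[OF refl], rule sum.swap)
  finally show "norm (norm (corner n A E C (Suc k) i j)) \<le> \<dots>" by simp
qed

lemma is_minv_tri:
  fixes B1 :: "nat \<Rightarrow> nat \<Rightarrow> 'a::ring_1"
  assumes R1: "is_minv n B1 R1" and R2: "is_minv n B2 R2"
  shows "is_minv (n + n) (tri n B1 (\<lambda>i j. - E i j) B2) (tri n R1 (mmul n R1 (mmul n E R2)) R2)"
proof -
  have "mmul n B1 (mmul n R1 (mmul n E R2)) i j = mmul n E R2 i j"
    "mmul n (mmul n R1 (mmul n E R2)) B2 i j = mmul n R1 E i j" if "i < n" "j < n" for i j
  proof -
    have "mmul n (mmul n B1 R1) (mmul n E R2) i j = mmul n mone (mmul n E R2) i j"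
      by (rule mmul_cong) (use R1 that in \<open>auto simp: is_minv_def\<close>)
    then show "mmul n B1 (mmul n R1 (mmul n E R2)) i j = mmul n E R2 i j" using that by (simp add: mmul_assoc)
    have "mmul n (mmul n R1 E) (mmul n R2 B2) i j = mmul n (mmul n R1 E) mone i j"
      by (rule mmul_cong) (use R2 that in \<open>auto simp: is_minv_def\<close>)
    moreover have "mmul n (mmul n R1 E) mone i j = mmul n R1 E i j" using that by simp
    ultimately show "mmul n (mmul n R1 (mmul n E R2)) B2 i j = mmul n R1 E i j" by (simp add: mmul_assoc)
  qed
  moreover have "mmul n (\<lambda>i j. - E i j) A i j = - mmul n E A i j" "mmul n A (\<lambda>i j. - E i j) i j = - mmul n A E i j"
    for i j and A :: "nat \<Rightarrow> nat \<Rightarrow> 'a"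
    by (simp_all add: mmul_def sum_negf)
  ultimately show ?thesis
    using R1 R2 unfolding is_minv_def
    by (auto simp: mmul_tri mone_block elim!: block_cases)
qed

lemma is_minv_cong:
  assumes "is_minv n A B" "\<And>i j. i < n \<Longrightarrow> j < n \<Longrightarrow> A i j = A' i j" "\<And>i j. i < n \<Longrightarrow> j < n \<Longrightarrow> B i j = B' i j"
  shows "is_minv n A' B'"
proof -
  have "mmul n A B i j = mmul n A' B' i j" "mmul n B A i j = mmul n B' A' i j" if "i < n" "j < n" for i j
    using assms(2,3) that by (auto intro!: mmul_cong)
  then show ?thesis using assms(1) unfolding is_minv_def by auto
qed

lemma is_minv_tri_mone:
  fixes B1 :: "nat \<Rightarrow> nat \<Rightarrow> 'a::ring_1"
  assumes "is_minv n B1 R1" "is_minv n B2 R2"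
  shows "is_minv (n + n) (tri n B1 (\<lambda>i j. - mone i j) B2) (tri n R1 (mmul n R1 R2) R2)"
proof (rule is_minv_cong[OF is_minv_tri[OF assms, of mone] refl])
  fix i j assume "i < n + n" "j < n + n"
  moreover have "mmul n R1 (mmul n mone R2) i j = mmul n R1 R2 i j" for i j by (rule mmul_cong) simp_all
  ultimately show "tri n R1 (mmul n R1 (mmul n mone R2)) R2 i j = tri n R1 (mmul n R1 R2) R2 i j"
    by (simp add: tri_def)
qed

context free_semicircular
begin

text \<open>The product of two resolvents whose numerical ranges lie in opposite half planes is a block of one
  resolvent of twice the size. The two diagonal blocks call for different scalar preconditioners, and these suffice
  for the whole matrix: the powers of a triangular matrix are summable as soon as those of its diagonal blocks are.\<close>

theorem Schwinger_Dyson_pair: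
  fixes B1 B2 :: "nat \<Rightarrow> nat \<Rightarrow> 'h bop"
  assumes B1: "\<And>i j. i < n \<Longrightarrow> j < n \<Longrightarrow> B1 i j = b1 i j *\<^sub>C 1 - g1 i j *\<^sub>C s - g2 i j *\<^sub>C d"
    and B2: "\<And>i j. i < n \<Longrightarrow> j < n \<Longrightarrow> B2 i j = b2 i j *\<^sub>C 1 - g1 i j *\<^sub>C s - g2 i j *\<^sub>C d"
    and D: "D > 0" and sg: "sg = 1 \<or> sg = -1"
    and lower1: "\<And>v. nrm2 n v \<le> D\<^sup>2 * nrm2 n (mv n B1 v)"
    and lower2: "\<And>v. nrm2 n v \<le> D\<^sup>2 * nrm2 n (mv n B2 v)"
    and acc1: "\<And>v. 0 \<le> sg * Im (\<Sum>i<n. cinner (mv n B1 v i) (v i))"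
    and acc2: "\<And>v. 0 \<le> (- sg) * Im (\<Sum>i<n. cinner (mv n B2 v i) (v i))"
    and R1: "is_minv n B1 R1" and R2: "is_minv n B2 R2"
  shows "Schwinger_Dyson_matrix (n + n) (tri n g1 (\<lambda>i j. 0) g1) (tri n R1 (mmul n R1 R2) R2)"
proof -
  have sg': "- sg = 1 \<or> - sg = -1" using sg by auto
  define y where "y k = 1 / (4 * D) * (1 / real (Suc k))" for k
  have y: "0 < y k" "y k \<le> 1 / (4 * D)" for k
    using D mult_left_mono[of "1 / real (Suc k)" 1 "1 / (4 * D)"] by (simp_all add: y_def)
  have ylim: "y \<longlonglongrightarrow> 0" unfolding y_def[abs_def]
    using tendsto_mult_left[OF LIMSEQ_Suc[OF lim_inverse_n'], of "1 / (4 * D)"] by simp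
  let ?S1 = "\<lambda>k. shifted B1 sg (y k)" and ?S2 = "\<lambda>k. shifted B2 (- sg) (y k)"
  obtain \<kappa>1 X1 where 1: "\<And>k. \<kappa>1 k \<noteq> 0" "\<And>k. is_minv n (?S1 k) (X1 k)"
    "\<And>k i j. i < n \<Longrightarrow> j < n \<Longrightarrow> summable (\<lambda>l. norm (mpow n (\<lambda>i j. mone i j - \<kappa>1 k *\<^sub>C ?S1 k i j) l i j))"
    "\<And>k v. nrm2 n (mv n (X1 k) v) \<le> (2 * D)\<^sup>2 * nrm2 n v"
    by (rule shifted_resolvents[OF D sg lower1 acc1, where y = y, OF y]) blast
  obtain \<kappa>2 X2 where 2: "\<And>k. \<kappa>2 k \<noteq> 0" "\<And>k. is_minv n (?S2 k) (X2 k)"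
    "\<And>k i j. i < n \<Longrightarrow> j < n \<Longrightarrow> summable (\<lambda>l. norm (mpow n (\<lambda>i j. mone i j - \<kappa>2 k *\<^sub>C ?S2 k i j) l i j))"
    "\<And>k v. nrm2 n (mv n (X2 k) v) \<le> (2 * D)\<^sup>2 * nrm2 n v"
    by (rule shifted_resolvents[OF D sg' lower2 acc2, where y = y, OF y]) blast
  have lim1: "(\<lambda>k. X1 k i j) \<longlonglongrightarrow> R1 i j" and lim2: "(\<lambda>k. X2 k i j) \<longlonglongrightarrow> R2 i j" if "i < n" "j < n" for i j
    by (rule resolvent_tendsto[OF D sg lower1 acc1 R1 1(2,4) y(1) ylim that],
        rule resolvent_tendsto[OF D sg' lower2 acc2 R2 2(2,4) y(1) ylim that])
  show ?thesis
  proof (rule Schwinger_Dyson_limit)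
    fix k
    define \<eta> where "\<eta> = \<i> * complex_of_real (sg * y k)"
    define c1 c2 where "c1 = (\<lambda>i j. mone i j - \<kappa>1 k *\<^sub>C ?S1 k i j)" and "c2 = (\<lambda>i j. mone i j - \<kappa>2 k *\<^sub>C ?S2 k i j)"
    define \<kappa> where "\<kappa> i = (if i < n then \<kappa>1 k else \<kappa>2 k)" for i
    let ?B = "tri n (?S1 k) (\<lambda>i j. - mone i j) (?S2 k)"
    show "Schwinger_Dyson_matrix (n + n) (tri n g1 (\<lambda>i j. 0) g1) (tri n (X1 k) (mmul n (X1 k) (X2 k)) (X2 k))"
    proof (rule Schwinger_Dyson_resolvent[OF _ _ _ is_minv_tri_mone[OF 1(2) 2(2)]])
      show "?B i j = tri n (\<lambda>i j. b1 i j + \<eta> * mone i j) (\<lambda>i j. - mone i j) (\<lambda>i j. b2 i j - \<eta> * mone i j) i j *\<^sub>C 1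
         - tri n g1 (\<lambda>i j. 0) g1 i j *\<^sub>C s - tri n g2 (\<lambda>i j. 0) g2 i j *\<^sub>C d"
        if "i < n + n" "j < n + n" for i j
        using that
        by (auto elim!: block_cases simp: shifted_def
            B1 B2 \<eta>_def mone_def scaleC_bop_simps)
      show "\<kappa> i \<noteq> 0" for i using 1(1) 2(1) by (simp add: \<kappa>_def)
      have c: "mone i j - \<kappa> i *\<^sub>C ?B i j = tri n c1 (\<lambda>i j. \<kappa>1 k *\<^sub>C mone i j) c2 i j"
        if "i < n + n" "j < n + n" for i j
        using that by (auto elim!: block_cases simp: \<kappa>_def c1_def c2_def scaleC_bop_simps mone_block)
      have "mpow (n + n) (\<lambda>i j. mone i j - \<kappa> i *\<^sub>C ?B i j) l i j = mpow (n + n) (tri n c1 (\<lambda>i j. \<kappa>1 k *\<^sub>C mone i j) c2) l i j"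
        if "i < n + n" "j < n + n" for i j l
        using that
      proof (induction l arbitrary: i)
        case (Suc l)
        then show ?case unfolding mpow.simps by (intro mmul_cong) (simp_all add: c)
      qed simp
      then have m: "mpow (n + n) (\<lambda>i j. mone i j - \<kappa> i *\<^sub>C ?B i j) l i j
        = tri n (mpow n c1 l) (corner n c1 (\<lambda>i j. \<kappa>1 k *\<^sub>C mone i j) c2 l) (mpow n c2 l) i j"
        if "i < n + n" "j < n + n" for i j l using that by (simp add: mpow_tri)
      show "summable (\<lambda>l. norm (mpow (n + n) (\<lambda>i j. mone i j - \<kappa> i *\<^sub>C ?B i j) l i j))"
        if "i < n + n" "j < n + n" for i j
        unfolding m[OF that] using that
        by (auto elim!: block_cases intro!: 1(3)[of _ _ k, folded c1_def] 2(3)[of _ _ k, folded c2_def] summable_corner)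
    qed
  next
    fix i j assume "i < n + n" "j < n + n"
    then show "(\<lambda>k. tri n (X1 k) (mmul n (X1 k) (X2 k)) (X2 k) i j) \<longlonglongrightarrow> tri n R1 (mmul n R1 R2) R2 i j"
      by (auto elim!: block_cases simp: mmul_def intro!: lim1 lim2 tendsto_intros)
  qed
qed

end

section \<open>The canonical linearization is bounded below\<close>

text \<open>The \<open>\<ell>\<^sup>1\<close> norm of tuples is convenient for substitution in triangular systems.\<close>

definition bounded_below :: "nat \<Rightarrow> (nat \<Rightarrow> nat \<Rightarrow> 'h::complex_hilbert_space bop) \<Rightarrow> bool" where
  "bounded_below k A \<longleftrightarrow> (\<exists>C\<ge>0. \<forall>v. (\<Sum>i<k. norm (v i)) \<le> C * (\<Sum>i<k. norm (mv k A v i)))"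

text \<open>Row \<open>k - 1 - j\<close> expresses \<open>v j\<close> by the components \<open>v l\<close> with \<open>l < j\<close>.\<close>

lemma bounded_below_antitriangular:
  fixes A :: "nat \<Rightarrow> nat \<Rightarrow> 'h::complex_hilbert_space bop"
  assumes diag: "\<And>i j. i < k \<Longrightarrow> j < k \<Longrightarrow> i + j = k - 1 \<Longrightarrow> A i j = - 1"
    and zero: "\<And>i j. i < k \<Longrightarrow> j < k \<Longrightarrow> k \<le> i + j \<Longrightarrow> A i j = 0"
  shows "bounded_below k A"
proof -
  define W where "W v = (\<Sum>i<k. norm (mv k A v i))" for v
  have "\<exists>C\<ge>0. \<forall>v. norm (v j) \<le> C * W v" if "j < k" for j
    using that
  proof (induction j rule: less_induct)
    case (less j)
    have "\<forall>l\<in>{..<j}. \<exists>C. 0 \<le> C \<and> (\<forall>v. norm (v l) \<le> C * W v)" using less by auto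
    from bchoice[OF this] obtain C where C: "\<And>l. l < j \<Longrightarrow> 0 \<le> C l" "\<And>l v. l < j \<Longrightarrow> norm (v l) \<le> C l * W v"
      by auto
    define i where "i = k - 1 - j"
    have i: "i < k" "i + j = k - 1" using less.prems by (auto simp: i_def)
    have "norm (v j) \<le> (1 + (\<Sum>l<j. norm (A i l) * C l)) * W v" for v
    proof -
      have "{..<k} = {..<j} \<union> {j} \<union> {j<..<k}" using less.prems by auto
      then have "mv k A v i = (\<Sum>l\<in>{..<j} \<union> {j} \<union> {j<..<k}. app (A i l) (v l))" by (simp add: mv_def)
      also have "\<dots> = (\<Sum>l<j. app (A i l) (v l)) + app (A i j) (v j) + (\<Sum>l\<in>{j<..<k}. app (A i l) (v l))"
        by (subst sum.union_disjoint; auto)+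
      also have "(\<Sum>l\<in>{j<..<k}. app (A i l) (v l)) = 0" using i by (intro sum.neutral) (auto simp: zero)
      also have "app (A i j) (v j) = - v j" using i less.prems by (simp add: diag)
      finally have "v j = (\<Sum>l<j. app (A i l) (v l)) - mv k A v i" by simp
      then have "norm (v j) \<le> norm (\<Sum>l<j. app (A i l) (v l)) + norm (mv k A v i)"
        by (metis norm_triangle_ineq4)
      also have "norm (\<Sum>l<j. app (A i l) (v l)) \<le> (\<Sum>l<j. norm (A i l) * (C l * W v))"
        by (intro sum_norm_le order_trans[OF norm_app] mult_left_mono C) auto
      also have "norm (mv k A v i) \<le> W v" unfolding W_def using i by (intro member_le_sum) auto
      finally show ?thesis by (simp add: algebra_simps sum_distrib_left)
    qed
    moreover have "0 \<le> 1 + (\<Sum>l<j. norm (A i l) * C l)"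
      by (intro add_nonneg_nonneg sum_nonneg mult_nonneg_nonneg) (auto simp: C)
    ultimately show ?case by blast
  qed
  then have "\<forall>j\<in>{..<k}. \<exists>C. 0 \<le> C \<and> (\<forall>v. norm (v j) \<le> C * W v)" by auto
  from bchoice[OF this] obtain C where C: "\<And>l. l < k \<Longrightarrow> 0 \<le> C l" "\<And>l v. l < k \<Longrightarrow> norm (v l) \<le> C l * W v"
    by auto
  have "(\<Sum>i<k. norm (v i)) \<le> (\<Sum>i<k. C i) * W v" for v
    unfolding sum_distrib_right by (intro sum_mono) (auto simp: C)
  moreover have "0 \<le> (\<Sum>i<k. C i)" by (intro sum_nonneg) (auto simp: C)
  ultimately show ?thesis unfolding bounded_below_def W_def by blast
qed

lemma bounded_below_diagonal:
  fixes A1 A2 :: "nat \<Rightarrow> nat \<Rightarrow> 'h::complex_hilbert_space bop"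
  assumes "bounded_below k1 A1" "bounded_below k2 A2"
    and "\<And>i j. i < k1 \<Longrightarrow> j < k1 \<Longrightarrow> A i j = A1 i j"
    and "\<And>i j. i < k2 \<Longrightarrow> j < k2 \<Longrightarrow> A (k1 + i) (k1 + j) = A2 i j"
    and "\<And>i j. i < k1 \<Longrightarrow> j < k2 \<Longrightarrow> A i (k1 + j) = 0"
    and "\<And>i j. i < k2 \<Longrightarrow> j < k1 \<Longrightarrow> A (k1 + i) j = 0"
  shows "bounded_below (k1 + k2) A"
proof -
  obtain C1 C2 where C: "0 \<le> C1" "0 \<le> C2"
    "\<And>v. (\<Sum>i<k1. norm (v i)) \<le> C1 * (\<Sum>i<k1. norm (mv k1 A1 v i))"
    "\<And>v. (\<Sum>i<k2. norm (v i)) \<le> C2 * (\<Sum>i<k2. norm (mv k2 A2 v i))"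
    using assms(1,2) unfolding bounded_below_def by metis
  have 1: "mv (k1 + k2) A v i = mv k1 A1 v i" if "i < k1" for v i
    using that by (simp add: mv_def sum_split_block assms)
  have 2: "mv (k1 + k2) A v (k1 + i) = mv k2 A2 (\<lambda>i. v (k1 + i)) i" if "i < k2" for v i
    using that by (simp add: mv_def sum_split_block assms)
  have "(\<Sum>i<k1 + k2. norm (v i)) \<le> (C1 + C2) * (\<Sum>i<k1 + k2. norm (mv (k1 + k2) A v i))" for v
  proof -
    have "(\<Sum>i<k1 + k2. norm (v i)) \<le> C1 * (\<Sum>i<k1. norm (mv k1 A1 v i)) + C2 * (\<Sum>i<k2. norm (mv k2 A2 (\<lambda>i. v (k1 + i)) i))"
      unfolding sum_split_block by (intro add_mono C)
    also have "\<dots> \<le> (C1 + C2) * ((\<Sum>i<k1. norm (mv k1 A1 v i)) + (\<Sum>i<k2. norm (mv k2 A2 (\<lambda>i. v (k1 + i)) i)))"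
      using C(1,2) by (simp add: algebra_simps add_increasing add_increasing2 sum_nonneg)
    also have "\<dots> = (C1 + C2) * (\<Sum>i<k1 + k2. norm (mv (k1 + k2) A v i))"
      unfolding sum_split_block by (simp add: 1 2)
    finally show ?thesis .
  qed
  then show ?thesis unfolding bounded_below_def using C(1,2) by (intro exI[of _ "C1 + C2"]) auto
qed

lemma bounded_below_antidiagonal:
  fixes A1 A2 :: "nat \<Rightarrow> nat \<Rightarrow> 'h::complex_hilbert_space bop"
  assumes "bounded_below k A1" "bounded_below k A2"
    and "\<And>i j. i < k \<Longrightarrow> j < k \<Longrightarrow> A i (k + j) = A1 i j"
    and "\<And>i j. i < k \<Longrightarrow> j < k \<Longrightarrow> A (k + i) j = A2 i j"
    and "\<And>i j. i < k \<Longrightarrow> j < k \<Longrightarrow> A i j = 0"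
    and "\<And>i j. i < k \<Longrightarrow> j < k \<Longrightarrow> A (k + i) (k + j) = 0"
  shows "bounded_below (k + k) A"
proof -
  obtain C1 C2 where C: "0 \<le> C1" "0 \<le> C2"
    "\<And>v. (\<Sum>i<k. norm (v i)) \<le> C1 * (\<Sum>i<k. norm (mv k A1 v i))"
    "\<And>v. (\<Sum>i<k. norm (v i)) \<le> C2 * (\<Sum>i<k. norm (mv k A2 v i))"
    using assms(1,2) unfolding bounded_below_def by metis
  have 1: "mv (k + k) A v i = mv k A1 (\<lambda>i. v (k + i)) i" if "i < k" for v i
    using that by (simp add: mv_def sum_split_block assms)
  have 2: "mv (k + k) A v (k + i) = mv k A2 v i" if "i < k" for v i
    using that by (simp add: mv_def sum_split_block assms)
  have "(\<Sum>i<k + k. norm (v i)) \<le> (C1 + C2) * (\<Sum>i<k + k. norm (mv (k + k) A v i))" for v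
  proof -
    have "(\<Sum>i<k + k. norm (v i)) \<le> C2 * (\<Sum>i<k. norm (mv k A2 v i)) + C1 * (\<Sum>i<k. norm (mv k A1 (\<lambda>i. v (k + i)) i))"
      unfolding sum_split_block by (intro add_mono C)
    also have "\<dots> \<le> (C1 + C2) * ((\<Sum>i<k. norm (mv k A1 (\<lambda>i. v (k + i)) i)) + (\<Sum>i<k. norm (mv k A2 v i)))"
      using C(1,2) by (simp add: algebra_simps add_increasing add_increasing2 sum_nonneg)
    also have "\<dots> = (C1 + C2) * (\<Sum>i<k + k. norm (mv (k + k) A v i))"
      unfolding sum_split_block by (simp add: 1 2)
    finally show ?thesis .
  qed
  then show ?thesis unfolding bounded_below_def using C(1,2) by (intro exI[of _ "C1 + C2"]) auto
qed

text \<open>Evaluation of the part of degree at most one, which is how the coefficient matrices of a linearization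
  enter the pencil.\<close>

definition affine_eval :: "'h::complex_hilbert_space bop \<Rightarrow> 'h bop \<Rightarrow> ncpoly \<Rightarrow> 'h bop" where
  "affine_eval s d p = Poly_Mapping.lookup p [] *\<^sub>C 1 + Poly_Mapping.lookup p [T1] *\<^sub>C s
     + Poly_Mapping.lookup p [T2] *\<^sub>C d"

lemma nc_adjoint_zero [simp]: "nc_adjoint 0 = 0"
  by (rule poly_mapping_eqI) (simp add: nc_adjoint.rep_eq)

lemma nc_adjoint_involution [simp]: "nc_adjoint (nc_adjoint p) = p"
  by (rule poly_mapping_eqI) (simp add: nc_adjoint.rep_eq)

lemma affine_eval_zero [simp]: "affine_eval s d 0 = 0"
  by (simp add: affine_eval_def scaleC_bop_simps)

lemma affine_eval_const:
  "affine_eval s d (Poly_Mapping.single [] c) = c *\<^sub>C 1"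
  "affine_eval s d (nc_adjoint (Poly_Mapping.single [] c)) = cnj c *\<^sub>C 1"
  by (simp_all add: affine_eval_def nc_adjoint.rep_eq lookup_single scaleC_bop_simps)

lemma affine_eval_adjoint:
  assumes "selfadjoint s" "selfadjoint d"
  shows "is_adjoint (affine_eval s d p) (affine_eval s d (nc_adjoint p))"
  using assms unfolding affine_eval_def nc_adjoint.rep_eq selfadjoint_def
  by (auto intro!: is_adjoint_add is_adjoint_scaleC is_adjoint_one)

context
  fixes s d :: "'h::complex_hilbert_space bop"
begin

text \<open>The block \<open>Q\<close> of a linearization. Its adjoint is included since both \<open>Q\<^sub>0\<close> and \<open>Q\<^sub>0\<^sup>*\<close> occur in the
  selfadjoint linearization.\<close>

definition invertible_corner :: "ncpoly mat \<Rightarrow> bool" where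
  "invertible_corner L \<longleftrightarrow> (\<exists>k. L \<in> carrier_mat (Suc k) (Suc k) \<and>
    bounded_below k (\<lambda>i j. affine_eval s d (L $$ (Suc i, Suc j))) \<and>
    bounded_below k (\<lambda>i j. affine_eval s d (nc_adjoint (L $$ (Suc j, Suc i)))))"

lemma invertible_corner_zero: "invertible_corner (0\<^sub>m 1 1)"
  unfolding invertible_corner_def bounded_below_def by (rule exI[of _ 0]) auto

lemma invertible_corner_monomial: "invertible_corner (lin_monomial c w)"
proof (cases "length w \<le> 1")
  case True
  then have L: "lin_monomial c w = mat_of_rows_list 2
         [[0, Poly_Mapping.single w c], [Poly_Mapping.single [] 1, Poly_Mapping.single [] (- 1)]]"
    by (simp add: lin_monomial_def)
  have "lin_monomial c w \<in> carrier_mat 2 2" "lin_monomial c w $$ (1, 1) = Poly_Mapping.single [] (- 1)"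
    unfolding L by (auto simp: mat_of_rows_list_def)
  then show ?thesis unfolding invertible_corner_def
    by (intro exI[of _ 1] conjI bounded_below_antitriangular)
      (auto simp: affine_eval_const scaleC_bop_simps numeral_2_eq_2)
next
  case False
  define k where "k = length w - 1"
  have k: "length w = Suc k" using False by (simp add: k_def)
  have L: "lin_monomial c w = Matrix.mat (Suc k) (Suc k) (\<lambda>(i, j).
         if i + j = k then Poly_Mapping.single [w ! i] (if i = 0 then c else 1)
         else if i + j = Suc k then Poly_Mapping.single [] (- 1) else 0)"
    using False unfolding lin_monomial_def Let_def k by simp
  show ?thesis unfolding invertible_corner_def
    by (intro exI[of _ k] conjI bounded_below_antitriangular)
      (auto simp: L affine_eval_const scaleC_bop_simps)
qed

lemma lin_add_corner:
  assumes "L1 \<in> carrier_mat (Suc k1) (Suc k1)" "L2 \<in> carrier_mat (Suc k2) (Suc k2)"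
  shows "lin_add L1 L2 \<in> carrier_mat (Suc (k1 + k2)) (Suc (k1 + k2))"
    "i < k1 \<Longrightarrow> j < k1 \<Longrightarrow> lin_add L1 L2 $$ (Suc i, Suc j) = L1 $$ (Suc i, Suc j)"
    "i < k2 \<Longrightarrow> j < k2 \<Longrightarrow> lin_add L1 L2 $$ (Suc (k1 + i), Suc (k1 + j)) = L2 $$ (Suc i, Suc j)"
    "i < k1 \<Longrightarrow> j < k2 \<Longrightarrow> lin_add L1 L2 $$ (Suc i, Suc (k1 + j)) = 0"
    "i < k2 \<Longrightarrow> j < k1 \<Longrightarrow> lin_add L1 L2 $$ (Suc (k1 + i), Suc j) = 0"
  using assms
  by (auto simp: lin_add_def split_block_def append_cols_def append_rows_def Let_def)

lemma invertible_corner_add: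
  assumes "invertible_corner L1" "invertible_corner L2" shows "invertible_corner (lin_add L1 L2)"
proof -
  obtain k1 k2 where L: "L1 \<in> carrier_mat (Suc k1) (Suc k1)" "L2 \<in> carrier_mat (Suc k2) (Suc k2)" and
    b: "bounded_below k1 (\<lambda>i j. affine_eval s d (L1 $$ (Suc i, Suc j)))"
    "bounded_below k1 (\<lambda>i j. affine_eval s d (nc_adjoint (L1 $$ (Suc j, Suc i))))"
    "bounded_below k2 (\<lambda>i j. affine_eval s d (L2 $$ (Suc i, Suc j)))"
    "bounded_below k2 (\<lambda>i j. affine_eval s d (nc_adjoint (L2 $$ (Suc j, Suc i))))"
    using assms unfolding invertible_corner_def by blast
  note e = lin_add_corner[OF L]
  show ?thesis unfolding invertible_corner_def
  proof (intro exI[of _ "k1 + k2"] conjI)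
    show "bounded_below (k1 + k2) (\<lambda>i j. affine_eval s d (lin_add L1 L2 $$ (Suc i, Suc j)))"
      by (rule bounded_below_diagonal[OF b(1,3)]) (simp_all add: e)
    show "bounded_below (k1 + k2) (\<lambda>i j. affine_eval s d (nc_adjoint (lin_add L1 L2 $$ (Suc j, Suc i))))"
      by (rule bounded_below_diagonal[OF b(2,4)]) (simp_all add: e)
  qed (rule e)
qed

lemma invertible_corner_sum: "invertible_corner (lin_sum ms)"
  unfolding lin_sum_def
  by (induction ms)
    (auto simp del: One_nat_def intro: invertible_corner_zero invertible_corner_add invertible_corner_monomial)

end

lemma lin_symmetrize_entries:
  assumes L: "L \<in> carrier_mat (Suc k) (Suc k)"
  shows "lin_symmetrize L \<in> carrier_mat (Suc (k + k)) (Suc (k + k))"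
    "lin_symmetrize L $$ (0, 0) = 0"
    "j < k \<Longrightarrow> lin_symmetrize L $$ (0, Suc j) = L $$ (0, Suc j)"
    "j < k \<Longrightarrow> lin_symmetrize L $$ (0, Suc (k + j)) = nc_adjoint (L $$ (Suc j, 0))"
    "i < k \<Longrightarrow> lin_symmetrize L $$ (Suc i, 0) = nc_adjoint (L $$ (0, Suc i))"
    "i < k \<Longrightarrow> lin_symmetrize L $$ (Suc (k + i), 0) = L $$ (Suc i, 0)"
    "i < k \<Longrightarrow> j < k \<Longrightarrow> lin_symmetrize L $$ (Suc i, Suc j) = 0"
    "i < k \<Longrightarrow> j < k \<Longrightarrow> lin_symmetrize L $$ (Suc (k + i), Suc (k + j)) = 0"
    "i < k \<Longrightarrow> j < k \<Longrightarrow> lin_symmetrize L $$ (Suc i, Suc (k + j)) = nc_adjoint (L $$ (Suc j, Suc i))"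
    "i < k \<Longrightarrow> j < k \<Longrightarrow> lin_symmetrize L $$ (Suc (k + i), Suc j) = L $$ (Suc i, Suc j)"
  using L
  by (auto simp: lin_symmetrize_def split_block_def append_cols_def append_rows_def Let_def mat_nc_adjoint_def)

text \<open>These are the properties of the linearization from which the spectrum of \<open>T\<close> is bounded: it is
  selfadjoint, its first diagonal entry vanishes, and the complementary block is bounded below because it is antidiagonal with blocks
  \<open>Q\<^sub>0\<^sup>*\<close> and \<open>Q\<^sub>0\<close>.\<close>

theorem canonical_sa_linearization_structure:
  fixes s d :: "'h::complex_hilbert_space bop"
  assumes "canonical_sa_linearization P L"
  obtains K where "L \<in> carrier_mat (Suc K) (Suc K)" "L $$ (0, 0) = 0"
    "\<And>i j. i < Suc K \<Longrightarrow> j < Suc K \<Longrightarrow> L $$ (j, i) = nc_adjoint (L $$ (i, j))"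
    "bounded_below K (\<lambda>i j. affine_eval s d (L $$ (Suc i, Suc j)))"
proof -
  obtain ms where L: "L = lin_symmetrize (lin_sum ms)"
    using assms unfolding canonical_sa_linearization_def by blast
  obtain k where k: "lin_sum ms \<in> carrier_mat (Suc k) (Suc k)" and
    b: "bounded_below k (\<lambda>i j. affine_eval s d (lin_sum ms $$ (Suc i, Suc j)))"
    "bounded_below k (\<lambda>i j. affine_eval s d (nc_adjoint (lin_sum ms $$ (Suc j, Suc i))))"
    using invertible_corner_sum[of s d ms] unfolding invertible_corner_def by blast
  note e = lin_symmetrize_entries[OF k, folded L]
  show ?thesis
  proof (rule that[of "k + k"])
    have idx: "i = 0 \<or> (\<exists>a<k. i = Suc a) \<or> (\<exists>a<k. i = Suc (k + a))" if "i < Suc (k + k)" for i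
      using that by presburger
    show "L $$ (j, i) = nc_adjoint (L $$ (i, j))" if "i < Suc (k + k)" "j < Suc (k + k)" for i j
      using idx[OF that(1)] idx[OF that(2)] by (elim disjE exE conjE) (simp_all add: e)
    show "bounded_below (k + k) (\<lambda>i j. affine_eval s d (L $$ (Suc i, Suc j)))"
      by (rule bounded_below_antidiagonal[OF b(2,1)]) (simp_all add: e)
  qed (rule e)+
qed

section \<open>The resolvent of a linearization\<close>

lemma Im_hermitian_form:
  assumes herm: "\<And>i j. i < n \<Longrightarrow> j < n \<Longrightarrow> is_adjoint (X i j) (X j i)"
  shows "Im (\<Sum>i<n. cinner (mv n X v i) (v i)) = 0"
proof -
  let ?S = "\<Sum>i<n. \<Sum>j<n. cinner (app (X i j) (v j)) (v i)"
  have "cnj ?S = (\<Sum>i<n. \<Sum>j<n. cinner (app (X j i) (v i)) (v j))"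
    unfolding cnj_sum
  proof (intro sum.cong refl)
    fix i j assume "i \<in> {..<n}" "j \<in> {..<n}"
    then have "cinner (app (X j i) (v i)) (v j) = cinner (v i) (app (X i j) (v j))"
      using herm[of j i] by (simp add: is_adjoint_def)
    then show "cnj (cinner (app (X i j) (v j)) (v i)) = cinner (app (X j i) (v i)) (v j)"
      by (simp add: cinner_commute[of "v i"])
  qed
  also have "\<dots> = ?S" by (rule sum.swap)
  finally have "Im (cnj ?S) = Im ?S" by (rule arg_cong)
  then have "Im ?S = 0" by (simp only: cnj.simps)
  then show ?thesis by (simp add: mv_def cinner_sum_left)
qed

text \<open>The matrix \<open>z e\<^sub>1\<^sub>1 - X\<close> for a linearization evaluated to \<open>X\<close>.\<close>

definition pencil ::
    "(nat \<Rightarrow> nat \<Rightarrow> 'h::complex_hilbert_space bop) \<Rightarrow> complex \<Rightarrow> nat \<Rightarrow> nat \<Rightarrow> 'h bop" where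
  "pencil X z i j = (if i = 0 \<and> j = 0 then z else 0) *\<^sub>C 1 - X i j"

context
  fixes K :: nat and X :: "nat \<Rightarrow> nat \<Rightarrow> 'h::complex_hilbert_space bop" and z :: complex
  assumes herm: "\<And>i j. i < Suc K \<Longrightarrow> j < Suc K \<Longrightarrow> is_adjoint (X i j) (X j i)"
    and X00: "X 0 0 = 0"
    and corner: "bounded_below K (\<lambda>i j. X (Suc i) (Suc j))"
begin

lemma mv_pencil: "mv (Suc K) (pencil X z) v i = (if i = 0 then z *\<^sub>C v 0 else 0) - mv (Suc K) X v i"
proof -
  have "(\<Sum>j<Suc K. app ((if i = 0 \<and> j = 0 then z else 0) *\<^sub>C 1) (v j)) = (\<Sum>j<Suc K. if j = 0 then (if i = 0 then z *\<^sub>C v 0 else 0) else 0)"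
    by (intro sum.cong) auto
  then show ?thesis unfolding pencil_def[abs_def] mv_diff by (simp add: mv_def)
qed

lemma Im_pencil_form: "Im (\<Sum>i<Suc K. cinner (mv (Suc K) (pencil X z) v i) (v i)) = Im z * (norm (v 0))\<^sup>2"
proof -
  have "(\<Sum>i<Suc K. cinner (mv (Suc K) (pencil X z) v i) (v i))
    = (\<Sum>i<Suc K. if i = 0 then z * complex_of_real ((norm (v 0))\<^sup>2) else 0) - (\<Sum>i<Suc K. cinner (mv (Suc K) X v i) (v i))"
    unfolding sum_subtractf[symmetric]
    by (intro sum.cong refl) (simp add: mv_pencil cinner_diff_left cinner_scaleC_left cinner_self cinner_minus_left)
  then show ?thesis using Im_hermitian_form[of "Suc K" X v, OF herm] by simp
qed

text \<open>The imaginary part of the quadratic form controls the first component, and then the block \<open>Q\<close> controls the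
  others: with \<open>V\<close> and \<open>W\<close> the \<open>\<ell>\<^sup>1\<close> norms of a tuple and of its image,
  \<open>norm (v 0)\<^sup>2 \<le> V W / \<bar>Im z\<bar>\<close> and \<open>V \<le> C W + E norm (v 0)\<close>. The mixed term \<open>V W\<close> is absorbed into \<open>V\<^sup>2\<close>.\<close>

lemma pencil_lower_bound:
  assumes z: "Im z \<noteq> 0"
  shows "\<exists>D>0. \<forall>v. nrm2 (Suc K) v \<le> D\<^sup>2 * nrm2 (Suc K) (mv (Suc K) (pencil X z) v)"
proof -
  define a where "a = \<bar>Im z\<bar>"
  have a: "a > 0" using z by (simp add: a_def)
  obtain C where C: "0 \<le> C" "\<And>v. (\<Sum>i<K. norm (v i)) \<le> C * (\<Sum>i<K. norm (mv K (\<lambda>i j. X (Suc i) (Suc j)) v i))"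
    using corner unfolding bounded_below_def by blast
  define \<xi> where "\<xi> = (\<Sum>i<K. norm (X (Suc i) 0))"
  have \<xi>: "0 \<le> \<xi>" unfolding \<xi>_def by (intro sum_nonneg) simp
  define E where "E = 1 + C * \<xi>"
  define F where "F = 4 * C\<^sup>2 + 4 * (E\<^sup>2 / a)\<^sup>2"
  have F: "0 \<le> F" by (simp add: F_def)
  \<comment> \<open>the square root compares the two norms of tuples; the summand makes the constant positive\<close>
  define D where "D = sqrt (F * real (Suc K)) + 1"
  have D: "D > 0" using F by (simp add: D_def add_nonneg_pos)
  have "nrm2 (Suc K) v \<le> D\<^sup>2 * nrm2 (Suc K) (mv (Suc K) (pencil X z) v)" for v
  proof -
    define w where "w = mv (Suc K) (pencil X z) v"
    define V W where "V = (\<Sum>i<Suc K. norm (v i))" and "W = (\<Sum>i<Suc K. norm (w i))"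
    have VW: "0 \<le> V" "0 \<le> W" unfolding V_def W_def by (intro sum_nonneg; simp)+
    have "a * (norm (v 0))\<^sup>2 = \<bar>Im (\<Sum>i<Suc K. cinner (w i) (v i))\<bar>"
      unfolding w_def Im_pencil_form by (simp add: a_def abs_mult)
    also have "\<dots> \<le> cmod (\<Sum>i<Suc K. cinner (w i) (v i))" by (rule abs_Im_le_cmod)
    also have "\<dots> \<le> (\<Sum>i<Suc K. norm (w i) * V)"
    proof (intro sum_norm_le order_trans[OF cmod_cinner_le] mult_left_mono)
      show "norm (v i) \<le> V" if "i \<in> {..<Suc K}" for i
        unfolding V_def using that by (intro member_le_sum) auto
    qed auto
    also have "\<dots> = W * V" by (simp only: W_def sum_distrib_right)
    finally have v0: "(norm (v 0))\<^sup>2 \<le> W * V / a" using a by (simp add: field_simps)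
    have "norm (mv K (\<lambda>i j. X (Suc i) (Suc j)) (\<lambda>i. v (Suc i)) i) \<le> norm (w (Suc i)) + norm (X (Suc i) 0) * norm (v 0)" if "i < K" for i
    proof -
      have "mv K (\<lambda>i j. X (Suc i) (Suc j)) (\<lambda>i. v (Suc i)) i = - w (Suc i) - app (X (Suc i) 0) (v 0)"
        unfolding w_def mv_pencil by (simp add: mv_def sum.lessThan_Suc_shift del: sum.lessThan_Suc)
      then have "norm (mv K (\<lambda>i j. X (Suc i) (Suc j)) (\<lambda>i. v (Suc i)) i) \<le> norm (w (Suc i)) + norm (app (X (Suc i) 0) (v 0))"
        by (metis norm_minus_cancel norm_triangle_ineq4)
      then show ?thesis using norm_app[of "X (Suc i) 0" "v 0"] by simp
    qed
    then have "(\<Sum>i<K. norm (mv K (\<lambda>i j. X (Suc i) (Suc j)) (\<lambda>i. v (Suc i)) i))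
      \<le> (\<Sum>i<K. norm (w (Suc i)) + norm (X (Suc i) 0) * norm (v 0))"
      by (intro sum_mono) auto
    also have "\<dots> \<le> W + \<xi> * norm (v 0)"
      by (simp add: W_def \<xi>_def sum.distrib sum_distrib_right sum.lessThan_Suc_shift del: sum.lessThan_Suc)
    finally have "(\<Sum>i<K. norm (v (Suc i))) \<le> C * (W + \<xi> * norm (v 0))"
      using order_trans[OF C(2)[of "\<lambda>i. v (Suc i)"] mult_left_mono[OF _ C(1)]] by simp
    then have "V \<le> C * W + E * norm (v 0)"
      by (simp add: V_def E_def sum.lessThan_Suc_shift algebra_simps del: sum.lessThan_Suc)
    then have "V\<^sup>2 \<le> (C * W + E * norm (v 0))\<^sup>2" using VW by (intro power_mono) auto
    also have "\<dots> \<le> 2 * (C * W)\<^sup>2 + 2 * (E * norm (v 0))\<^sup>2"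
      using sum_squares_bound[of "C * W" "E * norm (v 0)"] by (simp add: power2_sum)
    also have "\<dots> \<le> 2 * (C * W)\<^sup>2 + 2 * (E\<^sup>2 * (W * V / a))"
      using mult_left_mono[OF v0, of "E\<^sup>2"] by (simp add: power_mult_distrib)
    also have "2 * (E\<^sup>2 * (W * V / a)) = 2 * (2 * (E\<^sup>2 / a) * W) * V / 2" by simp
    also have "\<dots> \<le> ((2 * (E\<^sup>2 / a) * W)\<^sup>2 + V\<^sup>2) / 2"
      by (rule divide_right_mono[OF sum_squares_bound]) simp
    finally have q: "V\<^sup>2 \<le> 2 * (C * W)\<^sup>2 + ((2 * (E\<^sup>2 / a) * W)\<^sup>2 + V\<^sup>2) / 2" by simp
    have "x \<le> 4 * c + y" if "x \<le> 2 * c + (y + x) / 2" for x c y :: real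
      using that by (simp add: field_simps)
    from this[OF q] have "V\<^sup>2 \<le> F * W\<^sup>2" by (simp add: F_def power_mult_distrib power_divide distrib_right mult.assoc)
    moreover have "nrm2 (Suc K) v \<le> V\<^sup>2"
    proof -
      have "nrm2 (Suc K) v \<le> (\<Sum>i<Suc K. norm (v i) * V)" unfolding nrm2_def power2_eq_square
      proof (intro sum_mono mult_left_mono)
        show "norm (v i) \<le> V" if "i \<in> {..<Suc K}" for i
          unfolding V_def using that by (intro member_le_sum) auto
      qed auto
      then show ?thesis by (simp only: sum_distrib_right[symmetric] V_def[symmetric] power2_eq_square)
    qed
    moreover have "W\<^sup>2 \<le> real (Suc K) * nrm2 (Suc K) w"
      using sum_squared_le_sum_of_squares[of "\<lambda>i. norm (w i)" "{..<Suc K}"] by (simp add: W_def nrm2_def mult.commute)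
    then have "F * W\<^sup>2 \<le> F * (real (Suc K) * nrm2 (Suc K) w)" using F by (rule mult_left_mono)
    moreover have "F * real (Suc K) \<le> D\<^sup>2" using F by (simp add: D_def power2_sum)
    then have "F * real (Suc K) * nrm2 (Suc K) w \<le> D\<^sup>2 * nrm2 (Suc K) w" by (rule mult_right_mono) simp
    ultimately show ?thesis unfolding w_def[symmetric] by (simp add: mult.assoc)
  qed
  then show ?thesis using D by blast
qed

end

section \<open>Polynomial approximation on compact sets of reals\<close>

lemma real_continuous_poly_approx:
  fixes f :: "real \<Rightarrow> real"
  assumes "compact S" "continuous_on S f" "e > 0"
  obtains p :: "complex poly" and g where "\<And>t. poly p (of_real t) = of_real (g t)" "\<And>t. t \<in> S \<Longrightarrow> \<bar>f t - g t\<bar> < e"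
proof -
  obtain g where g: "real_polynomial_function g" "\<And>t. t \<in> S \<Longrightarrow> \<bar>f t - g t\<bar> < e"
    using Stone_Weierstrass_real_polynomial_function[OF assms] by blast
  then obtain a n where a: "g = (\<lambda>x. \<Sum>i\<le>n. a i * x ^ i)" using real_polynomial_function_iff_sum by blast
  have "poly (\<Sum>i\<le>n. Polynomial.monom (complex_of_real (a i)) i) (of_real t) = of_real (g t)" for t
    by (simp add: a poly_sum poly_monom)
  then show ?thesis using that g(2) by blast
qed

lemma complex_continuous_poly_approx:
  fixes f :: "real \<Rightarrow> complex"
  assumes S: "compact S" "continuous_on S f" and e: "e > 0"
  obtains p :: "complex poly" where "\<And>t. t \<in> S \<Longrightarrow> cmod (f t - poly p (of_real t)) \<le> e"
proof -
  obtain p1 g1 where 1: "\<And>t. poly p1 (complex_of_real t) = of_real (g1 t)" "\<And>t. t \<in> S \<Longrightarrow> \<bar>Re (f t) - g1 t\<bar> < e / 2"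
    using real_continuous_poly_approx[OF S(1) continuous_on_Re[OF S(2)], of "e / 2"] e by auto
  obtain p2 g2 where 2: "\<And>t. poly p2 (complex_of_real t) = of_real (g2 t)" "\<And>t. t \<in> S \<Longrightarrow> \<bar>Im (f t) - g2 t\<bar> < e / 2"
    using real_continuous_poly_approx[OF S(1) continuous_on_Im[OF S(2)], of "e / 2"] e by auto
  show ?thesis
  proof (rule that[of "p1 + Polynomial.smult \<i> p2"])
    fix t assume t: "t \<in> S"
    have "cmod (f t - poly (p1 + Polynomial.smult \<i> p2) (of_real t)) \<le> \<bar>Re (f t) - g1 t\<bar> + \<bar>Im (f t) - g2 t\<bar>"
      using cmod_le[of "f t - poly (p1 + Polynomial.smult \<i> p2) (of_real t)"] by (simp add: 1(1) 2(1))
    then show "cmod (f t - poly (p1 + Polynomial.smult \<i> p2) (of_real t)) \<le> e" using 1(2)[OF t] 2(2)[OF t] by simp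
  qed
qed

section \<open>Inverses of complex matrices\<close>

lemma mat_times_mmul:
  fixes A B :: "nat \<Rightarrow> nat \<Rightarrow> 'a::semiring_0"
  shows "fmat n A * fmat n B = fmat n (mmul n A B)"
  by (rule eq_matI) (auto simp: scalar_prod_def mmul_def atLeast0LessThan)

lemma mat_eq_one_iff:
  "fmat n A = 1\<^sub>m n \<longleftrightarrow> (\<forall>i<n. \<forall>j<n. A i j = mone i j)"
  by (auto simp: mat_eq_iff mone_def)

lemma left_inverse_imp_minv:
  fixes W F :: "nat \<Rightarrow> nat \<Rightarrow> complex"
  assumes "\<And>i j. i < n \<Longrightarrow> j < n \<Longrightarrow> mmul n F W i j = mone i j"
  shows "is_minv n W F"
proof -
  let ?F = "fmat n F" and ?W = "fmat n W"
  have "?F * ?W = 1\<^sub>m n" unfolding mat_times_mmul mat_eq_one_iff using assms by simp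
  then have "?W * ?F = 1\<^sub>m n" by (rule mat_mult_left_right_inverse[rotated 2]) auto
  then show ?thesis using assms unfolding mat_times_mmul mat_eq_one_iff is_minv_def by simp
qed

lemma inverse_by_adj_mat:
  fixes A :: "complex mat"
  assumes A: "A \<in> carrier_mat n n" and det: "det A \<noteq> 0"
  defines "C \<equiv> inverse (det A) \<cdot>\<^sub>m adj_mat A"
  shows "C \<in> carrier_mat n n" "A * C = 1\<^sub>m n" "C * A = 1\<^sub>m n"
  using adj_mat[OF A] A det
  by (auto simp: C_def mult_smult_distrib[of A n n] mult_smult_assoc_mat[of _ n n] intro!: eq_matI)

lemma trivial_left_kernel_imp_minv:
  fixes W :: "nat \<Rightarrow> nat \<Rightarrow> complex"
  assumes "\<And>\<xi> i. (\<And>k. k < n \<Longrightarrow> (\<Sum>i<n. \<xi> i * W i k) = 0) \<Longrightarrow> i < n \<Longrightarrow> \<xi> i = 0"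
  shows "\<exists>F. is_minv n W F"
proof -
  define A where "A = Matrix.mat n n (\<lambda>(i, j). W j i)"
  have A: "A \<in> carrier_mat n n" by (simp add: A_def)
  have "det A \<noteq> 0"
  proof
    assume "det A = 0"
    then obtain v where v: "v \<in> carrier_vec n" "v \<noteq> 0\<^sub>v n" "A *\<^sub>v v = 0\<^sub>v n"
      using det_0_iff_vec_prod_zero_field[OF A] by blast
    have "(\<Sum>i<n. v $ i * W i k) = 0" if "k < n" for k
    proof -
      have "(A *\<^sub>v v) $ k = (\<Sum>i<n. W i k * v $ i)"
        using that v(1) by (auto simp: A_def scalar_prod_def atLeast0LessThan)
      then show ?thesis using v(3) that by (simp add: mult.commute)
    qed
    then have "v $ i = 0" if "i < n" for i using assms[of "\<lambda>i. v $ i"] that by blast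
    then show False using v by (auto simp: vec_eq_iff)
  qed
  define C where "C = inverse (det A) \<cdot>\<^sub>m adj_mat A"
  note C = inverse_by_adj_mat(1,2)[OF A \<open>det A \<noteq> 0\<close>, folded C_def]
  have "mmul n (\<lambda>i j. C $$ (j, i)) W i j = mone i j" if "i < n" "j < n" for i j
  proof -
    have "mmul n (\<lambda>i j. C $$ (j, i)) W i j = (A * C) $$ (j, i)"
      using that A C(1) by (simp add: mmul_def scalar_prod_def A_def atLeast0LessThan mult.commute)
    then show ?thesis using that by (simp add: C(2) mone_def)
  qed
  then show ?thesis using left_inverse_imp_minv by blast
qed

section \<open>Subordination\<close>

locale free_semicircular_perturbation = free_semicircular M \<phi> s d \<sigma>
  for M :: "'h::complex_hilbert_space bop set" and \<phi> s d \<sigma> +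
  fixes \<nu> :: "real measure"
  assumes prob: "prob_space \<nu>" and sets_nu [measurable_cong, simp]: "sets \<nu> = sets borel"
    and compact_support: "\<exists>K. compact K \<and> (AE t in \<nu>. t \<in> K)"
    and d_moments: "\<phi> (d ^ k) = complex_of_real (\<integral>t. t ^ k \<partial>\<nu>)"
begin

sublocale prob_space \<nu> by (rule prob)

definition supp :: "real set" where
  "supp = {t. \<forall>e>0. measure \<nu> (ball t e) > 0}"

text \<open>The complement of the support is covered by the null intervals with rational end points.\<close>

lemma AE_supp: "AE t in \<nu>. t \<in> supp"
proof -
  define N where "N = {(a, b). a \<in> \<rat> \<and> b \<in> \<rat> \<and> emeasure \<nu> {a<..<b::real} = 0}"
  have "countable N" by (rule countable_subset[of _ "\<rat> \<times> \<rat>"]) (auto simp: N_def countable_rat)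
  then have "(\<Union>(a, b)\<in>N. {a<..<b}) \<in> null_sets \<nu>"
    by (intro null_sets_UN') (auto simp: N_def null_sets_def)
  moreover have "- supp \<subseteq> (\<Union>(a, b)\<in>N. {a<..<b})"
  proof
    fix t assume "t \<in> - supp"
    then obtain e where e: "e > 0" "measure \<nu> (ball t e) = 0"
      by (auto simp: supp_def) (metis less_le measure_nonneg not_le)
    obtain a b where ab: "a \<in> \<rat>" "t - e < a" "a < t" "b \<in> \<rat>" "t < b" "b < t + e"
      using Rats_dense_in_real[of "t - e" t] Rats_dense_in_real[of t "t + e"] e by auto
    have "emeasure \<nu> {a<..<b} \<le> emeasure \<nu> (ball t e)"
      using ab by (intro emeasure_mono) (auto simp: dist_real_def)
    then have "(a, b) \<in> N" using ab e by (auto simp: N_def emeasure_eq_measure)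
    then show "t \<in> (\<Union>(a, b)\<in>N. {a<..<b})" using ab by (intro UN_I[of "(a, b)"]) auto
  qed
  ultimately show ?thesis by (intro AE_I'[of "\<Union>(a, b)\<in>N. {a<..<b}"]) auto
qed

lemma compact_supp: "compact supp"
proof -
  obtain K where K: "compact K" "AE t in \<nu>. t \<in> K" using compact_support by blast
  have "supp \<subseteq> K"
  proof (rule ccontr)
    assume "\<not> supp \<subseteq> K"
    then obtain t where t: "t \<in> supp" "t \<notin> K" by blast
    then obtain e where e: "e > 0" "ball t e \<subseteq> - K"
      using open_Compl[OF compact_imp_closed[OF K(1)]] unfolding open_contains_ball by blast
    have "AE x in \<nu>. x \<notin> ball t e" using K(2) by eventually_elim (use e in auto)
    then have "measure \<nu> (ball t e) = 0" by (subst prob_eq_0) simp_all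
    then show False using t(1) e(1) by (auto simp: supp_def)
  qed
  moreover have "closed supp" unfolding closed_def open_contains_ball
  proof
    fix t assume "t \<in> - supp"
    then obtain e where e: "e > 0" "measure \<nu> (ball t e) = 0"
      by (auto simp: supp_def) (metis less_le measure_nonneg not_le)
    have "ball t e \<subseteq> - supp"
    proof
      fix u assume u: "u \<in> ball t e"
      have "ball u (e - dist t u) \<subseteq> ball t e"
        by (auto simp: dist_real_def)
      then have "measure \<nu> (ball u (e - dist t u)) \<le> measure \<nu> (ball t e)"
        by (intro finite_measure_mono) auto
      then show "u \<in> - supp" using e u by (auto simp: supp_def not_less intro!: exI[of _ "e - dist t u"])
    qed
    then show "\<exists>e>0. ball t e \<subseteq> - supp" using e(1) by blast
  qed
  ultimately show ?thesis using K(1) compact_Int_closed[of K supp] by (simp add: Int_absorb1)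
qed

lemma integrable_on_supp:
  fixes f :: "real \<Rightarrow> 'b::{banach, second_countable_topology}"
  assumes "f \<in> borel_measurable borel" "continuous_on supp f"
  shows "integrable \<nu> f"
proof -
  obtain B where "\<forall>t\<in>supp. norm (f t) \<le> B"
    using compact_continuous_image[OF assms(2) compact_supp] by (metis compact_imp_bounded bounded_iff imageI)
  then have "AE t in \<nu>. norm (f t) \<le> B" using AE_supp by auto
  moreover have "f \<in> borel_measurable \<nu>" using assms(1) by simp
  ultimately show ?thesis by (rule integrable_const_bound)
qed

lemma integrable_continuous:
  fixes f :: "real \<Rightarrow> 'b::{banach, second_countable_topology}"
  assumes "continuous_on UNIV f" shows "integrable \<nu> f"
  using assms by (intro integrable_on_supp) (auto intro: borel_measurable_continuous_onI continuous_on_subset)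

definition poly_d :: "complex poly \<Rightarrow> 'h bop" where
  "poly_d p = fold_coeffs (\<lambda>a x. a *\<^sub>C 1 + d * x) p 0"

lemma poly_d_0 [simp]: "poly_d 0 = 0"
  by (simp add: poly_d_def)

lemma poly_d_pCons [simp]: "poly_d (pCons a p) = a *\<^sub>C 1 + d * poly_d p"
  by (cases "p = 0 \<and> a = 0") (auto simp: poly_d_def scaleC_bop_simps)

lemma poly_d_add: "poly_d (p + q) = poly_d p + poly_d q"
  by (induction p q rule: poly_induct2) (simp_all add: algebra_simps scaleC_bop_simps)

lemma poly_d_smult: "poly_d (Polynomial.smult c p) = c *\<^sub>C poly_d p"
  by (induction p) (simp_all add: algebra_simps scaleC_bop_simps)

lemma poly_d_minus: "poly_d (- p) = - poly_d p"
  using poly_d_smult[of "-1" p] by (simp add: scaleC_bop_simps)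

lemma poly_d_diff: "poly_d (p - q) = poly_d p - poly_d q"
  using poly_d_add[of p "- q"] by (simp add: poly_d_minus)

lemma poly_d_sum: "poly_d (\<Sum>i\<in>I. p i) = (\<Sum>i\<in>I. poly_d (p i))"
  by (induction I rule: infinite_finite_induct) (simp_all add: poly_d_add)

lemma poly_d_mult: "poly_d (p * q) = poly_d p * poly_d q"
  by (induction p) (simp_all add: poly_d_add poly_d_smult algebra_simps scaleC_bop_simps)

lemma poly_d_M [simp]: "poly_d p \<in> M"
  by (induction p) simp_all

lemma spanned_poly_d: "spanned (poly_d p) (\<lambda>p q. 0)"
proof (induction p)
  case 0
  show ?case using spanned_scale[OF spanned_one, of 0] by (simp add: scaleC_bop_simps)
next
  case (pCons a p)
  show ?case using spanned_add[OF spanned_scale[OF spanned_one, of a] spanned_d[OF pCons.IH]] by simp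
qed

lemma phi_poly_d: "\<phi> (poly_d p) = (\<integral>t. poly p (of_real t) \<partial>\<nu>)"
proof -
  have int: "integrable \<nu> (\<lambda>t. complex_of_real t ^ k * poly p (of_real t))" for k p
    by (intro integrable_continuous continuous_intros)
  have "\<phi> (d ^ k * poly_d p) = (\<integral>t. of_real t ^ k * poly p (of_real t) \<partial>\<nu>)" for k
  proof (induction p arbitrary: k)
    case (pCons a p)
    have "d ^ k * poly_d (pCons a p) = a *\<^sub>C d ^ k + d ^ Suc k * poly_d p"
      by (simp add: algebra_simps scaleC_bop_simps power_commutes[symmetric] mult.assoc)
    then have "\<phi> (d ^ k * poly_d (pCons a p)) = a * \<phi> (d ^ k) + \<phi> (d ^ Suc k * poly_d p)"
      by (simp add: phi_add phi_scaleC del: power_Suc)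
    also have "\<dots> = a * (\<integral>t. complex_of_real t ^ k \<partial>\<nu>) + (\<integral>t. of_real t ^ Suc k * poly p (of_real t) \<partial>\<nu>)"
      unfolding pCons.IH d_moments by (simp flip: of_real_power)
    also have "\<dots> = (\<integral>t. a * complex_of_real t ^ k + of_real t ^ Suc k * poly p (of_real t) \<partial>\<nu>)"
      using int[of k 1] int[of "Suc k" p] by (subst Bochner_Integration.integral_add) auto
    also have "\<dots> = (\<integral>t. of_real t ^ k * poly (pCons a p) (of_real t) \<partial>\<nu>)"
      by (intro Bochner_Integration.integral_cong) (auto simp: algebra_simps)
    finally show ?case .
  qed simp
  from this[of 0] show ?thesis by simp
qed

lemma poly_map_cnj: "poly (map_poly cnj p) (of_real t) = cnj (poly p (of_real t))"
  by (induction p) (simp_all add: map_poly_pCons)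

lemma poly_d_commute_d: "poly_d p * d = d * poly_d p"
  using poly_d_mult[of p "[:0, 1:]"] poly_d_mult[of "[:0, 1:]" p] by (simp add: mult.commute scaleC_bop_simps)

lemma is_adjoint_poly_d: "is_adjoint (poly_d p) (poly_d (map_poly cnj p))"
proof (induction p)
  case (pCons a p)
  have "is_adjoint (a *\<^sub>C 1 + d * poly_d p) (cnj a *\<^sub>C 1 + poly_d (map_poly cnj p) * d)"
    using d_sa pCons.IH by (intro is_adjoint_add is_adjoint_scaleC is_adjoint_one is_adjoint_mult) (simp_all add: selfadjoint_def)
  then show ?case by (simp add: map_poly_pCons poly_d_commute_d)
qed (simp add: is_adjoint_zero)

definition l2sq :: "complex poly \<Rightarrow> real" where
  "l2sq p = (\<integral>t. (cmod (poly p (of_real t)))\<^sup>2 \<partial>\<nu>)"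

lemma phi_poly_d_square:
  "\<phi> (poly_d (map_poly cnj p) * poly_d p) = of_real (l2sq p)" "\<phi> (poly_d p * poly_d (map_poly cnj p)) = of_real (l2sq p)"
proof -
  have "\<phi> (poly_d (map_poly cnj p * p)) = (\<integral>t. complex_of_real ((cmod (poly p (of_real t)))\<^sup>2) \<partial>\<nu>)"
    unfolding phi_poly_d by (intro Bochner_Integration.integral_cong) (simp_all only: poly_mult poly_map_cnj complex_norm_square mult.commute)
  then show "\<phi> (poly_d (map_poly cnj p) * poly_d p) = of_real (l2sq p)"
    by (simp only: l2sq_def poly_d_mult integral_complex_of_real)
  then show "\<phi> (poly_d p * poly_d (map_poly cnj p)) = of_real (l2sq p)"
    by (simp add: phi_trace[of "poly_d p"])
qed

lemma l2sq_nonneg: "0 \<le> l2sq p"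
  unfolding l2sq_def by (intro Bochner_Integration.integral_nonneg) simp

text \<open>The trace moves one of the polynomials to the left of \<open>x\<close>, so that the bound involves both \<open>L\<^sup>2\<close> norms.\<close>

lemma phi_poly_bound:
  assumes "x \<in> M"
  shows "cmod (\<phi> (x * poly_d (r * q))) \<le> norm x * sqrt (l2sq q * l2sq r)"
proof -
  have "\<phi> (x * poly_d (r * q)) = \<phi> (poly_d q * x * poly_d r)"
    using assms phi_trace[of "x * poly_d r" "poly_d q"] by (simp add: poly_d_mult mult.assoc)
  moreover have "(cmod (\<phi> (poly_d q * x * poly_d r)))\<^sup>2
    \<le> (norm x)\<^sup>2 * Re (\<phi> (poly_d q * poly_d (map_poly cnj q))) * Re (\<phi> (poly_d (map_poly cnj r) * poly_d r))"
    using is_adjoint_poly_d assms by (intro phi_sandwich_bound) (auto intro: is_adjoint_sym)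
  ultimately have "(cmod (\<phi> (x * poly_d (r * q))))\<^sup>2 \<le> (norm x * sqrt (l2sq q * l2sq r))\<^sup>2"
    by (simp add: phi_poly_d_square power_mult_distrib l2sq_nonneg)
  then show ?thesis by (rule power2_le_imp_le) (simp add: l2sq_nonneg)
qed

lemma phi_poly_bound_sup:
  assumes "x \<in> M" "\<And>t. t \<in> supp \<Longrightarrow> cmod (poly p (of_real t)) \<le> e" "0 \<le> e"
  shows "cmod (\<phi> (x * poly_d p)) \<le> norm x * e"
proof -
  have "l2sq p \<le> (\<integral>t. e\<^sup>2 \<partial>\<nu>)" unfolding l2sq_def
  proof (rule integral_mono_AE)
    show "integrable \<nu> (\<lambda>t. (cmod (poly p (of_real t)))\<^sup>2)" by (intro integrable_continuous continuous_intros)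
    show "AE t in \<nu>. (cmod (poly p (of_real t)))\<^sup>2 \<le> e\<^sup>2"
      using AE_supp by eventually_elim (intro power_mono assms, auto)
  qed simp
  then have l: "l2sq p \<le> e\<^sup>2" by (simp add: prob_space)
  have "l2sq 1 = 1" by (simp add: l2sq_def prob_space)
  then have "cmod (\<phi> (x * poly_d p)) \<le> norm x * sqrt (l2sq p)"
    using phi_poly_bound[OF assms(1), of p 1] by simp
  also have "\<dots> \<le> norm x * e" using l assms(3) real_sqrt_le_mono[OF l] by (intro mult_left_mono) auto
  finally show ?thesis .
qed

text \<open>The polynomial approximates a tent function of width \<open>\<epsilon>\<close> at \<open>t\<^sub>0\<close> so closely on the support that
  its \<open>L\<^sup>2\<close> mass is concentrated near \<open>t\<^sub>0\<close>. Both error terms are small compared with the mass \<open>I\<close> of the squared tent function.\<close>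

lemma concentrated_poly:
  assumes t0: "t0 \<in> supp" and e: "e > 0"
  obtains p where "l2sq p > 0" "l2sq (p * [:of_real t0, - 1:]) \<le> e\<^sup>2 * l2sq p"
    "\<phi> (poly_d (p * p)) = of_real (l2sq p)"
proof -
  define \<epsilon> where "\<epsilon> = e / 2"
  have \<epsilon>: "\<epsilon> > 0" "2 * \<epsilon>\<^sup>2 \<le> e\<^sup>2" using e by (auto simp: \<epsilon>_def power2_eq_square)
  define f where "f t = max 0 (1 - \<bar>t - t0\<bar> / \<epsilon>)" for t
  have f: "0 \<le> f t" "f t \<le> 1" for t using \<epsilon> by (auto simp: f_def)
  have contf: "continuous_on A f" for A unfolding f_def using \<epsilon> by (intro continuous_intros) auto
  define I where "I = (\<integral>t. (f t)\<^sup>2 \<partial>\<nu>)"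
  have intf: "integrable \<nu> (\<lambda>t. (f t)\<^sup>2)" by (intro integrable_continuous continuous_intros contf)
  have "I > 0"
  proof -
    have "(\<integral>t. (1/4) * indicator (ball t0 (\<epsilon> / 2)) t \<partial>\<nu>) \<le> I" unfolding I_def
    proof (rule integral_mono)
      fix t
      show "(1/4) * indicator (ball t0 (\<epsilon> / 2)) t \<le> (f t)\<^sup>2"
      proof (cases "t \<in> ball t0 (\<epsilon> / 2)")
        case True
        then have "\<bar>t - t0\<bar> / \<epsilon> \<le> 1 / 2" using \<epsilon> by (auto simp: dist_real_def abs_minus_commute field_simps)
        then have "1 / 2 \<le> f t" by (simp add: f_def le_max_iff_disj)
        from power_mono[OF this, of 2] show ?thesis using True by (simp add: power2_eq_square)
      qed simp
      show "integrable \<nu> (\<lambda>t. (1/4::real) * indicator (ball t0 (\<epsilon> / 2)) t)"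
        by (intro integrable_mult_right integrable_real_indicator) (simp_all add: emeasure_eq_measure)
    qed (rule intf)
    moreover have "measure \<nu> (ball t0 (\<epsilon> / 2)) > 0" using t0 \<epsilon> by (simp add: supp_def)
    ultimately show ?thesis by simp
  qed
  obtain Bd where Bd: "\<And>t. t \<in> supp \<Longrightarrow> (t - t0)\<^sup>2 \<le> Bd"
  proof -
    have "compact ((\<lambda>t. (t - t0)\<^sup>2) ` supp)" by (intro compact_continuous_image continuous_intros compact_supp)
    then obtain B where "\<forall>y\<in>(\<lambda>t. (t - t0)\<^sup>2) ` supp. norm y \<le> B" by (metis compact_imp_bounded bounded_iff)
    then show ?thesis using that[of B] by auto
  qed
  have Bd0: "0 \<le> Bd" using order_trans[OF zero_le_power2 Bd[OF t0]] .
  define \<delta> where "\<delta> = min 1 (\<epsilon>\<^sup>2 * I / (3 * (Bd + 2 * \<epsilon>\<^sup>2) + 1))"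
  have den: "3 * (Bd + 2 * \<epsilon>\<^sup>2) + 1 > 0" using Bd0 by (simp add: add_nonneg_pos)
  have \<delta>: "\<delta> > 0" "\<delta> \<le> 1" unfolding \<delta>_def using \<epsilon> \<open>I > 0\<close> den by auto
  have \<delta>2: "3 * \<delta> * (Bd + 2 * \<epsilon>\<^sup>2) \<le> \<epsilon>\<^sup>2 * I"
  proof -
    have "\<delta> \<le> \<epsilon>\<^sup>2 * I / (3 * (Bd + 2 * \<epsilon>\<^sup>2) + 1)" by (simp add: \<delta>_def)
    then have "\<delta> * (3 * (Bd + 2 * \<epsilon>\<^sup>2) + 1) \<le> \<epsilon>\<^sup>2 * I" using den by (simp add: field_simps)
    then show ?thesis using \<delta>(1) by (simp add: algebra_simps)
  qed
  have \<delta>3: "6 * \<delta> \<le> I"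
  proof -
    \<comment> \<open>the polynomial keeps at least half of the mass\<close>
    have "6 * \<delta> * \<epsilon>\<^sup>2 \<le> \<epsilon>\<^sup>2 * I" proof -
      have "0 \<le> Bd * (\<delta> * 3)" using \<delta>(1) Bd0 by (intro mult_nonneg_nonneg) auto
      moreover have "6 * \<delta> * \<epsilon>\<^sup>2 + Bd * (\<delta> * 3) \<le> \<epsilon>\<^sup>2 * I" using \<delta>2 by (simp add: algebra_simps)
      ultimately show ?thesis by linarith
    qed
    then show ?thesis using \<epsilon> by simp
  qed
  obtain p g where p: "\<And>t. poly p (complex_of_real t) = of_real (g t)" "\<And>t. t \<in> supp \<Longrightarrow> \<bar>f t - g t\<bar> < \<delta>"
    using real_continuous_poly_approx[OF compact_supp contf \<delta>(1)] by blast
  have contg: "continuous_on UNIV g"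
  proof -
    have "g = (\<lambda>t. Re (poly p (of_real t)))" by (simp add: p(1))
    then show ?thesis by (auto intro!: continuous_intros)
  qed
  have intg: "integrable \<nu> (\<lambda>t. (g t)\<^sup>2)" by (intro integrable_continuous continuous_intros contg)
  have fg: "\<bar>(f t)\<^sup>2 - (g t)\<^sup>2\<bar> \<le> 3 * \<delta>" if "t \<in> supp" for t
  proof -
    have "\<bar>f t + g t\<bar> \<le> 3" using p(2)[OF that] f[of t] \<delta> by linarith
    moreover have "(f t)\<^sup>2 - (g t)\<^sup>2 = (f t - g t) * (f t + g t)" by (simp add: power2_eq_square algebra_simps)
    ultimately show ?thesis using p(2)[OF that] mult_mono[of "\<bar>f t - g t\<bar>" \<delta> "\<bar>f t + g t\<bar>" 3] \<delta>
      by (simp add: abs_mult mult.commute)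
  qed
  have l2p: "l2sq p = (\<integral>t. (g t)\<^sup>2 \<partial>\<nu>)" by (simp add: l2sq_def p(1))
  have "I \<le> (\<integral>t. (g t)\<^sup>2 + 3 * \<delta> \<partial>\<nu>)" unfolding I_def
  proof (rule integral_mono_AE[OF intf])
    show "AE t in \<nu>. (f t)\<^sup>2 \<le> (g t)\<^sup>2 + 3 * \<delta>" using AE_supp
    proof eventually_elim
      case (elim t) then show ?case using fg[OF elim] by linarith
    qed
  qed (use intg in simp)
  also have "\<dots> = l2sq p + 3 * \<delta>" using intg by (simp add: l2p prob_space)
  finally have lower: "I - 3 * \<delta> \<le> l2sq p" by simp
  have "l2sq (p * [:of_real t0, - 1:]) = (\<integral>t. (g t)\<^sup>2 * (t - t0)\<^sup>2 \<partial>\<nu>)"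
  proof -
    have "(cmod (poly (p * [:of_real t0, - 1:]) (of_real t)))\<^sup>2 = (g t)\<^sup>2 * (t - t0)\<^sup>2" for t
    proof -
      have "poly (p * [:of_real t0, - 1:]) (of_real t) = complex_of_real (g t * (t0 - t))"
        by (simp add: p(1) algebra_simps)
      then show ?thesis by (simp only: norm_of_real power2_abs power_mult_distrib power2_commute[of t0 t])
    qed
    then show ?thesis by (simp add: l2sq_def)
  qed
  also have "\<dots> \<le> (\<integral>t. \<epsilon>\<^sup>2 * (f t)\<^sup>2 + 3 * \<delta> * Bd \<partial>\<nu>)"
  proof (rule integral_mono_AE)
    show "integrable \<nu> (\<lambda>t. (g t)\<^sup>2 * (t - t0)\<^sup>2)" by (intro integrable_continuous continuous_intros contg)
    show "AE t in \<nu>. (g t)\<^sup>2 * (t - t0)\<^sup>2 \<le> \<epsilon>\<^sup>2 * (f t)\<^sup>2 + 3 * \<delta> * Bd" using AE_supp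
    proof eventually_elim
      case (elim t)
      have "(g t)\<^sup>2 * (t - t0)\<^sup>2 \<le> ((f t)\<^sup>2 + 3 * \<delta>) * (t - t0)\<^sup>2"
        using fg[OF elim] by (intro mult_right_mono) auto
      also have "\<dots> = (f t)\<^sup>2 * (t - t0)\<^sup>2 + 3 * \<delta> * (t - t0)\<^sup>2" by (simp add: algebra_simps)
      also have "(f t)\<^sup>2 * (t - t0)\<^sup>2 \<le> (f t)\<^sup>2 * \<epsilon>\<^sup>2"
      proof (cases "\<bar>t - t0\<bar> \<le> \<epsilon>")
        case True
        then have "(t - t0)\<^sup>2 \<le> \<epsilon>\<^sup>2" using \<epsilon> by (metis abs_ge_zero power2_abs power_mono)
        then show ?thesis by (intro mult_left_mono) auto
      next
        case False
        then have "f t = 0" using \<epsilon> by (simp add: f_def field_simps)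
        then show ?thesis by simp
      qed
      also have "3 * \<delta> * (t - t0)\<^sup>2 \<le> 3 * \<delta> * Bd" using Bd[OF elim] \<delta> by (intro mult_left_mono) auto
      finally show ?case by (simp add: mult.commute)
    qed
  qed (use intf in simp)
  also have "\<dots> = \<epsilon>\<^sup>2 * I + 3 * \<delta> * Bd" using intf by (simp add: I_def prob_space)
  also have "\<dots> \<le> 2 * \<epsilon>\<^sup>2 * (I - 3 * \<delta>)" using \<delta>2 by (simp add: algebra_simps)
  also have "\<dots> \<le> e\<^sup>2 * l2sq p" using \<epsilon> lower \<delta>3 \<open>I > 0\<close> by (intro mult_mono) auto
  finally have J: "l2sq (p * [:of_real t0, - 1:]) \<le> e\<^sup>2 * l2sq p" .
  have "\<phi> (poly_d (p * p)) = of_real (l2sq p)"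
    unfolding phi_poly_d l2p by (simp add: p(1) power2_eq_square flip: of_real_mult)
  moreover have "l2sq p > 0" using lower \<delta>3 \<open>I > 0\<close> by simp
  ultimately show ?thesis using that J by blast
qed

end

context free_semicircular_perturbation
begin

text \<open>The subordination map: \<open>subord n b g1 R\<close> is \<open>\<omega>(b)\<close> if \<open>R\<close> is the resolvent at \<open>b\<close>.\<close>

definition subord ::
    "nat \<Rightarrow> (nat \<Rightarrow> nat \<Rightarrow> complex) \<Rightarrow> (nat \<Rightarrow> nat \<Rightarrow> complex) \<Rightarrow> (nat \<Rightarrow> nat \<Rightarrow> 'h bop) \<Rightarrow> nat \<Rightarrow> nat \<Rightarrow> complex" where
  "subord n b g1 R i j = b i j - of_real (\<sigma>\<^sup>2) * (\<Sum>k<n. \<Sum>u<n. g1 i k * \<phi> (R k u) * g1 u j)"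

context
  fixes n :: nat and b g1 g2 :: "nat \<Rightarrow> nat \<Rightarrow> complex" and R :: "nat \<Rightarrow> nat \<Rightarrow> 'h bop"
  assumes R: "is_minv n (\<lambda>i j. b i j *\<^sub>C 1 - g1 i j *\<^sub>C s - g2 i j *\<^sub>C d) R"
    and SD: "Schwinger_Dyson_matrix n g1 R"
begin

lemma R_M: "i < n \<Longrightarrow> j < n \<Longrightarrow> R i j \<in> M"
  using SD unfolding Schwinger_Dyson_matrix_def by blast

text \<open>This is \<open>(\<omega> - \<gamma>\<^sub>2 d) E[R | d] = 1\<close> tested against polynomials in \<open>d\<close>. Apply \<open>\<phi>\<close> to
  \<open>(b - \<gamma>\<^sub>1 s - \<gamma>\<^sub>2 d) R q(d) = q(d)\<close>: the Schwinger--Dyson equation turns the term with \<open>s\<close> into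
  \<open>\<sigma>\<^sup>2 \<gamma>\<^sub>1 \<phi>(R) \<gamma>\<^sub>1 \<phi>(R q(d))\<close>, and the trace moves \<open>d\<close> next to \<open>q(d)\<close>.\<close>

lemma subordination_identity:
  assumes ij: "i < n" "j < n"
  shows "(\<Sum>k<n. \<phi> (R k j * poly_d (q * [:subord n b g1 R i k, - g2 i k:]))) = mone i j * \<phi> (poly_d q)"
proof -
  define x where "x = poly_d q"
  have x: "x \<in> M" by (simp add: x_def)
  have RM: "R k j \<in> M" if "k < n" for k using R_M that ij by simp
  have "(\<Sum>k<n. (b i k *\<^sub>C 1 - g1 i k *\<^sub>C s - g2 i k *\<^sub>C d) * R k j) = mone i j"
    using R ij unfolding is_minv_def mmul_def by blast
  then have "(\<Sum>k<n. (b i k *\<^sub>C 1 - g1 i k *\<^sub>C s - g2 i k *\<^sub>C d) * R k j) * x = mone i j * x" by simp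
  then have "(\<Sum>k<n. b i k *\<^sub>C (R k j * x) - g1 i k *\<^sub>C (s * (R k j * x)) - g2 i k *\<^sub>C (d * (R k j * x))) = mone i j * x"
    by (simp add: sum_distrib_right left_diff_distrib scaleC_bop_simps mult.assoc)
  then have "\<phi> (\<Sum>k<n. b i k *\<^sub>C (R k j * x) - g1 i k *\<^sub>C (s * (R k j * x)) - g2 i k *\<^sub>C (d * (R k j * x))) = mone i j * \<phi> x"
    by (simp add: mone_def)
  moreover have "\<phi> (\<Sum>k<n. b i k *\<^sub>C (R k j * x) - g1 i k *\<^sub>C (s * (R k j * x)) - g2 i k *\<^sub>C (d * (R k j * x)))
     = (\<Sum>k<n. b i k * \<phi> (R k j * x) - g1 i k * \<phi> (s * (R k j * x)) - g2 i k * \<phi> (d * (R k j * x)))"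
    using RM x by (subst phi_sum) (auto simp: phi_diff phi_scaleC)
  moreover have "(\<Sum>k<n. g1 i k * \<phi> (s * (R k j * x)))
    = (\<Sum>v<n. (b i v - subord n b g1 R i v) * \<phi> (R v j * x))"
  proof -
    have "\<phi> (s * (R k j * x)) = of_real (\<sigma>\<^sup>2) * (\<Sum>u<n. \<Sum>v<n. \<phi> (R k u) * g1 u v * \<phi> (R v j * x))" if "k < n" for k
      using SD spanned_poly_d[of q] that ij unfolding Schwinger_Dyson_matrix_def x_def by blast
    then have "(\<Sum>k<n. g1 i k * \<phi> (s * (R k j * x)))
      = (\<Sum>k<n. \<Sum>u<n. \<Sum>v<n. of_real (\<sigma>\<^sup>2) * (g1 i k * \<phi> (R k u) * g1 u v) * \<phi> (R v j * x))"
      by (intro sum.cong refl) (simp add: sum_distrib_left mult_ac)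
    also have "\<dots> = (\<Sum>k<n. \<Sum>v<n. \<Sum>u<n. of_real (\<sigma>\<^sup>2) * (g1 i k * \<phi> (R k u) * g1 u v) * \<phi> (R v j * x))"
      by (intro sum.cong refl sum.swap)
    also have "\<dots> = (\<Sum>v<n. \<Sum>k<n. \<Sum>u<n. of_real (\<sigma>\<^sup>2) * (g1 i k * \<phi> (R k u) * g1 u v) * \<phi> (R v j * x))"
      by (rule sum.swap)
    finally show ?thesis by (simp add: subord_def sum_distrib_left sum_distrib_right)
  qed
  moreover have "\<phi> (d * (R k j * x)) = \<phi> (R k j * (d * x))" if "k < n" for k
    using phi_trace[of d "R k j * x"] RM[OF that] x by (simp add: x_def poly_d_commute_d mult.assoc)
  ultimately have "(\<Sum>k<n. b i k * \<phi> (R k j * x) - (b i k - subord n b g1 R i k) * \<phi> (R k j * x) - g2 i k * \<phi> (R k j * (d * x))) = mone i j * \<phi> x"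
    by (simp add: sum_subtractf)
  moreover have "\<phi> (R k j * poly_d (q * [:subord n b g1 R i k, - g2 i k:]))
    = b i k * \<phi> (R k j * x) - (b i k - subord n b g1 R i k) * \<phi> (R k j * x) - g2 i k * \<phi> (R k j * (d * x))" if "k < n" for k
  proof -
    have "poly_d (q * [:subord n b g1 R i k, - g2 i k:]) = subord n b g1 R i k *\<^sub>C x - g2 i k *\<^sub>C (d * x)"
      by (simp add: x_def poly_d_add poly_d_smult poly_d_minus scaleC_bop_simps)
    then have "R k j * poly_d (q * [:subord n b g1 R i k, - g2 i k:]) = subord n b g1 R i k *\<^sub>C (R k j * x) - g2 i k *\<^sub>C (R k j * (d * x))"
      by (simp only: right_diff_distrib scaleC_bop_simps)
    then show ?thesis using RM[OF that] x
      by (simp only:) (simp add: phi_diff phi_scaleC algebra_simps)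
  qed
  ultimately show ?thesis by (simp add: x_def)
qed

text \<open>Coefficients that are themselves polynomials in \<open>t\<close> make it possible to multiply by an approximate inverse of
  \<open>\<omega> - t \<gamma>\<^sub>2\<close> from the left.\<close>

lemma subordination_row:
  assumes j: "j < n"
  shows "(\<Sum>k<n. \<phi> (R k j * poly_d (\<Sum>i<n. A i * [:subord n b g1 R i k, - g2 i k:]))) = \<phi> (poly_d (A j))"
proof -
  have "(\<Sum>k<n. \<phi> (R k j * poly_d (\<Sum>i<n. A i * [:subord n b g1 R i k, - g2 i k:])))
    = (\<Sum>k<n. \<Sum>i<n. \<phi> (R k j * poly_d (A i * [:subord n b g1 R i k, - g2 i k:])))"
  proof (intro sum.cong refl)
    fix k assume "k \<in> {..<n}"
    then have "R k j \<in> M" using R_M j by simp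
    then show "\<phi> (R k j * poly_d (\<Sum>i<n. A i * [:subord n b g1 R i k, - g2 i k:]))
      = (\<Sum>i<n. \<phi> (R k j * poly_d (A i * [:subord n b g1 R i k, - g2 i k:])))"
      unfolding poly_d_sum sum_distrib_left by (intro phi_sum M_mult poly_d_M)
  qed
  also have "\<dots> = (\<Sum>i<n. \<Sum>k<n. \<phi> (R k j * poly_d (A i * [:subord n b g1 R i k, - g2 i k:])))" by (rule sum.swap)
  also have "\<dots> = (\<Sum>i<n. mone i j * \<phi> (poly_d (A i)))"
    using j by (intro sum.cong refl subordination_identity) auto
  also have "\<dots> = (\<Sum>i<n. \<phi> (poly_d (A i)) * mone i j)" by (simp add: mult.commute)
  also have "\<dots> = \<phi> (poly_d (A j))" by (rule sum_mone_right[OF j])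
  finally show ?thesis .
qed

text \<open>Insert \<open>A\<^sub>i = \<xi>\<^sub>i p\<^sup>2\<close> with \<open>p\<close> concentrated at \<open>t\<^sub>0\<close>. Up to a term with the factor
  \<open>t\<^sub>0 - t\<close>, of order \<open>e\<close>, the identity has \<open>\<xi> (\<omega> - t\<^sub>0 \<gamma>\<^sub>2)\<close> on one side and \<open>\<xi>\<close> on the other, and all
  terms are bounded by multiples of the mass of \<open>p\<^sup>2\<close>.\<close>

lemma row_lower_bound:
  assumes t0: "t0 \<in> supp" and j: "j < n"
  shows "cmod (\<xi> j) \<le> (\<Sum>k<n. cmod (\<Sum>i<n. \<xi> i * (subord n b g1 R i k - of_real t0 * g2 i k)) * norm (R k j))"
    (is "_ \<le> (\<Sum>k<n. cmod (?\<eta> k) * _)")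
proof -
  define c where "c k = (\<Sum>i<n. \<xi> i * g2 i k)" for k
  define Q where "Q = (\<Sum>k<n. cmod (c k) * norm (R k j))"
  have Q: "0 \<le> Q" unfolding Q_def by (intro sum_nonneg mult_nonneg_nonneg) auto
  have "cmod (\<xi> j) \<le> (\<Sum>k<n. cmod (?\<eta> k) * norm (R k j)) + e * Q" if e: "e > 0" for e
  proof -
    obtain p where p: "l2sq p > 0" "l2sq (p * [:of_real t0, - 1:]) \<le> e\<^sup>2 * l2sq p"
      "\<phi> (poly_d (p * p)) = of_real (l2sq p)"
      using concentrated_poly[OF t0 e] by blast
    define r where "r = p * [:complex_of_real t0, - 1:]"
    have G: "(\<Sum>i<n. Polynomial.smult (\<xi> i) (p * p) * [:subord n b g1 R i k, - g2 i k:])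
       = Polynomial.smult (?\<eta> k) (p * p) + Polynomial.smult (c k) (r * p)" for k
    proof -
      have "Polynomial.smult (\<xi> i) (p * p) * [:subord n b g1 R i k, - g2 i k:]
        = Polynomial.smult (\<xi> i * (subord n b g1 R i k - of_real t0 * g2 i k)) (p * p) + Polynomial.smult (\<xi> i * g2 i k) (r * p)" for i
        by (simp add: r_def algebra_simps smult_add_right smult_diff_left smult_diff_right mult_smult_left mult_smult_right)
      then show ?thesis by (simp add: sum.distrib c_def smult_sum)
    qed
    have "\<xi> j * of_real (l2sq p) = \<phi> (poly_d (Polynomial.smult (\<xi> j) (p * p)))"
      by (simp add: poly_d_smult phi_scaleC p(3))
    also have "\<dots> = (\<Sum>k<n. \<phi> (R k j * poly_d (Polynomial.smult (?\<eta> k) (p * p) + Polynomial.smult (c k) (r * p))))"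
      using subordination_row[OF j, of "\<lambda>i. Polynomial.smult (\<xi> i) (p * p)"] unfolding G by simp
    also have "\<dots> = (\<Sum>k<n. ?\<eta> k * \<phi> (R k j * poly_d (p * p)) + c k * \<phi> (R k j * poly_d (r * p)))"
      using R_M j by (intro sum.cong refl)
        (simp add: poly_d_add poly_d_smult distrib_left scaleC_bop_simps phi_add phi_scaleC)
    finally have "cmod (\<xi> j) * l2sq p = cmod (\<Sum>k<n. ?\<eta> k * \<phi> (R k j * poly_d (p * p)) + c k * \<phi> (R k j * poly_d (r * p)))"
      using p(1) by (metis abs_of_pos norm_mult norm_of_real)
    also have "\<dots> \<le> (\<Sum>k<n. cmod (?\<eta> k) * (norm (R k j) * l2sq p) + cmod (c k) * (norm (R k j) * (e * l2sq p)))"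
    proof (intro sum_norm_le order_trans[OF norm_triangle_ineq] add_mono)
      fix k assume "k \<in> {..<n}"
      then have RM: "R k j \<in> M" using R_M j by simp
      have "cmod (\<phi> (R k j * poly_d (p * p))) \<le> norm (R k j) * l2sq p"
        using phi_poly_bound[OF RM, of p p] p(1) by simp
      then show "cmod (?\<eta> k * \<phi> (R k j * poly_d (p * p))) \<le> cmod (?\<eta> k) * (norm (R k j) * l2sq p)"
        unfolding norm_mult by (intro mult_left_mono) auto
      have "sqrt (l2sq p * l2sq r) \<le> sqrt ((e * l2sq p)\<^sup>2)"
        using mult_left_mono[OF p(2), of "l2sq p"] p(1)
        by (intro real_sqrt_le_mono) (simp add: r_def power2_eq_square mult_ac)
      then have "sqrt (l2sq p * l2sq r) \<le> e * l2sq p" using e p(1) by simp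
      then have "cmod (\<phi> (R k j * poly_d (r * p))) \<le> norm (R k j) * (e * l2sq p)"
        using order_trans[OF phi_poly_bound[OF RM, of r p] mult_left_mono[of _ _ "norm (R k j)"]] by simp
      then show "cmod (c k * \<phi> (R k j * poly_d (r * p))) \<le> cmod (c k) * (norm (R k j) * (e * l2sq p))"
        unfolding norm_mult by (intro mult_left_mono) auto
    qed
    also have "\<dots> = ((\<Sum>k<n. cmod (?\<eta> k) * norm (R k j)) + e * Q) * l2sq p"
      unfolding Q_def distrib_right sum_distrib_left sum_distrib_right sum.distrib[symmetric]
      by (intro sum.cong refl) (simp add: mult_ac)
    finally show ?thesis using p(1) by simp
  qed
  then have "cmod (\<xi> j) \<le> (\<Sum>k<n. cmod (?\<eta> k) * norm (R k j)) + e" if "e > 0" for e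
  proof -
    have "e / (Q + 1) * Q \<le> e" using that Q by (simp add: field_simps)
    then show ?thesis using \<open>\<And>e. e > 0 \<Longrightarrow> _ e\<close>[of "e / (Q + 1)"] that Q by fastforce
  qed
  then show ?thesis by (rule field_le_epsilon)
qed

theorem subordination_invertible:
  assumes "t \<in> supp"
  shows "\<exists>F. is_minv n (\<lambda>i k. subord n b g1 R i k - of_real t * g2 i k) F"
proof (rule trivial_left_kernel_imp_minv)
  fix \<xi> i assume "\<And>k. k < n \<Longrightarrow> (\<Sum>i<n. \<xi> i * (subord n b g1 R i k - of_real t * g2 i k)) = 0" "i < n"
  then show "\<xi> i = 0" using row_lower_bound[OF assms \<open>i < n\<close>, of \<xi>] by simp
qed

text \<open>The rows of \<open>F\<close> are admissible in \<open>row_lower_bound\<close>. The bound is uniform in \<open>t\<close>.\<close>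

lemma subordination_inverse_bound:
  assumes t: "t \<in> supp" and F: "is_minv n (\<lambda>i k. subord n b g1 R i k - of_real t * g2 i k) F" and ij: "i < n" "j < n"
  shows "cmod (F i j) \<le> norm (R i j)"
proof -
  have "(\<Sum>l<n. F i l * (subord n b g1 R l k - of_real t * g2 l k)) = mone i k" if "k < n" for k
    using F ij that unfolding is_minv_def mmul_def by blast
  then have "cmod (F i j) \<le> (\<Sum>k<n. cmod (mone i k) * norm (R k j))"
    using row_lower_bound[OF t ij(2), of "F i"] by simp
  also have "\<dots> = (\<Sum>k<n. mone i k * norm (R k j))" by (intro sum.cong) (auto simp: mone_def)
  also have "\<dots> = norm (R i j)" by (rule sum_mone_left[OF ij(1)])
  finally show ?thesis .
qed

text \<open>The resolvent identity and the uniform bound make \<open>F\<close> Lipschitz on the support.\<close>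

lemma subordination_inverse_continuous:
  assumes F: "\<And>t. t \<in> supp \<Longrightarrow> is_minv n (\<lambda>i k. subord n b g1 R i k - of_real t * g2 i k) (F t)" and ij: "i < n" "j < n"
  shows "continuous_on supp (\<lambda>t. F t i j)"
proof -
  define C where "C = (\<Sum>u<n. \<Sum>v<n. norm (R i u) * cmod (g2 u v) * norm (R v j))"
  have "cmod (F t i j - F t' i j) \<le> C * dist t t'" if tt: "t \<in> supp" "t' \<in> supp" for t t'
  proof -
    define W where "W t i k = subord n b g1 R i k - of_real t * g2 i k" for t i k
    note F' = F[folded W_def]
    have "mmul n (mmul n (F t) (W t')) (F t') i j = (\<Sum>k<n. F t i k * mone k j)"
      unfolding mmul_assoc using F'[OF tt(2)] ij by (auto simp: mmul_def[of n "F t"] is_minv_def intro!: sum.cong)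
    then have 1: "mmul n (mmul n (F t) (W t')) (F t') i j = F t i j" using ij by (simp only: sum_mone_right)
    have "mmul n (mmul n (F t) (W t)) (F t') i j = mmul n mone (F t') i j"
      by (rule mmul_cong) (use F'[OF tt(1)] ij in \<open>auto simp: is_minv_def\<close>)
    then have 2: "mmul n (mmul n (F t) (W t)) (F t') i j = F t' i j" using ij by simp
    have "F t i j - F t' i j = mmul n (mmul n (F t) (W t')) (F t') i j - mmul n (mmul n (F t) (W t)) (F t') i j"
      by (simp add: 1 2)
    also have "\<dots> = (\<Sum>v<n. \<Sum>u<n. of_real (t - t') * (F t i u * g2 u v * F t' v j))"
      unfolding mmul_def sum_distrib_right sum_subtractf[symmetric]
      by (intro sum.cong refl) (simp add: W_def algebra_simps)
    finally have "cmod (F t i j - F t' i j) \<le> (\<Sum>v<n. \<Sum>u<n. dist t t' * (norm (R i u) * cmod (g2 u v) * norm (R v j)))"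
    proof (elim ssubst, intro sum_norm_le)
      fix v u assume "v \<in> {..<n}" "u \<in> {..<n}"
      then have "cmod (F t i u) \<le> norm (R i u)" "cmod (F t' v j) \<le> norm (R v j)"
        using subordination_inverse_bound[OF tt(1) F[OF tt(1)]] subordination_inverse_bound[OF tt(2) F[OF tt(2)]] ij by auto
      then show "cmod (of_real (t - t') * (F t i u * g2 u v * F t' v j)) \<le> dist t t' * (norm (R i u) * cmod (g2 u v) * norm (R v j))"
        unfolding norm_mult by (intro mult_mono mult_nonneg_nonneg) (auto simp: dist_real_def simp del: of_real_diff)
    qed
    also have "\<dots> = C * dist t t'"
      unfolding C_def by (subst sum.swap) (simp add: sum_distrib_left mult_ac)
    finally show ?thesis .
  qed
  moreover have "0 \<le> C" unfolding C_def by (intro sum_nonneg mult_nonneg_nonneg) auto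
  ultimately have "C-lipschitz_on supp (\<lambda>t. F t i j)" by (intro lipschitz_onI) (auto simp: dist_norm)
  then show ?thesis by (rule lipschitz_on_continuous_on)
qed

text \<open>Take for \<open>A\<close> polynomials close to the \<open>i\<close>-th row of \<open>F\<close> on the support. Then \<open>A (\<omega> - t \<gamma>\<^sub>2)\<close> is close to the
  \<open>i\<close>-th unit row, and \<open>subordination_row\<close> says that \<open>\<phi> (R i j)\<close> is close to \<open>\<integral> A\<^sub>j d\<nu>\<close>, hence to \<open>\<integral> F\<^sub>i\<^sub>j d\<nu>\<close>.\<close>

theorem subordination_integral:
  assumes F: "\<And>t. t \<in> supp \<Longrightarrow> is_minv n (\<lambda>i k. subord n b g1 R i k - of_real t * g2 i k) (F t)"
    and meas: "\<And>i j. i < n \<Longrightarrow> j < n \<Longrightarrow> (\<lambda>t. F t i j) \<in> borel_measurable borel"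
    and ij: "i < n" "j < n"
  shows "(\<integral>t. F t i j \<partial>\<nu>) = \<phi> (R i j)"
proof -
  define W where "W t i k = subord n b g1 R i k - of_real t * g2 i k" for t i k
  note F' = F[folded W_def]
  note cont = subordination_inverse_continuous[OF F]
  have intF: "integrable \<nu> (\<lambda>t. F t i j)"
    by (rule integrable_on_supp[OF meas[OF ij]]) (rule cont[OF _ ij])
  have "\<exists>B\<ge>0. \<forall>t\<in>supp. \<forall>k<n. (\<Sum>l<n. cmod (W t l k)) \<le> B"
  proof -
    have "compact ((\<lambda>t. \<Sum>k<n. \<Sum>l<n. cmod (W t l k)) ` supp)"
      unfolding W_def by (intro compact_continuous_image continuous_intros compact_supp)
    then obtain B where B: "\<forall>y\<in>(\<lambda>t. \<Sum>k<n. \<Sum>l<n. cmod (W t l k)) ` supp. norm y \<le> B"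
      by (metis compact_imp_bounded bounded_iff)
    have "(\<Sum>l<n. cmod (W t l k)) \<le> max 0 B" if "t \<in> supp" "k < n" for t k
    proof -
      have "(\<Sum>l<n. cmod (W t l k)) \<le> (\<Sum>k<n. \<Sum>l<n. cmod (W t l k))"
        using that by (intro member_le_sum) (auto intro: sum_nonneg)
      also have "\<dots> \<le> B" using B that by fastforce
      finally show ?thesis by simp
    qed
    then show ?thesis by (intro exI[of _ "max 0 B"]) auto
  qed
  then obtain B where B: "B \<ge> 0" "\<And>t k. t \<in> supp \<Longrightarrow> k < n \<Longrightarrow> (\<Sum>l<n. cmod (W t l k)) \<le> B" by blast
  define N where "N = (\<Sum>k<n. norm (R k j))"
  have N: "0 \<le> N" unfolding N_def by (intro sum_nonneg) simp
  have close: "cmod (\<phi> (R i j) - (\<integral>t. F t i j \<partial>\<nu>)) \<le> e * (N * B + 1)" if e: "e > 0" for e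
  proof -
    have "\<forall>l\<in>{..<n}. \<exists>p. \<forall>t\<in>supp. cmod (F t i l - poly p (of_real t)) \<le> e"
    proof
      fix l assume "l \<in> {..<n}"
      then have "continuous_on supp (\<lambda>t. F t i l)" using ij by (intro cont) auto
      from complex_continuous_poly_approx[OF compact_supp this e]
      show "\<exists>p. \<forall>t\<in>supp. cmod (F t i l - poly p (of_real t)) \<le> e" by metis
    qed
    from bchoice[OF this] obtain A where A: "\<And>l t. l < n \<Longrightarrow> t \<in> supp \<Longrightarrow> cmod (F t i l - poly (A l) (of_real t)) \<le> e"
      by auto
    define G where "G k = (\<Sum>l<n. A l * [:subord n b g1 R l k, - g2 l k:])" for k
    have G: "cmod (poly (G k - [:mone i k:]) (of_real t)) \<le> e * B" if k: "k < n" and t: "t \<in> supp" for k t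
    proof -
      have "mone i k = (\<Sum>l<n. F t i l * W t l k)" using F'[OF t] ij k by (simp add: is_minv_def mmul_def)
      moreover have "poly (G k) (of_real t) = (\<Sum>l<n. poly (A l) (of_real t) * W t l k)"
        by (simp add: G_def poly_sum W_def algebra_simps)
      ultimately have "poly (G k - [:mone i k:]) (of_real t) = (\<Sum>l<n. (poly (A l) (of_real t) - F t i l) * W t l k)"
        by (simp add: sum_subtractf left_diff_distrib)
      also have "cmod \<dots> \<le> (\<Sum>l<n. e * cmod (W t l k))"
        using A[OF _ t] by (intro sum_norm_le) (auto simp: norm_mult norm_minus_commute intro!: mult_right_mono)
      also have "\<dots> \<le> e * B" using B(2)[OF t k] e by (simp add: sum_distrib_left[symmetric])
      finally show ?thesis .
    qed
    have "\<phi> (poly_d (A j)) = (\<Sum>k<n. \<phi> (R k j * poly_d (G k)))"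
      using subordination_row[OF ij(2), of A] by (simp add: G_def)
    also have "\<dots> = (\<Sum>k<n. mone i k * \<phi> (R k j) + \<phi> (R k j * poly_d (G k - [:mone i k:])))"
      using R_M ij by (intro sum.cong refl)
        (simp add: poly_d_diff right_diff_distrib phi_diff phi_scaleC scaleC_bop_simps)
    also have "\<dots> = \<phi> (R i j) + (\<Sum>k<n. \<phi> (R k j * poly_d (G k - [:mone i k:])))"
      using ij by (simp add: sum.distrib sum_mone_left)
    finally have "\<phi> (R i j) - (\<integral>t. F t i j \<partial>\<nu>)
      = (\<integral>t. poly (A j) (of_real t) \<partial>\<nu>) - (\<integral>t. F t i j \<partial>\<nu>) - (\<Sum>k<n. \<phi> (R k j * poly_d (G k - [:mone i k:])))"
      by (simp add: phi_poly_d)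
    moreover have "cmod ((\<integral>t. poly (A j) (of_real t) \<partial>\<nu>) - (\<integral>t. F t i j \<partial>\<nu>)) \<le> e"
    proof -
      have intA: "integrable \<nu> (\<lambda>t. poly (A j) (complex_of_real t))" by (intro integrable_continuous continuous_intros)
      have "cmod ((\<integral>t. poly (A j) (of_real t) \<partial>\<nu>) - (\<integral>t. F t i j \<partial>\<nu>))
        = cmod (\<integral>t. poly (A j) (of_real t) - F t i j \<partial>\<nu>)"
        using intA intF by simp
      also have "\<dots> \<le> (\<integral>t. cmod (poly (A j) (of_real t) - F t i j) \<partial>\<nu>)" by (rule integral_norm_bound)
      also have "\<dots> \<le> (\<integral>t. e \<partial>\<nu>)"
      proof (rule integral_mono_AE)
        show "AE t in \<nu>. cmod (poly (A j) (of_real t) - F t i j) \<le> e"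
          using AE_supp by eventually_elim (use A[OF ij(2)] in \<open>simp add: norm_minus_commute\<close>)
      qed (use intA intF in auto)
      finally show ?thesis by (simp add: prob_space)
    qed
    moreover have "cmod (\<Sum>k<n. \<phi> (R k j * poly_d (G k - [:mone i k:]))) \<le> (\<Sum>k<n. norm (R k j) * (e * B))"
      using R_M ij e B(1) G by (intro sum_norm_le phi_poly_bound_sup) auto
    then have "cmod (\<Sum>k<n. \<phi> (R k j * poly_d (G k - [:mone i k:]))) \<le> N * (e * B)"
      by (simp add: N_def sum_distrib_right)
    ultimately have "cmod (\<phi> (R i j) - (\<integral>t. F t i j \<partial>\<nu>)) \<le> e + N * (e * B)"
      by (simp only: diff_right_commute) (smt (verit) norm_triangle_ineq4)
    then show ?thesis by (simp add: algebra_simps)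
  qed
  have "cmod (\<phi> (R i j) - (\<integral>t. F t i j \<partial>\<nu>)) \<le> 0 + e" if "e > 0" for e
  proof -
    have "N * B + 1 > 0" using N B(1) by (simp add: add_nonneg_pos)
    then show ?thesis using close[of "e / (N * B + 1)"] that by simp
  qed
  then have "cmod (\<phi> (R i j) - (\<integral>t. F t i j \<partial>\<nu>)) \<le> 0" by (rule field_le_epsilon)
  then show ?thesis by simp
qed

end

end

section \<open>Matrix inverses and linear maps in coordinates\<close>

lemma inverse_in_eq:
  fixes A B :: "nat \<Rightarrow> nat \<Rightarrow> 'a::ring_1"
  assumes "is_minv n A B" "\<And>i j. i < n \<Longrightarrow> j < n \<Longrightarrow> B i j \<in> S"
  shows "inverse_in S (fmat n A) = fmat n B"
  unfolding inverse_in_def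
proof (rule the_equality)
  let ?A = "fmat n A" and ?B = "fmat n B"
  have AB: "?A * ?B = 1\<^sub>m n" "?B * ?A = 1\<^sub>m n"
    unfolding mat_times_mmul mat_eq_one_iff using assms(1) by (simp_all add: is_minv_def)
  show "?B \<in> carrier_mat (dim_row ?A) (dim_row ?A) \<and> elements_mat ?B \<subseteq> S \<and> inverts_mat ?A ?B \<and> inverts_mat ?B ?A"
    using AB assms(2) by (auto simp: inverts_mat_def elements_mat_def)
  fix Y assume "Y \<in> carrier_mat (dim_row ?A) (dim_row ?A) \<and> elements_mat Y \<subseteq> S \<and> inverts_mat ?A Y \<and> inverts_mat Y ?A"
  then have Y: "Y \<in> carrier_mat n n" "Y * ?A = 1\<^sub>m n" by (auto simp: inverts_mat_def)
  have "Y = Y * (?A * ?B)" using Y by (simp add: AB)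
  also have "\<dots> = (Y * ?A) * ?B" using Y by (intro assoc_mult_mat[symmetric, of _ n n _ n _ n]) auto
  finally show "Y = ?B" by (simp add: Y)
qed

lemma continuous_on_det:
  fixes A :: "real \<Rightarrow> complex mat"
  assumes A: "\<And>t. A t \<in> carrier_mat n n"
    and cont: "\<And>i j. i < n \<Longrightarrow> j < n \<Longrightarrow> continuous_on UNIV (\<lambda>t. A t $$ (i, j))"
  shows "continuous_on UNIV (\<lambda>t. det (A t))"
proof -
  have "det (A t) = (\<Sum>p | p permutes {0..<n}. signof p * (\<Prod>i = 0..<n. A t $$ (i, p i)))" for t
    using A[of t] by (simp add: Determinant.det_def)
  then show ?thesis
    by (auto intro!: continuous_intros cont)
qed

lemma mat_inv_eq_adj_mat:
  fixes A :: "complex mat"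
  assumes A: "A \<in> carrier_mat n n" and det: "det A \<noteq> 0"
  shows "mat_inv A = inverse (det A) \<cdot>\<^sub>m adj_mat A"
  unfolding inverse_in_def
proof (rule the_equality)
  let ?C = "inverse (det A) \<cdot>\<^sub>m adj_mat A"
  note C = inverse_by_adj_mat[OF A det]
  then show "?C \<in> carrier_mat (dim_row A) (dim_row A) \<and> elements_mat ?C \<subseteq> UNIV \<and> inverts_mat A ?C \<and> inverts_mat ?C A"
    using A by (auto simp: inverts_mat_def)
  fix Y assume "Y \<in> carrier_mat (dim_row A) (dim_row A) \<and> elements_mat Y \<subseteq> UNIV \<and> inverts_mat A Y \<and> inverts_mat Y A"
  then have Y: "Y \<in> carrier_mat n n" "Y * A = 1\<^sub>m n" using A by (auto simp: inverts_mat_def)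
  have "Y = Y * (A * ?C)" using Y C by simp
  also have "\<dots> = (Y * A) * ?C" using Y C A by (intro assoc_mult_mat[symmetric, of _ n n _ n _ n]) auto
  finally show "Y = ?C" unfolding Y(2) left_mult_one_mat[OF C(1)] .
qed

text \<open>The determinant is a polynomial in \<open>t\<close>.\<close>

lemma finite_singular_parameters:
  fixes w g :: "complex mat"
  assumes w: "w \<in> carrier_mat n n" and g: "g \<in> carrier_mat n n"
    and nz: "det (w - complex_of_real t0 \<cdot>\<^sub>m g) \<noteq> 0"
  shows "finite {t. det (w - complex_of_real t \<cdot>\<^sub>m g) = 0}"
proof -
  define p where "p = (\<Sum>\<pi> | \<pi> permutes {0..<n}. [:signof \<pi>:] * (\<Prod>i = 0..<n. [:w $$ (i, \<pi> i), - g $$ (i, \<pi> i):]))"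
  have p: "poly p (of_real t) = det (w - complex_of_real t \<cdot>\<^sub>m g)" for t
  proof -
    have "w - complex_of_real t \<cdot>\<^sub>m g \<in> carrier_mat n n" using w g by (auto intro!: minus_carrier_mat)
    moreover have "(w - complex_of_real t \<cdot>\<^sub>m g) $$ (i, \<pi> i) = w $$ (i, \<pi> i) - of_real t * g $$ (i, \<pi> i)"
      if "\<pi> permutes {0..<n}" "i \<in> {0..<n}" for \<pi> i
      using w g permutes_in_image[OF that(1), of i] that(2) by auto
    ultimately show ?thesis using w g unfolding p_def poly_sum
      by (auto simp: Determinant.det_def poly_prod intro!: sum.cong prod.cong)
  qed
  have "p \<noteq> 0" using p[of t0] nz by auto
  then have "finite (complex_of_real -` {x. poly p x = 0})"
    by (intro finite_vimageI poly_roots_finite inj_of_real)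
  then show ?thesis by (rule finite_subset[rotated]) (auto simp: p)
qed

text \<open>Where the matrix is invertible the entries are given by the adjugate. Elsewhere no matrix satisfies the
  description that defines \<open>mat_inv\<close>, so its value is one and the same arbitrary element for all such \<open>t\<close>.\<close>

lemma mat_inv_measurable:
  fixes w g :: "complex mat"
  assumes w: "w \<in> carrier_mat n n" and g: "g \<in> carrier_mat n n" and ij: "i < n" "j < n"
  shows "(\<lambda>t. mat_inv (w - complex_of_real t \<cdot>\<^sub>m g) $$ (i, j)) \<in> borel_measurable borel"
proof -
  define A where "A t = w - complex_of_real t \<cdot>\<^sub>m g" for t
  have A: "A t \<in> carrier_mat n n" for t using w g by (auto simp: A_def intro!: minus_carrier_mat)
  have cont: "continuous_on UNIV (\<lambda>t. A t $$ (i, j))" if "i < n" "j < n" for i j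
  proof -
    have "A t $$ (i, j) = w $$ (i, j) - complex_of_real t * g $$ (i, j)" for t
      using w g that by (simp add: A_def)
    then show ?thesis by (auto intro!: continuous_intros)
  qed
  have inv1: "mat_inv (A t) = inverse (det (A t)) \<cdot>\<^sub>m adj_mat (A t)" if "det (A t) \<noteq> 0" for t
    by (rule mat_inv_eq_adj_mat[OF A that])
  have inv0: "mat_inv (A t) = (THE Y. False)" if "det (A t) = 0" for t
  proof -
    have "\<not> (Y \<in> carrier_mat (dim_row (A t)) (dim_row (A t)) \<and> elements_mat Y \<subseteq> UNIV \<and> inverts_mat (A t) Y \<and> inverts_mat Y (A t))" for Y
    proof
      assume "Y \<in> carrier_mat (dim_row (A t)) (dim_row (A t)) \<and> elements_mat Y \<subseteq> UNIV \<and> inverts_mat (A t) Y \<and> inverts_mat Y (A t)"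
      then have Y: "Y \<in> carrier_mat n n" "A t * Y = 1\<^sub>m n" using A[of t] by (auto simp: inverts_mat_def)
      have "det (A t) * det Y = 1" using det_mult[OF A[of t] Y(1)] Y(2) by simp
      then show False using that by simp
    qed
    then show ?thesis unfolding inverse_in_def by (intro arg_cong[where f = The] ext) blast
  qed
  have contdet: "continuous_on UNIV (\<lambda>t. det (A t))" by (rule continuous_on_det[OF A cont])
  have contadj: "continuous_on UNIV (\<lambda>t. adj_mat (A t) $$ (i, j))"
  proof -
    have "adj_mat (A t) $$ (i, j) = (- 1) ^ (j + i) * det (mat_delete (A t) j i)" for t
      using A[of t] ij by (simp add: adj_mat_def cofactor_def)
    moreover have "continuous_on UNIV (\<lambda>t. det (mat_delete (A t) j i))"
    proof (rule continuous_on_det[of _ "n - 1"])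
      show "mat_delete (A t) j i \<in> carrier_mat (n - 1) (n - 1)" for t using A[of t] by (rule mat_delete_carrier)
      fix k l assume kl: "k < n - 1" "l < n - 1"
      have "mat_delete (A t) j i $$ (k, l) = A t $$ (if k < j then k else Suc k, if l < i then l else Suc l)" for t
        using A[of t] kl by (simp add: mat_delete_def)
      then show "continuous_on UNIV (\<lambda>t. mat_delete (A t) j i $$ (k, l))" using kl by (auto intro!: cont)
    qed
    ultimately show ?thesis by (auto intro!: continuous_intros)
  qed
  have "mat_inv (A t) $$ (i, j) = (if det (A t) = 0 then (THE Y. False) $$ (i, j) else inverse (det (A t)) * adj_mat (A t) $$ (i, j))" for t
    using inv0[of t] inv1[of t] adj_mat(1)[OF A[of t]] ij by simp
  moreover have [measurable]: "(\<lambda>t. det (A t)) \<in> borel_measurable borel" "(\<lambda>t. adj_mat (A t) $$ (i, j)) \<in> borel_measurable borel"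
    using contdet contadj by (auto intro: borel_measurable_continuous_onI)
  ultimately show ?thesis unfolding A_def[symmetric] by simp
qed

lemma sum_product_index: "(\<Sum>a<m * n. f a) = (\<Sum>k<m. \<Sum>r<n. f (k * n + r :: nat))"
proof (cases "n = 0")
  case False
  have "(\<Sum>k<m. \<Sum>r<n. f (k * n + r)) = (\<Sum>(k, r)\<in>{..<m} \<times> {..<n}. f (k * n + r))"
    by (rule sum.cartesian_product)
  also have "\<dots> = (\<Sum>a<m * n. f a)"
  proof (rule sum.reindex_bij_witness[of _ "\<lambda>a. (a div n, a mod n)" "\<lambda>(k, r). k * n + r"])
    fix x assume "x \<in> {..<m} \<times> {..<n}"
    then obtain k r where x: "x = (k, r)" "k < m" "r < n" by auto
    have "k * n + r < Suc k * n" using x by simp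
    also have "\<dots> \<le> m * n" using x by (intro mult_le_mono1) simp
    finally show "(case x of (k, r) \<Rightarrow> k * n + r) \<in> {..<m * n}" using x by simp
    show "(\<lambda>a. (a div n, a mod n)) (case x of (k, r) \<Rightarrow> k * n + r) = x" using x by simp
  next
    fix a assume "a \<in> {..<m * n}"
    then show "(\<lambda>a. (a div n, a mod n)) a \<in> {..<m} \<times> {..<n}"
      using False by (simp add: less_mult_imp_div_less)
  qed auto
  finally show ?thesis by simp
qed simp

lemma product_index_less: "k < m \<Longrightarrow> r < n \<Longrightarrow> k * n + r < m * (n::nat)"
  by (rule less_le_trans[OF _ mult_le_mono1[of "Suc k" m n]]) simp_all

text \<open>A linear map of \<open>N \<times> N\<close> matrices is a square matrix of size \<open>N\<^sup>2\<close>, with the pair \<open>(i, j)\<close> numbered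
  \<open>i N + j\<close>.\<close>

lemma linear_map_bij:
  fixes c :: "nat \<Rightarrow> nat \<Rightarrow> nat \<Rightarrow> nat \<Rightarrow> complex"
  assumes G: "\<And>x i j. x \<in> carrier_mat N N \<Longrightarrow> i < N \<Longrightarrow> j < N \<Longrightarrow>
      G x $$ (i, j) = (\<Sum>k<N. \<Sum>l<N. c i j k l * x $$ (k, l))"
    and Gc: "\<And>x. x \<in> carrier_mat N N \<Longrightarrow> G x \<in> carrier_mat N N"
    and ker: "\<And>x. x \<in> carrier_mat N N \<Longrightarrow> G x = 0\<^sub>m N N \<Longrightarrow> x = 0\<^sub>m N N"
  shows "bij_betw G (carrier_mat N N) (carrier_mat N N)"
proof -
  define A where "A = Matrix.mat (N * N) (N * N) (\<lambda>(p, q). c (p div N) (p mod N) (q div N) (q mod N))"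
  define V where "V x = Matrix.vec (N * N) (\<lambda>q. x $$ (q div N, q mod N) :: complex)" for x
  define U where "U v = Matrix.mat N N (\<lambda>(i, j). v $ (i * N + j) :: complex)" for v
  have A: "A \<in> carrier_mat (N * N) (N * N)" by (simp add: A_def)
  have dm: "p div N < N" "p mod N < N" if "p < N * N" for p
    using that by (auto simp: less_mult_imp_div_less) (metis gr_implies_not0 mod_less_divisor mult_eq_0_iff neq0_conv)
  note idx = product_index_less[where m = N and n = N]
  have VU: "V (U v) = v" if "v \<in> carrier_vec (N * N)" for v
    using that dm by (auto simp: V_def U_def)
  have UV: "U (V x) = x" if "x \<in> carrier_mat N N" for x
    using that idx by (auto simp: V_def U_def intro!: eq_matI)
  have AV: "A *\<^sub>v V x = V (G x)" if x: "x \<in> carrier_mat N N" for x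
  proof (rule eq_vecI)
    fix p assume "p < dim_vec (V (G x))"
    then have p: "p < N * N" by (simp add: V_def)
    have "(A *\<^sub>v V x) $ p = (\<Sum>q<N * N. c (p div N) (p mod N) (q div N) (q mod N) * x $$ (q div N, q mod N))"
      using p by (simp add: A_def V_def scalar_prod_def atLeast0LessThan)
    also have "\<dots> = (\<Sum>k<N. \<Sum>l<N. c (p div N) (p mod N) k l * x $$ (k, l))"
      unfolding sum_product_index by (intro sum.cong refl) simp
    also have "\<dots> = V (G x) $ p" using p dm[OF p] x by (simp add: V_def G)
    finally show "(A *\<^sub>v V x) $ p = V (G x) $ p" .
  qed (simp add: A_def V_def)
  have "det A \<noteq> 0"
  proof
    assume "det A = 0"
    then obtain v where v: "v \<in> carrier_vec (N * N)" "v \<noteq> 0\<^sub>v (N * N)" "A *\<^sub>v v = 0\<^sub>v (N * N)"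
      using det_0_iff_vec_prod_zero_field[OF A] by blast
    have Uc: "U v \<in> carrier_mat N N" by (simp add: U_def)
    have "V (G (U v)) = 0\<^sub>v (N * N)" using AV[OF Uc] VU[OF v(1)] v(3) by simp
    then have "U (V (G (U v))) = U (0\<^sub>v (N * N))" by simp
    moreover have "U (0\<^sub>v (N * N)) = 0\<^sub>m N N" using idx by (auto simp: U_def intro!: eq_matI)
    ultimately have "G (U v) = 0\<^sub>m N N" using UV[OF Gc[OF Uc]] by simp
    then have "U v = 0\<^sub>m N N" by (rule ker[OF Uc])
    then have "V (U v) = V (0\<^sub>m N N)" by simp
    then have "v = 0\<^sub>v (N * N)" using VU[OF v(1)] dm by (auto simp: V_def)
    then show False using v by simp
  qed
  define C where "C = inverse (det A) \<cdot>\<^sub>m adj_mat A"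
  note C = inverse_by_adj_mat[OF A \<open>det A \<noteq> 0\<close>, folded C_def]
  have Vc: "V x \<in> carrier_vec (N * N)" for x by (simp add: V_def)
  show ?thesis
  proof (rule bij_betw_byWitness[where f'="\<lambda>y. U (C *\<^sub>v V y)"])
    show "\<forall>x\<in>carrier_mat N N. U (C *\<^sub>v V (G x)) = x"
    proof
      fix x :: "complex mat" assume x: "x \<in> carrier_mat N N"
      have "C *\<^sub>v V (G x) = (C * A) *\<^sub>v V x"
        unfolding AV[OF x, symmetric] by (rule assoc_mult_mat_vec[symmetric, OF C(1) A Vc])
      then show "U (C *\<^sub>v V (G x)) = x" using UV[OF x] by (simp add: C Vc)
    qed
    show "\<forall>y\<in>carrier_mat N N. G (U (C *\<^sub>v V y)) = y"
    proof
      fix y :: "complex mat" assume y: "y \<in> carrier_mat N N"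
      have Uc: "U (C *\<^sub>v V y) \<in> carrier_mat N N" by (simp add: U_def)
      have "V (G (U (C *\<^sub>v V y))) = A *\<^sub>v (C *\<^sub>v V y)"
        using AV[OF Uc] VU[of "C *\<^sub>v V y"] mult_mat_vec_carrier[OF C(1) Vc, of y] by simp
      also have "\<dots> = (A * C) *\<^sub>v V y" by (rule assoc_mult_mat_vec[symmetric, OF A C(1) Vc])
      finally have "V (G (U (C *\<^sub>v V y))) = V y" by (simp add: C Vc)
      then have "U (V (G (U (C *\<^sub>v V y)))) = U (V y)" by simp
      then show "G (U (C *\<^sub>v V y)) = y" using UV[OF y] UV[OF Gc[OF Uc]] by simp
    qed
    show "G ` carrier_mat N N \<subseteq> carrier_mat N N" using Gc by auto
    show "(\<lambda>y. U (C *\<^sub>v V y)) ` carrier_mat N N \<subseteq> carrier_mat N N" by (auto simp: U_def)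
  qed
qed

lemma kron_one_left:
  assumes "P \<in> carrier_mat m m" "i < m * m" "a < m * m"
  shows "kron P (1\<^sub>m m) $$ (i, a) = (if i mod m = a mod m then P $$ (i div m, a div m) else 0)"
    "kron (1\<^sub>m m) P $$ (i, a) = (if i div m = a div m then P $$ (i mod m, a mod m) else 0)"
proof -
  have m: "m > 0" using assms(2) by (cases m) auto
  have "i div m < m" "a div m < m" using assms by (simp_all add: less_mult_imp_div_less)
  then show "kron P (1\<^sub>m m) $$ (i, a) = (if i mod m = a mod m then P $$ (i div m, a div m) else 0)"
    "kron (1\<^sub>m m) P $$ (i, a) = (if i div m = a div m then P $$ (i mod m, a mod m) else 0)"
    using assms m by (auto simp: kron_def)
qed

lemma mult_mat_entry:
  assumes "A \<in> carrier_mat r n" "B \<in> carrier_mat n c" "i < r" "j < c"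
  shows "(A * B) $$ (i, j) = (\<Sum>k<n. A $$ (i, k) * B $$ (k, j))"
  using assms by (simp add: scalar_prod_def atLeast0LessThan)

lemma kron_sandwich:
  assumes P: "P \<in> carrier_mat m m" and S: "S \<in> carrier_mat m m"
    and x: "x \<in> carrier_mat (m * m) (m * m)" and ij: "i < m * m" "j < m * m"
  shows "(kron P (1\<^sub>m m) * x * kron (1\<^sub>m m) S) $$ (i, j)
    = (\<Sum>k<m. \<Sum>l<m. P $$ (i div m, k) * x $$ (k * m + i mod m, (j div m) * m + l) * S $$ (l, j mod m))"
proof -
  have m: "m > 0" using ij by (cases m) auto
  have dm: "i mod m < m" "j div m < m" using m ij by (simp_all add: less_mult_imp_div_less)
  note idx = product_index_less[where m = m and n = m]
  have K: "kron P (1\<^sub>m m) \<in> carrier_mat (m * m) (m * m)" "kron (1\<^sub>m m) S \<in> carrier_mat (m * m) (m * m)"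
    using P S by (auto simp: kron_def)
  have left: "(kron P (1\<^sub>m m) * x) $$ (i, c) = (\<Sum>k<m. P $$ (i div m, k) * x $$ (k * m + i mod m, c))"
    if c: "c < m * m" for c
  proof -
    have "(kron P (1\<^sub>m m) * x) $$ (i, c) = (\<Sum>a<m * m. kron P (1\<^sub>m m) $$ (i, a) * x $$ (a, c))"
      by (rule mult_mat_entry[OF K(1) x ij(1) c])
    also have "\<dots> = (\<Sum>k<m. \<Sum>r<m. if r = i mod m then P $$ (i div m, k) * x $$ (k * m + r, c) else 0)"
      unfolding sum_product_index
      by (intro sum.cong refl) (use ij idx in \<open>simp add: kron_one_left[OF P]\<close>)
    finally show ?thesis using dm(1) by simp
  qed
  have "(kron P (1\<^sub>m m) * x * kron (1\<^sub>m m) S) $$ (i, j)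
    = (\<Sum>c<m * m. (kron P (1\<^sub>m m) * x) $$ (i, c) * kron (1\<^sub>m m) S $$ (c, j))"
    by (rule mult_mat_entry[OF mult_carrier_mat[OF K(1) x] K(2) ij])
  also have "\<dots> = (\<Sum>k'<m. \<Sum>l<m. if k' = j div m then (kron P (1\<^sub>m m) * x) $$ (i, k' * m + l) * S $$ (l, j mod m) else 0)"
    unfolding sum_product_index
    by (intro sum.cong refl) (use ij idx in \<open>simp add: kron_one_left[OF S]\<close>)
  also have "\<dots> = (\<Sum>k'<m. if k' = j div m then (\<Sum>l<m. (kron P (1\<^sub>m m) * x) $$ (i, k' * m + l) * S $$ (l, j mod m)) else 0)"
    by (intro sum.cong refl) simp
  also have "\<dots> = (\<Sum>l<m. (kron P (1\<^sub>m m) * x) $$ (i, (j div m) * m + l) * S $$ (l, j mod m))"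
    using dm(2) by simp
  also have "\<dots> = (\<Sum>l<m. \<Sum>k<m. P $$ (i div m, k) * x $$ (k * m + i mod m, (j div m) * m + l) * S $$ (l, j mod m))"
    using left idx[OF dm(2)] by (intro sum.cong refl) (simp add: sum_distrib_right)
  finally show ?thesis by (subst sum.swap) simp
qed

section \<open>Bilinear forms\<close>

definition bil :: "nat \<Rightarrow> (nat \<Rightarrow> complex) \<Rightarrow> (nat \<Rightarrow> nat \<Rightarrow> complex) \<Rightarrow> (nat \<Rightarrow> complex) \<Rightarrow> complex" where
  "bil n x A y = (\<Sum>i<n. \<Sum>j<n. x i * A i j * y j)"

definition row_mult :: "nat \<Rightarrow> (nat \<Rightarrow> complex) \<Rightarrow> (nat \<Rightarrow> nat \<Rightarrow> complex) \<Rightarrow> nat \<Rightarrow> complex" where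
  "row_mult n x A j = (\<Sum>i<n. x i * A i j)"

definition col_mult :: "nat \<Rightarrow> (nat \<Rightarrow> nat \<Rightarrow> complex) \<Rightarrow> (nat \<Rightarrow> complex) \<Rightarrow> nat \<Rightarrow> complex" where
  "col_mult n A y i = (\<Sum>j<n. A i j * y j)"

lemma bil_cong:
  assumes "\<And>i. i < n \<Longrightarrow> x i = x' i" "\<And>i j. i < n \<Longrightarrow> j < n \<Longrightarrow> A i j = A' i j" "\<And>i. i < n \<Longrightarrow> y i = y' i"
  shows "bil n x A y = bil n x' A' y'"
  unfolding bil_def using assms by (intro sum.cong) auto

lemma bil_mmul_left: "bil n x (mmul n A B) y = bil n (row_mult n x A) B y"
proof -
  have "bil n x (mmul n A B) y = (\<Sum>i<n. \<Sum>j<n. \<Sum>k<n. x i * A i k * B k j * y j)"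
    by (simp add: bil_def mmul_def sum_distrib_left sum_distrib_right mult.assoc)
  also have "\<dots> = (\<Sum>i<n. \<Sum>k<n. \<Sum>j<n. x i * A i k * B k j * y j)" by (intro sum.cong refl sum.swap)
  also have "\<dots> = (\<Sum>k<n. \<Sum>i<n. \<Sum>j<n. x i * A i k * B k j * y j)" by (rule sum.swap)
  also have "\<dots> = (\<Sum>k<n. \<Sum>j<n. \<Sum>i<n. x i * A i k * B k j * y j)" by (intro sum.cong refl sum.swap)
  finally show ?thesis by (simp add: bil_def row_mult_def sum_distrib_right)
qed

lemma bil_mmul_right: "bil n x (mmul n A B) y = bil n x A (col_mult n B y)"
proof -
  have "bil n x (mmul n A B) y = (\<Sum>i<n. \<Sum>j<n. \<Sum>k<n. x i * A i k * B k j * y j)"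
    by (simp add: bil_def mmul_def sum_distrib_left sum_distrib_right mult.assoc)
  also have "\<dots> = (\<Sum>i<n. \<Sum>k<n. \<Sum>j<n. x i * A i k * B k j * y j)" by (intro sum.cong refl sum.swap)
  finally show ?thesis by (simp add: bil_def col_mult_def sum_distrib_left mult.assoc)
qed

lemma bil_sandwich: "bil n x (mmul n A (mmul n B C)) y = bil n (row_mult n x A) B (col_mult n C y)"
  by (rule trans[OF bil_mmul_left bil_mmul_right])

lemma bil_integral:
  assumes "\<And>i j. i < n \<Longrightarrow> j < n \<Longrightarrow> integrable M (\<lambda>t. A t i j)"
  shows "integrable M (\<lambda>t. bil n x (A t) y)" "(\<integral>t. bil n x (A t) y \<partial>M) = bil n x (\<lambda>i j. \<integral>t. A t i j \<partial>M) y"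
proof -
  show "integrable M (\<lambda>t. bil n x (A t) y)" unfolding bil_def
    by (intro Bochner_Integration.integrable_sum integrable_mult_left integrable_mult_right) (use assms in auto)
  have "(\<integral>t. bil n x (A t) y \<partial>M) = (\<Sum>i<n. \<integral>t. (\<Sum>j<n. x i * A t i j * y j) \<partial>M)"
    unfolding bil_def by (rule Bochner_Integration.integral_sum) (use assms in auto)
  also have "\<dots> = (\<Sum>i<n. \<Sum>j<n. \<integral>t. x i * A t i j * y j \<partial>M)"
    by (intro sum.cong refl Bochner_Integration.integral_sum) (use assms in auto)
  also have "\<dots> = bil n x (\<lambda>i j. \<integral>t. A t i j \<partial>M) y"
    unfolding bil_def by (intro sum.cong refl) simp
  finally show "(\<integral>t. bil n x (A t) y \<partial>M) = bil n x (\<lambda>i j. \<integral>t. A t i j \<partial>M) y" .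
qed

lemma bil_mone: "bil n x mone y = (\<Sum>i<n. x i * y i)"
proof -
  have "bil n x mone y = (\<Sum>i<n. x i * (\<Sum>j<n. mone i j * y j))"
    by (simp add: bil_def sum_distrib_left mult.assoc)
  also have "\<dots> = (\<Sum>i<n. x i * y i)" by (intro sum.cong refl) (simp only: sum_mone_left lessThan_iff)
  finally show ?thesis .
qed

lemma bil_add: "bil n x (\<lambda>i j. A i j + c * B i j) y = bil n x A y + c * bil n x B y"
  by (simp add: bil_def sum.distrib sum_distrib_left algebra_simps)

lemma norm_bil_le:
  "cmod (bil n x A y) \<le> (\<Sum>i<n. \<Sum>j<n. cmod (A i j)) * ((\<Sum>i<n. (cmod (x i))\<^sup>2) + (\<Sum>i<n. (cmod (y i))\<^sup>2))"
  unfolding bil_def sum_distrib_right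
proof (intro sum_norm_le)
  fix i j assume "i \<in> {..<n}" "j \<in> {..<n}"
  then have "(cmod (x i))\<^sup>2 \<le> (\<Sum>i<n. (cmod (x i))\<^sup>2)" "(cmod (y j))\<^sup>2 \<le> (\<Sum>i<n. (cmod (y i))\<^sup>2)"
    by (auto intro!: member_le_sum)
  moreover have "2 * (cmod (x i) * cmod (y j)) \<le> (cmod (x i))\<^sup>2 + (cmod (y j))\<^sup>2"
    using sum_squares_bound[of "cmod (x i)" "cmod (y j)"] by simp
  moreover have "0 \<le> cmod (x i) * cmod (y j)" by simp
  ultimately have "cmod (x i) * cmod (y j) \<le> (\<Sum>i<n. (cmod (x i))\<^sup>2) + (\<Sum>i<n. (cmod (y i))\<^sup>2)" by linarith
  from mult_left_mono[OF this, of "cmod (A i j)"]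
  show "cmod (x i * A i j * y j) \<le> cmod (A i j) * ((\<Sum>i<n. (cmod (x i))\<^sup>2) + (\<Sum>i<n. (cmod (y i))\<^sup>2))"
    by (simp add: norm_mult mult_ac)
qed

lemma bil_entry:
  assumes "i < n" "j < n"
  shows "bil n (mone i) A (\<lambda>k. mone k j) = A i j"
proof -
  have "bil n (mone i) A (\<lambda>k. mone k j) = (\<Sum>k<n. mone i k * (\<Sum>l<n. A k l * mone l j))"
    by (simp add: bil_def sum_distrib_left mult.assoc)
  then show ?thesis using assms by (simp only: sum_mone_left sum_mone_right)
qed

section \<open>The contraction estimate\<close>

context free_semicircular_perturbation
begin

lemma Schwinger_Dyson_corner:
  assumes "Schwinger_Dyson_matrix (n + n) (tri n g1 (\<lambda>i j. 0) g1) (tri n R1 E R2)"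
  shows "Schwinger_Dyson_matrix n g1 R1"
  unfolding Schwinger_Dyson_matrix_def
proof (intro conjI allI impI)
  show "R1 i j \<in> M" if "i < n" "j < n" for i j
    using assms that unfolding Schwinger_Dyson_matrix_def by (metis tri_simps(1) trans_less_add1)
  fix i j x assume ij: "i < n" "j < n" and x: "spanned x (\<lambda>p q. 0)"
  have "i < n + n" "j < n + n" using ij by auto
  then have "\<phi> (s * (tri n R1 E R2 i j * x)) = of_real (\<sigma>\<^sup>2) *
      (\<Sum>u<n + n. \<Sum>v<n + n. \<phi> (tri n R1 E R2 i u) * tri n g1 (\<lambda>i j. 0) g1 u v * \<phi> (tri n R1 E R2 v j * x))"
    using assms x unfolding Schwinger_Dyson_matrix_def by blast
  then show "\<phi> (s * (R1 i j * x)) = of_real (\<sigma>\<^sup>2) * (\<Sum>u<n. \<Sum>v<n. \<phi> (R1 i u) * g1 u v * \<phi> (R1 v j * x))"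
    using ij by (simp add: sum_split_block)
qed

text \<open>The upper right block of \<open>\<omega>\<close> for a triangular block resolvent is, up to the sign, the matrix
  \<open>e + \<sigma>\<^sup>2 \<gamma>\<^sub>1 \<phi>(E) \<gamma>\<^sub>1\<close>. With \<open>e = 1\<close> and \<open>E = R R\<^sup>*\<close> this is \<open>potential\<close>.\<close>

lemma subord_tri:
  assumes "i < n + n" "k < n + n"
  shows "subord (n + n) (tri n b1 (\<lambda>i j. - e i j) b2) (tri n g1 (\<lambda>i j. 0) g1) (tri n R1 E R2) i k
    = tri n (subord n b1 g1 R1)
        (\<lambda>i j. - (e i j + of_real (\<sigma>\<^sup>2) * mmul n g1 (mmul n (\<lambda>k l. \<phi> (E k l)) g1) i j)) (subord n b2 g1 R2) i k"
proof -
  have "mmul n g1 (mmul n (\<lambda>k l. \<phi> (E k l)) g1) i j = (\<Sum>k<n. \<Sum>u<n. g1 i k * \<phi> (E k u) * g1 u j)" for i j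
    unfolding mmul_def by (simp add: sum_distrib_left mult.assoc)
  then show ?thesis using assms by (elim block_cases) (simp_all add: subord_def sum_split_block)
qed

end

text \<open>A selfadjoint matrix \<open>X = \<gamma>\<^sub>0 + \<gamma>\<^sub>1 s + \<gamma>\<^sub>2 d\<close> of size \<open>K + 1\<close> with the properties of a canonical linearization.\<close>

locale hermitian_pencil = free_semicircular_perturbation M \<phi> s d \<sigma> \<nu>
  for M :: "'h::complex_hilbert_space bop set" and \<phi> s d \<sigma> \<nu> +
  fixes K :: nat and g0 g1 g2 :: "nat \<Rightarrow> nat \<Rightarrow> complex" and X :: "nat \<Rightarrow> nat \<Rightarrow> 'h bop"
  assumes X: "\<And>i j. i < Suc K \<Longrightarrow> j < Suc K \<Longrightarrow> X i j = g0 i j *\<^sub>C 1 + g1 i j *\<^sub>C s + g2 i j *\<^sub>C d"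
    and X_herm: "\<And>i j. i < Suc K \<Longrightarrow> j < Suc K \<Longrightarrow> is_adjoint (X i j) (X j i)"
    and X00: "X 0 0 = 0"
    and corner: "bounded_below K (\<lambda>i j. X (Suc i) (Suc j))"
    and g0_herm: "\<And>i j. i < Suc K \<Longrightarrow> j < Suc K \<Longrightarrow> g0 j i = cnj (g0 i j)"
    and g1_herm: "\<And>i j. i < Suc K \<Longrightarrow> j < Suc K \<Longrightarrow> g1 j i = cnj (g1 i j)"
    and g2_herm: "\<And>i j. i < Suc K \<Longrightarrow> j < Suc K \<Longrightarrow> g2 j i = cnj (g2 i j)"
begin

abbreviation (input) "n \<equiv> Suc K"

definition base :: "complex \<Rightarrow> nat \<Rightarrow> nat \<Rightarrow> complex" where
  "base z i j = (if i = 0 \<and> j = 0 then z else 0) - g0 i j"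

definition resolvent :: "complex \<Rightarrow> nat \<Rightarrow> nat \<Rightarrow> 'h bop" where
  "resolvent z = (SOME R. is_minv n (pencil X z) R)"

lemma pencil_base:
  "i < n \<Longrightarrow> j < n \<Longrightarrow> pencil X z i j = base z i j *\<^sub>C 1 - g1 i j *\<^sub>C s - g2 i j *\<^sub>C d"
  unfolding pencil_def base_def by (simp add: X scaleC_bop_simps algebra_simps)

lemma sgn_Im: "Im z \<noteq> 0 \<Longrightarrow> sgn (Im z) = 1 \<or> sgn (Im z) = -1"
  by (auto simp: sgn_if)

lemma pencil_accretive: "0 \<le> sgn (Im z) * Im (\<Sum>i<n. cinner (mv n (pencil X z) v i) (v i))"
  by (subst Im_pencil_form[OF X_herm X00 corner]) (auto simp: sgn_if mult_nonpos_nonneg)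

lemma pencil_bound:
  "Im z \<noteq> 0 \<Longrightarrow> \<exists>D>0. \<forall>v. nrm2 n v \<le> D\<^sup>2 * nrm2 n (mv n (pencil X z) v)"
  by (rule pencil_lower_bound[OF X_herm X00 corner])

lemma resolvent_inverse_pencil: assumes "Im z \<noteq> 0" shows "is_minv n (pencil X z) (resolvent z)"
proof -
  obtain D where D: "D > 0" "\<And>v. nrm2 n v \<le> D\<^sup>2 * nrm2 n (mv n (pencil X z) v)"
    using pencil_bound[OF assms] by blast
  have "\<exists>R. is_minv n (pencil X z) R"
    by (rule boundary_resolvent[OF D(1) sgn_Im[OF assms] D(2) pencil_accretive])
  then show ?thesis unfolding resolvent_def by (rule someI_ex)
qed

lemma resolvent_inverse:
  "Im z \<noteq> 0 \<Longrightarrow> is_minv n (\<lambda>i j. base z i j *\<^sub>C 1 - g1 i j *\<^sub>C s - g2 i j *\<^sub>C d) (resolvent z)"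
  by (rule is_minv_cong[OF resolvent_inverse_pencil]) (simp_all add: pencil_base)

abbreviation (input) pair :: "complex \<Rightarrow> nat \<Rightarrow> nat \<Rightarrow> 'h bop" where
  "pair z \<equiv> mmul n (resolvent z) (resolvent (cnj z))"

lemma resolvent_Schwinger_Dyson_pair:
  assumes z: "Im z \<noteq> 0"
  shows "Schwinger_Dyson_matrix (n + n) (tri n g1 (\<lambda>i j. 0) g1) (tri n (resolvent z) (pair z) (resolvent (cnj z)))"
proof -
  have z': "Im (cnj z) \<noteq> 0" using z by simp
  obtain D1 where D1: "D1 > 0" "\<And>v. nrm2 n v \<le> D1\<^sup>2 * nrm2 n (mv n (pencil X z) v)"
    using pencil_bound[OF z] by blast
  obtain D2 where D2: "D2 > 0" "\<And>v. nrm2 n v \<le> D2\<^sup>2 * nrm2 n (mv n (pencil X (cnj z)) v)"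
    using pencil_bound[OF z'] by blast
  define D where "D = max D1 D2"
  have "D1\<^sup>2 \<le> D\<^sup>2" "D2\<^sup>2 \<le> D\<^sup>2" using D1(1) D2(1) by (auto simp: D_def intro!: power_mono)
  then have l: "nrm2 n v \<le> D\<^sup>2 * nrm2 n (mv n (pencil X z) v)" "nrm2 n v \<le> D\<^sup>2 * nrm2 n (mv n (pencil X (cnj z)) v)" for v
    using order_trans[OF D1(2) mult_right_mono] order_trans[OF D2(2) mult_right_mono] by auto
  have "D > 0" using D1(1) by (simp add: D_def)
  moreover have "0 \<le> - sgn (Im z) * Im (\<Sum>i<n. cinner (mv n (pencil X (cnj z)) v i) (v i))" for v
    using pencil_accretive[of "cnj z" v] by (simp add: sgn_minus del: sum.lessThan_Suc)
  ultimately show ?thesis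
    by (intro Schwinger_Dyson_pair[OF pencil_base pencil_base _ sgn_Im[OF z] l pencil_accretive _
          resolvent_inverse_pencil[OF z] resolvent_inverse_pencil[OF z']])
qed

lemma resolvent_Schwinger_Dyson: "Im z \<noteq> 0 \<Longrightarrow> Schwinger_Dyson_matrix n g1 (resolvent z)"
  using Schwinger_Dyson_corner[OF resolvent_Schwinger_Dyson_pair] .

lemma resolvent_M: "Im z \<noteq> 0 \<Longrightarrow> i < n \<Longrightarrow> j < n \<Longrightarrow> resolvent z i j \<in> M"
  using resolvent_Schwinger_Dyson[of z] unfolding Schwinger_Dyson_matrix_def by blast

text \<open>The adjoint of the resolvent at \<open>z\<close> inverts the adjoint pencil, which is the pencil at \<open>cnj z\<close>.\<close>

lemma resolvent_adjoint:
  assumes z: "Im z \<noteq> 0" and ij: "i < n" "j < n"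
  shows "is_adjoint (resolvent z i j) (resolvent (cnj z) j i)"
proof -
  have z': "Im (cnj z) \<noteq> 0" using z by simp
  define R' where "R' j i = (SOME b. b \<in> M \<and> is_adjoint (resolvent z i j) b)" for i j
  have R': "is_adjoint (resolvent z i j) (R' j i)" if "i < n" "j < n" for i j
    using someI_ex[OF M_adjoint[OF resolvent_M[OF z that], unfolded Bex_def]] by (simp add: R'_def)
  have P: "is_adjoint (pencil X z i j) (pencil X (cnj z) j i)" if "i < n" "j < n" for i j
  proof -
    have "is_adjoint ((if i = 0 \<and> j = 0 then z else 0) *\<^sub>C 1 :: 'h bop) ((if j = 0 \<and> i = 0 then cnj z else 0) *\<^sub>C 1)"
      by (auto simp: scaleC_bop_simps is_adjoint_zero intro: is_adjoint_scaleC[OF is_adjoint_one])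
    then show ?thesis unfolding pencil_def using that by (intro is_adjoint_diff X_herm)
  qed
  have m: "is_adjoint (mone i j) (mone j i :: 'h bop)" for i j
    by (simp add: mone_def is_adjoint_one is_adjoint_zero)
  have "is_minv n (pencil X (cnj z)) R'" unfolding is_minv_def
  proof (intro allI impI conjI)
    fix i j assume ij: "i < n" "j < n"
    have "is_adjoint (mmul n (resolvent z) (pencil X z) j i) (mmul n (pencil X (cnj z)) R' i j)"
      unfolding mmul_def using ij by (intro is_adjoint_sum is_adjoint_mult R' P) auto
    then show "mmul n (pencil X (cnj z)) R' i j = mone i j"
      using resolvent_inverse_pencil[OF z] ij m[of j i] by (auto simp: is_minv_def intro: is_adjoint_unique)
    have "is_adjoint (mmul n (pencil X z) (resolvent z) j i) (mmul n R' (pencil X (cnj z)) i j)"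
      unfolding mmul_def using ij by (intro is_adjoint_sum is_adjoint_mult R' P) auto
    then show "mmul n R' (pencil X (cnj z)) i j = mone i j"
      using resolvent_inverse_pencil[OF z] ij m[of j i] by (auto simp: is_minv_def intro: is_adjoint_unique)
  qed
  then have "R' j i = resolvent (cnj z) j i"
    by (rule is_minv_unique[OF _ resolvent_inverse_pencil[OF z']]) (use ij in auto)
  then show ?thesis using R'[OF ij] by simp
qed

definition omega_fun :: "complex \<Rightarrow> nat \<Rightarrow> nat \<Rightarrow> complex" where
  "omega_fun z = subord n (base z) g1 (resolvent z)"

definition omega_mat :: "complex \<Rightarrow> complex mat" where
  "omega_mat z = fmat n (omega_fun z)"

definition g2_mat :: "complex mat" where
  "g2_mat = fmat n g2"

text \<open>The matrix \<open>F\<^sub>z(t)\<close>, inverse of \<open>subW z t = \<omega>(z e\<^sub>1\<^sub>1 - \<gamma>\<^sub>0) - t \<gamma>\<^sub>2\<close>.\<close>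

definition subF :: "complex \<Rightarrow> real \<Rightarrow> nat \<Rightarrow> nat \<Rightarrow> complex" where
  "subF z t i j = mat_inv (omega_mat z - complex_of_real t \<cdot>\<^sub>m g2_mat) $$ (i, j)"

definition subW :: "complex \<Rightarrow> real \<Rightarrow> nat \<Rightarrow> nat \<Rightarrow> complex" where
  "subW z t i j = omega_fun z i j - of_real t * g2 i j"

lemma omega_pencil_mat:
  "omega_mat z - complex_of_real t \<cdot>\<^sub>m g2_mat = fmat n (subW z t)"
  by (auto simp: omega_mat_def g2_mat_def subW_def)

lemma subF_measurable: "i < n \<Longrightarrow> j < n \<Longrightarrow> (\<lambda>t. subF z t i j) \<in> borel_measurable borel"
  unfolding subF_def by (rule mat_inv_measurable[where n = n]) (simp_all add: omega_mat_def g2_mat_def)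

lemma subF_inverse:
  assumes z: "Im z \<noteq> 0" and t: "t \<in> supp"
  shows "is_minv n (subW z t) (subF z t)"
proof -
  obtain F where F: "is_minv n (\<lambda>i k. omega_fun z i k - of_real t * g2 i k) F"
    using subordination_invertible[OF resolvent_inverse[OF z] resolvent_Schwinger_Dyson[OF z] t]
    unfolding omega_fun_def by blast
  have "mat_inv (omega_mat z - complex_of_real t \<cdot>\<^sub>m g2_mat) = fmat n F"
    unfolding omega_pencil_mat by (rule inverse_in_eq) (use F in \<open>simp_all add: subW_def[abs_def]\<close>)
  then show ?thesis by (intro is_minv_cong[OF F]) (simp_all add: subW_def subF_def)
qed

lemma subF_continuous: "Im z \<noteq> 0 \<Longrightarrow> i < n \<Longrightarrow> j < n \<Longrightarrow> continuous_on supp (\<lambda>t. subF z t i j)"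
  using subF_inverse unfolding subW_def[abs_def] omega_fun_def
  by (intro subordination_inverse_continuous[OF resolvent_inverse resolvent_Schwinger_Dyson]) auto

lemma subF_products_integrable:
  assumes "Im z \<noteq> 0" "Im w \<noteq> 0" "i < n" "k < n" "l < n" "j < n"
  shows "integrable \<nu> (\<lambda>t. subF z t i k * subF w t l j)"
  using assms by (intro integrable_on_supp borel_measurable_times subF_measurable continuous_on_mult subF_continuous)

lemma phi_resolvent_cnj:
  assumes "Im z \<noteq> 0" "i < n" "j < n"
  shows "\<phi> (resolvent (cnj z) j i) = cnj (\<phi> (resolvent z i j))"
  using assms by (intro phi_adjoint resolvent_M resolvent_adjoint) auto

lemma omega_fun_cnj:
  assumes z: "Im z \<noteq> 0" and ij: "i < n" "j < n"
  shows "omega_fun (cnj z) j i = cnj (omega_fun z i j)"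
proof -
  have "(\<Sum>k<n. \<Sum>u<n. g1 j k * \<phi> (resolvent (cnj z) k u) * g1 u i)
    = (\<Sum>k<n. \<Sum>u<n. cnj (g1 i u * \<phi> (resolvent z u k) * g1 k j))"
    using ij z by (intro sum.cong refl) (simp add: phi_resolvent_cnj[OF z] g1_herm[of _ j] g1_herm[of i] mult_ac del: sum.lessThan_Suc)
  also have "\<dots> = cnj (\<Sum>u<n. \<Sum>k<n. g1 i u * \<phi> (resolvent z u k) * g1 k j)"
    unfolding cnj_sum by (rule sum.swap)
  finally show ?thesis
    unfolding omega_fun_def subord_def base_def using g0_herm[OF ij] by (auto simp del: sum.lessThan_Suc)
qed

lemma subF_cnj:
  assumes z: "Im z \<noteq> 0" and t: "t \<in> supp" and ij: "i < n" "j < n"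
  shows "subF (cnj z) t j i = cnj (subF z t i j)"
proof -
  have z': "Im (cnj z) \<noteq> 0" using z by simp
  have W: "subW (cnj z) t j i = cnj (subW z t i j)" if "i < n" "j < n" for i j
    using omega_fun_cnj[OF z that] g2_herm[OF that] by (simp add: subW_def)
  have m: "mmul n (subW z t) (subF z t) i j = mone i j" "mmul n (subF z t) (subW z t) i j = mone i j" if "i < n" "j < n" for i j
    using subF_inverse[OF z t] that by (simp_all add: is_minv_def)
  have "is_minv n (subW (cnj z) t) (\<lambda>j i. cnj (subF z t i j))" unfolding is_minv_def
  proof (intro allI impI conjI)
    fix i j assume ij: "i < n" "j < n"
    have "mmul n (subW (cnj z) t) (\<lambda>j i. cnj (subF z t i j)) i j = cnj (mmul n (subF z t) (subW z t) j i)"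
      unfolding mmul_def cnj_sum using ij by (intro sum.cong refl) (simp add: W)
    then show "mmul n (subW (cnj z) t) (\<lambda>j i. cnj (subF z t i j)) i j = mone i j" using ij by (simp add: m mone_def)
    have "mmul n (\<lambda>j i. cnj (subF z t i j)) (subW (cnj z) t) i j = cnj (mmul n (subW z t) (subF z t) j i)"
      unfolding mmul_def cnj_sum using ij by (intro sum.cong refl) (simp add: W)
    then show "mmul n (\<lambda>j i. cnj (subF z t i j)) (subW (cnj z) t) i j = mone i j" using ij by (simp add: m mone_def)
  qed
  then show ?thesis using is_minv_unique[OF subF_inverse[OF z' t]] ij by simp
qed

text \<open>The matrix \<open>u\<close> that the completely positive map contracts.\<close>

definition potential :: "complex \<Rightarrow> nat \<Rightarrow> nat \<Rightarrow> complex" where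
  "potential z i j = mone i j + of_real (\<sigma>\<^sup>2) * mmul n g1 (mmul n (\<lambda>k l. \<phi> (pair z k l)) g1) i j"

text \<open>The subordination formula for the resolvent \<open>tri n R (R R\<^sup>*) R\<^sup>*\<close>. The inverse of
  \<open>\<omega> - t \<gamma>\<^sub>2\<close> at this resolvent is triangular with diagonal blocks \<open>F\<close>, \<open>F\<^sup>*\<close> and corner \<open>F u F\<^sup>*\<close>.\<close>

lemma potential_integral:
  assumes z: "Im z \<noteq> 0" and ij: "i < n" "j < n"
  shows "(\<integral>t. mmul n (subF z t) (mmul n (potential z) (subF (cnj z) t)) i j \<partial>\<nu>) = \<phi> (pair z i j)"
proof -
  have z': "Im (cnj z) \<noteq> 0" using z by simp
  let ?b = "tri n (base z) (\<lambda>i j. - mone i j) (base (cnj z))"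
  let ?g1 = "tri n g1 (\<lambda>i j. 0) g1" and ?g2 = "tri n g2 (\<lambda>i j. 0) g2"
  let ?R = "tri n (resolvent z) (pair z) (resolvent (cnj z))"
  let ?F = "\<lambda>t. tri n (subF z t) (mmul n (subF z t) (mmul n (potential z) (subF (cnj z) t))) (subF (cnj z) t)"
  have R: "is_minv (n + n) (\<lambda>i j. ?b i j *\<^sub>C 1 - ?g1 i j *\<^sub>C s - ?g2 i j *\<^sub>C d) ?R"
  proof (rule is_minv_cong[OF is_minv_tri_mone[OF resolvent_inverse[OF z] resolvent_inverse[OF z']] _ refl])
    fix i j assume "i < n + n" "j < n + n"
    then show "tri n (\<lambda>i j. base z i j *\<^sub>C 1 - g1 i j *\<^sub>C s - g2 i j *\<^sub>C d) (\<lambda>i j. - mone i j)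
       (\<lambda>i j. base (cnj z) i j *\<^sub>C 1 - g1 i j *\<^sub>C s - g2 i j *\<^sub>C d) i j = ?b i j *\<^sub>C 1 - ?g1 i j *\<^sub>C s - ?g2 i j *\<^sub>C d"
      by (elim block_cases) (simp_all add: mone_def scaleC_bop_simps del: add_Suc add_Suc_right)
  qed
  have W: "subord (n + n) ?b ?g1 ?R i k - of_real t * ?g2 i k
    = tri n (subW z t) (\<lambda>i j. - potential z i j) (subW (cnj z) t) i k" if "i < n + n" "k < n + n" for i k t
    unfolding subord_tri[OF that] using that
    by (elim block_cases)
      (simp_all add: subW_def omega_fun_def potential_def del: sum.lessThan_Suc add_Suc add_Suc_right)
  have F: "is_minv (n + n) (\<lambda>i k. subord (n + n) ?b ?g1 ?R i k - of_real t * ?g2 i k) (?F t)" if t: "t \<in> supp" for t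
    by (rule is_minv_cong[OF is_minv_tri[OF subF_inverse[OF z t] subF_inverse[OF z' t]]]) (simp_all only: W refl)
  have meas: "(\<lambda>t. ?F t i j) \<in> borel_measurable borel" if "i < n + n" "j < n + n" for i j
    using that by (elim block_cases)
      (auto simp: mmul_def simp del: sum.lessThan_Suc add_Suc add_Suc_right intro!: subF_measurable borel_measurable_sum borel_measurable_times)
  have "(\<integral>t. ?F t i (n + j) \<partial>\<nu>) = \<phi> (?R i (n + j))"
    by (rule subordination_integral[OF R resolvent_Schwinger_Dyson_pair[OF z] F meas]) (use ij in auto)
  then show ?thesis using ij by (simp only: tri_simps)
qed

definition form :: "complex \<Rightarrow> (nat \<Rightarrow> complex) \<Rightarrow> real" where
  "form z \<xi> = Re (bil n (\<lambda>i. cnj (\<xi> i)) (potential z) \<xi>)"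

definition sqn :: "(nat \<Rightarrow> complex) \<Rightarrow> real" where
  "sqn \<xi> = (\<Sum>i<n. (cmod (\<xi> i))\<^sup>2)"

lemma sqn_nonneg: "0 \<le> sqn \<xi>"
  unfolding sqn_def by (intro sum_nonneg) simp

text \<open>The vector \<open>F\<^sub>z(t)\<^sup>* \<gamma>\<^sub>1 \<xi>\<close>. In terms of it, \<open>\<langle>\<gamma>\<^sub>1 F u F\<^sup>* \<gamma>\<^sub>1 \<xi>, \<xi>\<rangle>\<close> is the form of \<open>u\<close>.\<close>

definition pull :: "complex \<Rightarrow> real \<Rightarrow> (nat \<Rightarrow> complex) \<Rightarrow> nat \<Rightarrow> complex" where
  "pull z t \<xi> k = (\<Sum>l<n. cnj (subF z t l k) * col_mult n g1 \<xi> l)"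

lemma cnj_col_mult_g1: "l < n \<Longrightarrow> cnj (col_mult n g1 \<xi> l) = row_mult n (\<lambda>i. cnj (\<xi> i)) g1 l"
  unfolding col_mult_def row_mult_def cnj_sum by (intro sum.cong refl) (simp add: g1_herm[of l])

lemma form_eq:
  "form z \<xi> = sqn \<xi> + \<sigma>\<^sup>2 * Re (bil n (\<lambda>l. cnj (col_mult n g1 \<xi> l)) (\<lambda>k l. \<phi> (pair z k l)) (col_mult n g1 \<xi>))"
proof -
  have "bil n (\<lambda>i. cnj (\<xi> i)) (potential z) \<xi> = (\<Sum>i<n. cnj (\<xi> i) * \<xi> i)
    + of_real (\<sigma>\<^sup>2) * bil n (row_mult n (\<lambda>i. cnj (\<xi> i)) g1) (\<lambda>k l. \<phi> (pair z k l)) (col_mult n g1 \<xi>)"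
    unfolding potential_def[abs_def] bil_add bil_mone bil_sandwich ..
  also have "bil n (row_mult n (\<lambda>i. cnj (\<xi> i)) g1) (\<lambda>k l. \<phi> (pair z k l)) (col_mult n g1 \<xi>)
    = bil n (\<lambda>l. cnj (col_mult n g1 \<xi> l)) (\<lambda>k l. \<phi> (pair z k l)) (col_mult n g1 \<xi>)"
    by (rule bil_cong) (simp_all only: cnj_col_mult_g1)
  also have "(\<Sum>i<n. cnj (\<xi> i) * \<xi> i) = of_real (sqn \<xi>)"
    unfolding sqn_def of_real_sum by (intro sum.cong refl) (simp only: complex_norm_square mult.commute)
  finally show ?thesis unfolding form_def by (simp del: sum.lessThan_Suc)
qed

text \<open>It is \<open>\<phi>\<close> of the sum of the \<open>x\<^sub>k x\<^sub>k\<^sup>*\<close>, where \<open>x\<^sub>k\<close> is the \<open>k\<close>-th component of \<open>\<eta>\<^sup>* R\<close>.\<close>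

lemma phi_pair_pos:
  assumes z: "Im z \<noteq> 0"
  shows "0 \<le> Re (bil n (\<lambda>l. cnj (\<eta> l)) (\<lambda>k l. \<phi> (pair z k l)) \<eta>)"
proof -
  have z': "Im (cnj z) \<noteq> 0" using z by simp
  define x where "x k = (\<Sum>p<n. cnj (\<eta> p) *\<^sub>C resolvent z p k)" for k
  define x' where "x' k = (\<Sum>q<n. \<eta> q *\<^sub>C resolvent (cnj z) k q)" for k
  have xM: "x k \<in> M" "x' k \<in> M" if "k < n" for k
    unfolding x_def x'_def using that by (auto intro!: M_sum M_scaleC resolvent_M z z' simp del: sum.lessThan_Suc)
  have adj: "is_adjoint (x' k) (x k)" if "k < n" for k
    unfolding x_def x'_def using that z z'
    by (intro is_adjoint_sum is_adjoint_scaleC) (use resolvent_adjoint[OF z'] in simp)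
  have "(\<Sum>k<n. \<phi> (x k * x' k)) = (\<Sum>k<n. \<Sum>p<n. \<Sum>q<n. cnj (\<eta> p) * \<phi> (resolvent z p k * resolvent (cnj z) k q) * \<eta> q)"
  proof (intro sum.cong refl)
    fix k assume k: "k \<in> {..<n}"
    have e: "x k * x' k = (\<Sum>p<n. \<Sum>q<n. (cnj (\<eta> p) * \<eta> q) *\<^sub>C (resolvent z p k * resolvent (cnj z) k q))"
      unfolding x_def x'_def sum_product by (intro sum.cong refl) (simp add: scaleC_bop_simps mult.commute)
    have "\<phi> (x k * x' k) = (\<Sum>p<n. \<phi> (\<Sum>q<n. (cnj (\<eta> p) * \<eta> q) *\<^sub>C (resolvent z p k * resolvent (cnj z) k q)))"
      unfolding e using k by (intro phi_sum M_sum M_scaleC M_mult resolvent_M z z') auto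
    also have "\<dots> = (\<Sum>p<n. \<Sum>q<n. \<phi> ((cnj (\<eta> p) * \<eta> q) *\<^sub>C (resolvent z p k * resolvent (cnj z) k q)))"
      using k by (intro sum.cong refl phi_sum M_scaleC M_mult resolvent_M z z') auto
    also have "\<dots> = (\<Sum>p<n. \<Sum>q<n. cnj (\<eta> p) * \<phi> (resolvent z p k * resolvent (cnj z) k q) * \<eta> q)"
      using k by (intro sum.cong refl) (subst phi_scaleC, auto intro!: M_mult resolvent_M z z')
    finally show "\<phi> (x k * x' k) = (\<Sum>p<n. \<Sum>q<n. cnj (\<eta> p) * \<phi> (resolvent z p k * resolvent (cnj z) k q) * \<eta> q)" .
  qed
  also have "\<dots> = (\<Sum>p<n. \<Sum>k<n. \<Sum>q<n. cnj (\<eta> p) * \<phi> (resolvent z p k * resolvent (cnj z) k q) * \<eta> q)"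
    by (rule sum.swap)
  also have "\<dots> = (\<Sum>p<n. \<Sum>q<n. \<Sum>k<n. cnj (\<eta> p) * \<phi> (resolvent z p k * resolvent (cnj z) k q) * \<eta> q)"
    by (intro sum.cong refl sum.swap)
  also have "\<dots> = bil n (\<lambda>l. cnj (\<eta> l)) (\<lambda>k l. \<phi> (pair z k l)) \<eta>"
    unfolding bil_def
  proof (intro sum.cong refl)
    fix p q assume "p \<in> {..<n}" "q \<in> {..<n}"
    then have "\<phi> (pair z p q) = (\<Sum>k<n. \<phi> (resolvent z p k * resolvent (cnj z) k q))"
      unfolding mmul_def by (intro phi_sum M_mult resolvent_M z z') auto
    then show "(\<Sum>k<n. cnj (\<eta> p) * \<phi> (resolvent z p k * resolvent (cnj z) k q) * \<eta> q) = cnj (\<eta> p) * \<phi> (pair z p q) * \<eta> q"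
      by (simp only: sum_distrib_left sum_distrib_right)
  qed
  finally have "bil n (\<lambda>l. cnj (\<eta> l)) (\<lambda>k l. \<phi> (pair z k l)) \<eta> = (\<Sum>k<n. \<phi> (x k * x' k))" ..
  moreover have "0 \<le> Re (\<Sum>k<n. \<phi> (x k * x' k))"
    unfolding Re_sum using xM adj by (intro sum_nonneg phi_pos_Re(2)) auto
  ultimately show ?thesis by (simp only:)
qed

lemma form_lower: "Im z \<noteq> 0 \<Longrightarrow> sqn \<xi> \<le> form z \<xi>"
  unfolding form_eq using phi_pair_pos[of z "col_mult n g1 \<xi>"] by simp

lemma form_upper: "\<exists>U\<ge>1. \<forall>\<xi>. form z \<xi> \<le> U * sqn \<xi>"
proof -
  define P where "P = (\<Sum>i<n. \<Sum>j<n. cmod (potential z i j))"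
  have P: "0 \<le> P" unfolding P_def by (intro sum_nonneg) simp
  have "form z \<xi> \<le> (2 * P + 1) * sqn \<xi>" for \<xi>
  proof -
    have "form z \<xi> \<le> cmod (bil n (\<lambda>i. cnj (\<xi> i)) (potential z) \<xi>)" unfolding form_def by (rule complex_Re_le_cmod)
    also have "\<dots> \<le> P * (sqn \<xi> + sqn \<xi>)"
      using norm_bil_le[of n "\<lambda>i. cnj (\<xi> i)" "potential z" \<xi>] unfolding P_def sqn_def complex_mod_cnj .
    finally show ?thesis using sqn_nonneg[of \<xi>] by (simp add: algebra_simps)
  qed
  then show ?thesis using P by (intro exI[of _ "2 * P + 1"]) auto
qed

lemma cnj_pull: "cnj (pull z t \<xi> k) = row_mult n (\<lambda>l. cnj (col_mult n g1 \<xi> l)) (subF z t) k"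
  unfolding pull_def row_mult_def cnj_sum by (intro sum.cong refl) (simp add: mult.commute)

lemma pull_col_mult:
  assumes "Im z \<noteq> 0" "t \<in> supp" "k < n"
  shows "pull z t \<xi> k = col_mult n (subF (cnj z) t) (col_mult n g1 \<xi>) k"
  unfolding pull_def col_mult_def[of n "subF (cnj z) t"]
  using assms by (intro sum.cong refl) (simp add: subF_cnj)

text \<open>This is \<open>\<sigma>\<^sup>2 \<gamma>\<^sub>1 (\<integral> F u F\<^sup>* d\<nu>) \<gamma>\<^sub>1 = u - 1\<close> as an identity of quadratic forms.\<close>

lemma form_pull:
  assumes z: "Im z \<noteq> 0"
  shows "integrable \<nu> (\<lambda>t. form z (pull z t \<xi>))" "\<sigma>\<^sup>2 * (\<integral>t. form z (pull z t \<xi>) \<partial>\<nu>) = form z \<xi> - sqn \<xi>"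
proof -
  have z': "Im (cnj z) \<noteq> 0" using z by simp
  let ?\<eta> = "col_mult n g1 \<xi>"
  define G where "G t = mmul n (subF z t) (mmul n (potential z) (subF (cnj z) t))" for t
  have intG: "integrable \<nu> (\<lambda>t. G t i j)" if "i < n" "j < n" for i j
  proof -
    have "G t i j = (\<Sum>k<n. \<Sum>l<n. potential z k l * (subF z t i k * subF (cnj z) t l j))" for t
      unfolding G_def mmul_def sum_distrib_left by (intro sum.cong refl) (simp only: mult_ac)
    moreover have "integrable \<nu> (\<lambda>t. \<Sum>k<n. \<Sum>l<n. potential z k l * (subF z t i k * subF (cnj z) t l j))"
      using that by (intro Bochner_Integration.integrable_sum integrable_mult_right subF_products_integrable z z') auto
    ultimately show ?thesis by (simp only:)
  qed
  note bi = bil_integral[of n \<nu> G "\<lambda>l. cnj (?\<eta> l)" ?\<eta>, OF intG]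
  have eq: "form z (pull z t \<xi>) = Re (bil n (\<lambda>l. cnj (?\<eta> l)) (G t) ?\<eta>)" if t: "t \<in> supp" for t
  proof -
    have "bil n (\<lambda>k. cnj (pull z t \<xi> k)) (potential z) (pull z t \<xi>)
      = bil n (row_mult n (\<lambda>l. cnj (?\<eta> l)) (subF z t)) (potential z) (col_mult n (subF (cnj z) t) ?\<eta>)"
      by (rule bil_cong) (rule cnj_pull, rule refl, rule pull_col_mult[OF z t])
    then show ?thesis unfolding form_def G_def bil_sandwich by (rule arg_cong)
  qed
  have AE: "AE t in \<nu>. Re (bil n (\<lambda>l. cnj (?\<eta> l)) (G t) ?\<eta>) = form z (pull z t \<xi>)"
    using AE_supp by eventually_elim (simp only: eq)
  have pm: "(\<lambda>t. pull z t \<xi> k) \<in> borel_measurable borel" if "k < n" for k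
    unfolding pull_def using that
    by (intro borel_measurable_sum borel_measurable_times measurable_compose[OF subF_measurable] borel_measurable_const)
      (auto intro!: borel_measurable_continuous_onI continuous_intros)
  have fm: "(\<lambda>t. form z (pull z t \<xi>)) \<in> borel_measurable \<nu>"
    unfolding form_def bil_def measurable_cong_sets[OF sets_nu refl]
    by (intro measurable_compose[OF _ borel_measurable_Re] borel_measurable_sum borel_measurable_times pm
        measurable_compose[OF pm, of _ cnj] borel_measurable_const)
      (auto intro!: borel_measurable_continuous_onI continuous_intros)
  have intR: "integrable \<nu> (\<lambda>t. Re (bil n (\<lambda>l. cnj (?\<eta> l)) (G t) ?\<eta>))"
    using bi(1) by (rule integrable_Re)
  show "integrable \<nu> (\<lambda>t. form z (pull z t \<xi>))"
    using integrable_cong_AE[THEN iffD1, OF borel_measurable_integrable[OF intR] fm AE intR] .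
  have "(\<integral>t. form z (pull z t \<xi>) \<partial>\<nu>) = (\<integral>t. Re (bil n (\<lambda>l. cnj (?\<eta> l)) (G t) ?\<eta>) \<partial>\<nu>)"
    by (rule integral_cong_AE[OF fm borel_measurable_integrable[OF intR]]) (use AE in \<open>eventually_elim, simp only:\<close>)
  also have "\<dots> = Re (bil n (\<lambda>l. cnj (?\<eta> l)) (\<lambda>i j. \<integral>t. G t i j \<partial>\<nu>) ?\<eta>)"
    using integral_Re[OF bi(1)] bi(2) by simp
  also have "bil n (\<lambda>l. cnj (?\<eta> l)) (\<lambda>i j. \<integral>t. G t i j \<partial>\<nu>) ?\<eta> = bil n (\<lambda>l. cnj (?\<eta> l)) (\<lambda>k l. \<phi> (pair z k l)) ?\<eta>"
    by (rule bil_cong) (simp_all only: G_def potential_integral[OF z])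
  finally show "\<sigma>\<^sup>2 * (\<integral>t. form z (pull z t \<xi>) \<partial>\<nu>) = form z \<xi> - sqn \<xi>"
    unfolding form_eq[of z \<xi>] by simp
qed

text \<open>For \<open>Y = \<gamma>\<^sub>1 y \<gamma>\<^sub>1\<close> the eigenvalue equation reads
  \<open>l \<langle>Y \<eta>, \<xi>\<rangle> = \<integral> \<langle>Y b\<^sub>t, a\<^sub>t\<rangle> d\<nu>(t)\<close> with \<open>a\<^sub>t\<close> and \<open>b\<^sub>t\<close> the vectors \<open>pull\<close> at \<open>z\<^sub>1\<close> and at \<open>cnj z\<^sub>2\<close>. A
  bound \<open>\<bar>\<langle>Y \<eta>, \<xi>\<rangle>\<bar> \<le> C (form z\<^sub>1 \<xi> + form (cnj z\<^sub>2) \<eta>)\<close> for all vectors therefore implies the same bound with \<open>r C\<close>,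
  where \<open>r < 1\<close> is the contraction factor of both forms.\<close>

theorem no_large_eigenvalue:
  assumes z: "Im z1 \<noteq> 0" "Im z2 \<noteq> 0" and \<sigma>: "\<sigma> > 0" and l: "1 / \<sigma>\<^sup>2 \<le> cmod l"
    and y: "\<And>i j. i < n \<Longrightarrow> j < n \<Longrightarrow>
      l * y i j = (\<integral>t. mmul n (subF z1 t) (mmul n (mmul n g1 (mmul n y g1)) (subF z2 t)) i j \<partial>\<nu>)"
    and ij: "i < n" "j < n"
  shows "y i j = 0"
proof -
  define w where "w = cnj z2"
  have w: "Im w \<noteq> 0" "cnj w = z2" using z by (simp_all add: w_def)
  define Y where "Y = mmul n g1 (mmul n y g1)"
  define G where "G t = mmul n (subF z1 t) (mmul n Y (subF z2 t))" for t
  have l0: "l \<noteq> 0" using l \<sigma> by auto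
  obtain U1 U2 where U: "U1 \<ge> 1" "\<And>\<xi>. form z1 \<xi> \<le> U1 * sqn \<xi>" "U2 \<ge> 1" "\<And>\<xi>. form w \<xi> \<le> U2 * sqn \<xi>"
    using form_upper by metis
  define r where "r = 1 - 1 / max U1 U2"
  have r: "0 \<le> r" "r < 1" using U(1) by (auto simp: r_def)
  have contr: "form z1 \<xi> - sqn \<xi> \<le> r * form z1 \<xi>" "form w \<xi> - sqn \<xi> \<le> r * form w \<xi>" for \<xi>
  proof -
    have "form z1 \<xi> \<le> max U1 U2 * sqn \<xi>" "form w \<xi> \<le> max U1 U2 * sqn \<xi>"
      using U(2,4)[of \<xi>] sqn_nonneg[of \<xi>] by (meson max.cobounded1 max.cobounded2 mult_right_mono order_trans)+
    then show "form z1 \<xi> - sqn \<xi> \<le> r * form z1 \<xi>" "form w \<xi> - sqn \<xi> \<le> r * form w \<xi>"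
      using U(1) by (simp_all add: r_def field_simps)
  qed
  have intG: "integrable \<nu> (\<lambda>t. G t i j)" if "i < n" "j < n" for i j
  proof -
    have "G t i j = (\<Sum>k<n. \<Sum>l<n. Y k l * (subF z1 t i k * subF z2 t l j))" for t
      unfolding G_def mmul_def[of n "subF z1 t"] mmul_def[of n Y] sum_distrib_left by (intro sum.cong refl) (simp only: mult_ac)
    moreover have "integrable \<nu> (\<lambda>t. \<Sum>k<n. \<Sum>l<n. Y k l * (subF z1 t i k * subF z2 t l j))"
      using that by (intro Bochner_Integration.integrable_sum integrable_mult_right subF_products_integrable z) auto
    ultimately show ?thesis by (simp only:)
  qed
  have step: "cmod (bil n (\<lambda>i. cnj (\<xi> i)) Y \<eta>) \<le> (r * C) * (form z1 \<xi> + form w \<eta>)"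
    if C: "0 \<le> C" "\<And>\<xi> \<eta>. cmod (bil n (\<lambda>i. cnj (\<xi> i)) Y \<eta>) \<le> C * (form z1 \<xi> + form w \<eta>)" for C \<xi> \<eta>
  proof -
    define x where "x l = cnj (col_mult n g1 \<xi> l)" for l
    define v where "v = col_mult n g1 \<eta>"
    note bi = bil_integral[of n \<nu> G x v, OF intG]
    have "bil n (\<lambda>i. cnj (\<xi> i)) Y \<eta> = bil n (row_mult n (\<lambda>i. cnj (\<xi> i)) g1) y v"
      unfolding Y_def bil_sandwich v_def ..
    also have "\<dots> = bil n x y v" by (rule bil_cong) (simp_all only: x_def cnj_col_mult_g1)
    finally have 1: "bil n (\<lambda>i. cnj (\<xi> i)) Y \<eta> = bil n x y v" .
    have "l * bil n x y v = bil n x (\<lambda>i j. l * y i j) v"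
      unfolding bil_def sum_distrib_left by (intro sum.cong refl) (simp only: mult_ac)
    also have "\<dots> = bil n x (\<lambda>i j. \<integral>t. G t i j \<partial>\<nu>) v"
      by (rule bil_cong) (simp_all only: y G_def Y_def)
    also have "\<dots> = (\<integral>t. bil n x (G t) v \<partial>\<nu>)" using bi(2) ..
    finally have 2: "l * bil n x y v = (\<integral>t. bil n x (G t) v \<partial>\<nu>)" .
    have "cmod l * cmod (bil n x y v) \<le> (\<integral>t. cmod (bil n x (G t) v) \<partial>\<nu>)"
      unfolding norm_mult[symmetric] 2 by (rule integral_norm_bound)
    also have "\<dots> \<le> (\<integral>t. C * (form z1 (pull z1 t \<xi>) + form w (pull w t \<eta>)) \<partial>\<nu>)"
    proof (rule integral_mono_AE)
      show "integrable \<nu> (\<lambda>t. cmod (bil n x (G t) v))" using bi(1) by (rule integrable_norm)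
      show "integrable \<nu> (\<lambda>t. C * (form z1 (pull z1 t \<xi>) + form w (pull w t \<eta>)))"
        using form_pull(1)[OF z(1)] form_pull(1)[OF w(1)] by simp
      show "AE t in \<nu>. cmod (bil n x (G t) v) \<le> C * (form z1 (pull z1 t \<xi>) + form w (pull w t \<eta>))"
        using AE_supp
      proof eventually_elim
        case (elim t)
        have "bil n x (G t) v = bil n (row_mult n x (subF z1 t)) Y (col_mult n (subF z2 t) v)"
          unfolding G_def bil_sandwich ..
        also have "\<dots> = bil n (\<lambda>k. cnj (pull z1 t \<xi> k)) Y (pull w t \<eta>)"
          by (rule bil_cong) (simp_all only: cnj_pull, simp_all only: pull_col_mult[OF w(1) elim] w(2) x_def[abs_def] v_def)
        finally show ?case using C(2)[of "pull z1 t \<xi>" "pull w t \<eta>"] by simp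
      qed
    qed
    also have "\<dots> = C * ((\<integral>t. form z1 (pull z1 t \<xi>) \<partial>\<nu>) + (\<integral>t. form w (pull w t \<eta>) \<partial>\<nu>))"
      using form_pull(1)[OF z(1)] form_pull(1)[OF w(1)] by simp
    finally have "\<sigma>\<^sup>2 * (cmod l * cmod (bil n x y v)) \<le> \<sigma>\<^sup>2 * (C * ((\<integral>t. form z1 (pull z1 t \<xi>) \<partial>\<nu>) + (\<integral>t. form w (pull w t \<eta>) \<partial>\<nu>)))"
      by (rule mult_left_mono) simp
    also have "\<dots> = C * ((form z1 \<xi> - sqn \<xi>) + (form w \<eta> - sqn \<eta>))"
      unfolding form_pull(2)[OF z(1), symmetric] form_pull(2)[OF w(1), symmetric] by (simp add: algebra_simps)
    also have "\<dots> \<le> C * (r * form z1 \<xi> + r * form w \<eta>)"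
      using C(1) contr by (intro mult_left_mono add_mono) auto
    finally have 3: "\<sigma>\<^sup>2 * cmod l * cmod (bil n x y v) \<le> (r * C) * (form z1 \<xi> + form w \<eta>)" by (simp add: algebra_simps)
    have "1 \<le> \<sigma>\<^sup>2 * cmod l" using l \<sigma> by (simp add: field_simps)
    then have "1 * cmod (bil n x y v) \<le> \<sigma>\<^sup>2 * cmod l * cmod (bil n x y v)" by (intro mult_right_mono) auto
    then show ?thesis unfolding 1 using 3 by simp
  qed
  define C0 where "C0 = (\<Sum>i<n. \<Sum>j<n. cmod (Y i j))"
  have C0: "0 \<le> C0" unfolding C0_def by (intro sum_nonneg) simp
  have base_bound: "cmod (bil n (\<lambda>i. cnj (\<xi> i)) Y \<eta>) \<le> C0 * (form z1 \<xi> + form w \<eta>)" for \<xi> \<eta>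
  proof -
    have "cmod (bil n (\<lambda>i. cnj (\<xi> i)) Y \<eta>) \<le> C0 * (sqn \<xi> + sqn \<eta>)"
      using norm_bil_le[of n "\<lambda>i. cnj (\<xi> i)" Y \<eta>] unfolding C0_def sqn_def complex_mod_cnj .
    also have "\<dots> \<le> C0 * (form z1 \<xi> + form w \<eta>)"
      using C0 form_lower[OF z(1)] form_lower[OF w(1)] by (intro mult_left_mono add_mono) auto
    finally show ?thesis .
  qed
  have iter: "cmod (bil n (\<lambda>i. cnj (\<xi> i)) Y \<eta>) \<le> (r ^ k * C0) * (form z1 \<xi> + form w \<eta>)" for k \<xi> \<eta>
  proof (induction k arbitrary: \<xi> \<eta>)
    case (Suc k)
    show ?case using step[of "r ^ k * C0", OF _ Suc] r(1) C0 by (simp add: mult.assoc)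
  qed (use base_bound in simp)
  have Y0: "bil n (\<lambda>i. cnj (\<xi> i)) Y \<eta> = 0" for \<xi> \<eta>
  proof -
    have "(\<lambda>k. (r ^ k * C0) * (form z1 \<xi> + form w \<eta>)) \<longlonglongrightarrow> (0 * C0) * (form z1 \<xi> + form w \<eta>)"
      by (intro tendsto_intros LIMSEQ_power_zero) (use r in simp)
    then have "cmod (bil n (\<lambda>i. cnj (\<xi> i)) Y \<eta>) \<le> (0 * C0) * (form z1 \<xi> + form w \<eta>)"
      by (rule LIMSEQ_le_const) (use iter in blast)
    then show ?thesis by simp
  qed
  have "Y k m = 0" if "k < n" "m < n" for k m
  proof -
    have "bil n (\<lambda>i. cnj (mone k i)) Y (\<lambda>i. mone i m) = 0" by (rule Y0)
    moreover have "(\<lambda>i. cnj (mone k i)) = mone k" by (auto simp: mone_def)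
    ultimately show ?thesis using bil_entry[OF that, of Y] by simp
  qed
  then have "mmul n (subF z1 t) (mmul n Y (subF z2 t)) i j = 0" for t
    unfolding mmul_def[of n "subF z1 t"] mmul_def[of n Y] by (intro sum.neutral ballI) simp
  then have "l * y i j = 0" using y[OF ij] by (simp add: Y_def)
  then show ?thesis using l0 by simp
qed

end

section \<open>The operator in coordinates\<close>

context hermitian_pencil
begin

definition g1_mat :: "complex mat" where
  "g1_mat = fmat n g1"

text \<open>Outside this finite set, which is disjoint from the support, the integrand of \<open>T\<close> is given by \<open>subF\<close>.\<close>

definition singular :: "complex \<Rightarrow> real set" where
  "singular z = {t. det (omega_mat z - complex_of_real t \<cdot>\<^sub>m g2_mat) = 0}"

lemma omega_mat_carrier: "omega_mat z \<in> carrier_mat n n" "g1_mat \<in> carrier_mat n n" "g2_mat \<in> carrier_mat n n"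
  by (simp_all add: omega_mat_def g1_mat_def g2_mat_def)

lemma supp_nonsingular:
  assumes "Im z \<noteq> 0" "t \<in> supp" shows "t \<notin> singular z"
proof
  assume t: "t \<in> singular z"
  have "fmat n (subW z t) * fmat n (subF z t) = 1\<^sub>m n"
    unfolding mat_times_mmul mat_eq_one_iff using subF_inverse[OF assms] by (simp add: is_minv_def)
  then have "det (fmat n (subW z t)) * det (fmat n (subF z t)) = 1"
    using det_mult[of "fmat n (subW z t)" n "fmat n (subF z t)"] by simp
  then show False using t unfolding singular_def omega_pencil_mat by simp
qed

lemma supp_nonempty: "supp \<noteq> {}"
  using AE_supp by auto

lemma finite_singular: assumes "Im z \<noteq> 0" shows "finite (singular z)"
proof -
  obtain t0 where "t0 \<in> supp" using supp_nonempty by blast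
  then have "det (omega_mat z - complex_of_real t0 \<cdot>\<^sub>m g2_mat) \<noteq> 0"
    using supp_nonsingular[OF assms] by (auto simp: singular_def)
  then show ?thesis unfolding singular_def by (rule finite_singular_parameters[OF omega_mat_carrier(1,3)])
qed

lemma mat_inv_nonsingular:
  assumes "t \<notin> singular z"
  shows "mat_inv (omega_mat z - complex_of_real t \<cdot>\<^sub>m g2_mat) = fmat n (subF z t)"
proof -
  have c: "omega_mat z - complex_of_real t \<cdot>\<^sub>m g2_mat \<in> carrier_mat n n"
    using omega_mat_carrier by (auto intro!: minus_carrier_mat)
  have "mat_inv (omega_mat z - complex_of_real t \<cdot>\<^sub>m g2_mat) \<in> carrier_mat n n"
    using mat_inv_eq_adj_mat[OF c] adj_mat(1)[OF c] assms by (simp add: singular_def)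
  then show ?thesis by (auto simp: subF_def)
qed

definition sandwich :: "complex \<Rightarrow> complex \<Rightarrow> real \<Rightarrow> nat \<Rightarrow> nat \<Rightarrow> nat \<Rightarrow> nat \<Rightarrow> complex" where
  "sandwich z1 z2 t i k l j = mmul n (subF z1 t) g1 i k * mmul n g1 (subF z2 t) l j"

lemma sandwich_measurable:
  "i < n \<Longrightarrow> k < n \<Longrightarrow> l < n \<Longrightarrow> j < n \<Longrightarrow> (\<lambda>t. sandwich z1 z2 t i k l j) \<in> borel_measurable borel"
  unfolding sandwich_def mmul_def
  by (intro borel_measurable_times borel_measurable_sum borel_measurable_const subF_measurable) auto

lemma sandwich_integrable:
  assumes "Im z1 \<noteq> 0" "Im z2 \<noteq> 0" "i < n" "k < n" "l < n" "j < n"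
  shows "integrable \<nu> (\<lambda>t. sandwich z1 z2 t i k l j)"
proof (rule integrable_on_supp)
  show "continuous_on supp (\<lambda>t. sandwich z1 z2 t i k l j)"
    unfolding sandwich_def mmul_def using assms
    by (intro continuous_on_mult continuous_on_sum continuous_on_const subF_continuous) auto
qed (use assms in \<open>auto intro: sandwich_measurable\<close>)

text \<open>Only the quotient of \<open>i\<close> and the remainder of \<open>j\<close> interact with the kernel: \<open>T\<close> acts on each slice
  \<open>y\<close> of \<open>x\<close> with fixed remainder of \<open>i\<close> and fixed quotient of \<open>j\<close>. The two forms of the
  entry serve to see \<open>T\<close> as a linear map and to apply \<open>no_large_eigenvalue\<close> to the slice.\<close>

lemma T_op_entry:
  assumes z: "Im z1 \<noteq> 0" "Im z2 \<noteq> 0" and x: "x \<in> carrier_mat (n * n) (n * n)" and ij: "i < n * n" "j < n * n"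
  defines "y \<equiv> \<lambda>k l. x $$ (k * n + i mod n, (j div n) * n + l)"
  shows "T_op n \<nu> g1_mat g2_mat (omega_mat z1) (omega_mat z2) x $$ (i, j)
      = (\<Sum>k<n. \<Sum>l<n. (\<integral>t. sandwich z1 z2 t (i div n) k l (j mod n) \<partial>\<nu>) * y k l)" (is ?sum)
    and "T_op n \<nu> g1_mat g2_mat (omega_mat z1) (omega_mat z2) x $$ (i, j)
      = (\<integral>t. mmul n (subF z1 t) (mmul n (mmul n g1 (mmul n y g1)) (subF z2 t)) (i div n) (j mod n) \<partial>\<nu>)" (is ?int)
proof -
  have dm: "i div n < n" "j mod n < n" using ij by (simp_all add: less_mult_imp_div_less)
  define f where "f t = (kron (mat_inv (omega_mat z1 - complex_of_real t \<cdot>\<^sub>m g2_mat) * g1_mat) (1\<^sub>m n) * x *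
           kron (1\<^sub>m n) (g1_mat * mat_inv (omega_mat z2 - complex_of_real t \<cdot>\<^sub>m g2_mat))) $$ (i, j)" for t
  define h where "h t = (\<Sum>k<n. \<Sum>l<n. sandwich z1 z2 t (i div n) k l (j mod n) * y k l)" for t
  have fh: "f t = h t" if t: "t \<notin> singular z1 \<union> singular z2" for t
  proof -
    have F: "mat_inv (omega_mat z1 - complex_of_real t \<cdot>\<^sub>m g2_mat) * g1_mat = fmat n (mmul n (subF z1 t) g1)"
      "g1_mat * mat_inv (omega_mat z2 - complex_of_real t \<cdot>\<^sub>m g2_mat) = fmat n (mmul n g1 (subF z2 t))"
    proof -
      have t': "t \<notin> singular z1" "t \<notin> singular z2" using t by auto
      show "mat_inv (omega_mat z1 - complex_of_real t \<cdot>\<^sub>m g2_mat) * g1_mat = fmat n (mmul n (subF z1 t) g1)"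
        "g1_mat * mat_inv (omega_mat z2 - complex_of_real t \<cdot>\<^sub>m g2_mat) = fmat n (mmul n g1 (subF z2 t))"
        unfolding mat_inv_nonsingular[OF t'(1)] mat_inv_nonsingular[OF t'(2)] g1_mat_def mat_times_mmul by (rule refl)+
    qed
    have "f t = (\<Sum>k<n. \<Sum>l<n. fmat n (mmul n (subF z1 t) g1) $$ (i div n, k) * y k l
        * fmat n (mmul n g1 (subF z2 t)) $$ (l, j mod n))"
      unfolding f_def F y_def by (rule kron_sandwich[OF _ _ x ij]) simp_all
    also have "\<dots> = h t" unfolding h_def sandwich_def
    proof (intro sum.cong refl)
      fix k l assume "k \<in> {..<n}" "l \<in> {..<n}"
      then show "fmat n (mmul n (subF z1 t) g1) $$ (i div n, k) * y k l
        * fmat n (mmul n g1 (subF z2 t)) $$ (l, j mod n)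
        = mmul n (subF z1 t) g1 (i div n) k * mmul n g1 (subF z2 t) l (j mod n) * y k l"
        using dm by (simp del: sum.lessThan_Suc)
    qed
    finally show ?thesis .
  qed
  have hm: "h \<in> borel_measurable borel" unfolding h_def using dm
    by (intro borel_measurable_sum borel_measurable_times borel_measurable_const sandwich_measurable) auto
  \<comment> \<open>the value of the integrand at the finitely many singular parameters is arbitrary\<close>
  have fm: "f \<in> borel_measurable borel"
    by (rule measurable_discrete_difference[OF hm, of "singular z1 \<union> singular z2"])
      (use finite_singular[OF z(1)] finite_singular[OF z(2)] fh in \<open>auto intro: countable_finite\<close>)
  have "AE t in \<nu>. f t = h t" using AE_supp
    by eventually_elim (rule fh, use supp_nonsingular z in auto)
  then have "(\<integral>t. f t \<partial>\<nu>) = (\<integral>t. h t \<partial>\<nu>)" using fm hm by (intro integral_cong_AE) auto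
  moreover have "T_op n \<nu> g1_mat g2_mat (omega_mat z1) (omega_mat z2) x $$ (i, j) = (\<integral>t. f t \<partial>\<nu>)"
    unfolding T_op_def f_def using ij by (subst index_mat(1)) auto
  ultimately have T: "T_op n \<nu> g1_mat g2_mat (omega_mat z1) (omega_mat z2) x $$ (i, j) = (\<integral>t. h t \<partial>\<nu>)" by simp
  have int: "integrable \<nu> (\<lambda>t. sandwich z1 z2 t (i div n) k l (j mod n) * y k l)" if "k < n" "l < n" for k l
    using that dm z by (intro integrable_mult_left sandwich_integrable)
  have "(\<integral>t. h t \<partial>\<nu>) = (\<Sum>k<n. \<integral>t. (\<Sum>l<n. sandwich z1 z2 t (i div n) k l (j mod n) * y k l) \<partial>\<nu>)"
    unfolding h_def by (rule Bochner_Integration.integral_sum) (use int in \<open>auto intro!: Bochner_Integration.integrable_sum simp del: sum.lessThan_Suc\<close>)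
  also have "\<dots> = (\<Sum>k<n. \<Sum>l<n. \<integral>t. sandwich z1 z2 t (i div n) k l (j mod n) * y k l \<partial>\<nu>)"
    by (intro sum.cong refl Bochner_Integration.integral_sum) (use int in auto)
  also have "\<dots> = (\<Sum>k<n. \<Sum>l<n. (\<integral>t. sandwich z1 z2 t (i div n) k l (j mod n) \<partial>\<nu>) * y k l)"
    by (intro sum.cong refl) simp
  finally show ?sum unfolding T .
  have "h t = mmul n (subF z1 t) (mmul n (mmul n g1 (mmul n y g1)) (subF z2 t)) (i div n) (j mod n)" for t
  proof -
    have "mmul n (subF z1 t) (mmul n (mmul n g1 (mmul n y g1)) (subF z2 t)) = mmul n (mmul n (subF z1 t) g1) (mmul n y (mmul n g1 (subF z2 t)))"
      by (simp only: mmul_assoc)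
    then show ?thesis unfolding h_def sandwich_def
      by (simp only: mmul_def[of n "mmul n (subF z1 t) g1"] mmul_def[of n y] sum_distrib_left mult_ac)
  qed
  then have "h = (\<lambda>t. mmul n (subF z1 t) (mmul n (mmul n g1 (mmul n y g1)) (subF z2 t)) (i div n) (j mod n))"
    by (rule ext)
  then show ?int unfolding T by (rule arg_cong)
qed

text \<open>In finite dimension it is enough that the kernel is trivial, and an element of the kernel has slices that satisfy
  the eigenvalue equation.\<close>

theorem T_op_resolvent_bijective:
  assumes z: "Im z1 \<noteq> 0" "Im z2 \<noteq> 0" and \<sigma>: "\<sigma> > 0" and l: "1 / \<sigma>\<^sup>2 \<le> cmod l"
  shows "bij_betw (\<lambda>x. l \<cdot>\<^sub>m x - T_op n \<nu> g1_mat g2_mat (omega_mat z1) (omega_mat z2) x)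
    (carrier_mat (n * n) (n * n)) (carrier_mat (n * n) (n * n))"
proof -
  let ?T = "T_op n \<nu> g1_mat g2_mat (omega_mat z1) (omega_mat z2)"
  have Tc: "?T x \<in> carrier_mat (n * n) (n * n)" for x by (simp add: T_op_def del: mult_Suc mult_Suc_right)
  define \<kappa> where "\<kappa> i k l j = (\<integral>t. sandwich z1 z2 t i k l j \<partial>\<nu>)" for i k l j
  define c where "c i j a b = (if a mod n = i mod n \<and> b div n = j div n then \<kappa> (i div n) (a div n) (b mod n) (j mod n) else 0)" for i j a b
  have dmod: "(k * N + r) div N = k" "(k * N + r) mod N = r" if "r < N" for k r N :: nat
    using that by simp_all
  have T: "?T x $$ (i, j) = (\<Sum>a<n * n. \<Sum>b<n * n. c i j a b * x $$ (a, b))"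
    if x: "x \<in> carrier_mat (n * n) (n * n)" and ij: "i < n * n" "j < n * n" for x i j
  proof -
    have dm: "i mod n < n" "j div n < n" using ij by (simp_all add: less_mult_imp_div_less)
    have "(\<Sum>b<n * n. c i j (k * n + r) b * x $$ (k * n + r, b))
      = (if r = i mod n then (\<Sum>l<n. \<kappa> (i div n) k l (j mod n) * x $$ (k * n + i mod n, (j div n) * n + l)) else 0)"
      if "r < n" for k r
    proof -
      have "(\<Sum>b<n * n. c i j (k * n + r) b * x $$ (k * n + r, b))
        = (\<Sum>k'<n. \<Sum>l<n. if k' = j div n then (if r = i mod n then \<kappa> (i div n) k l (j mod n) * x $$ (k * n + i mod n, k' * n + l) else 0) else 0)"
        unfolding sum_product_index
      proof (intro sum.cong refl)
        fix k' l assume "l \<in> {..<n}"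
        then have d: "(k' * n + l) div n = k'" "(k' * n + l) mod n = l" "(k * n + r) div n = k" "(k * n + r) mod n = r"
          using that dmod by blast+
        show "c i j (k * n + r) (k' * n + l) * x $$ (k * n + r, k' * n + l)
          = (if k' = j div n then (if r = i mod n then \<kappa> (i div n) k l (j mod n) * x $$ (k * n + i mod n, k' * n + l) else 0) else 0)"
          by (simp only: c_def d) auto
      qed
      also have "\<dots> = (\<Sum>k'<n. if k' = j div n then (\<Sum>l<n. if r = i mod n then \<kappa> (i div n) k l (j mod n) * x $$ (k * n + i mod n, k' * n + l) else 0) else 0)"
        by (intro sum.cong refl) (simp del: sum.lessThan_Suc)
      also have "\<dots> = (\<Sum>l<n. if r = i mod n then \<kappa> (i div n) k l (j mod n) * x $$ (k * n + i mod n, (j div n) * n + l) else 0)"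
        using dm(2) by (subst sum.delta) auto
      finally show ?thesis by (simp del: sum.lessThan_Suc)
    qed
    then have "(\<Sum>a<n * n. \<Sum>b<n * n. c i j a b * x $$ (a, b))
      = (\<Sum>k<n. \<Sum>r<n. if r = i mod n then (\<Sum>l<n. \<kappa> (i div n) k l (j mod n) * x $$ (k * n + i mod n, (j div n) * n + l)) else 0)"
      unfolding sum_product_index[of _ n n] by (intro sum.cong refl) auto
    also have "\<dots> = (\<Sum>k<n. \<Sum>l<n. \<kappa> (i div n) k l (j mod n) * x $$ (k * n + i mod n, (j div n) * n + l))"
      using dm(1) by (simp del: sum.lessThan_Suc mult_Suc_right)
    finally show ?thesis unfolding \<kappa>_def T_op_entry(1)[OF z x ij] ..
  qed
  show ?thesis
  proof (rule linear_map_bij)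
    fix x :: "complex mat" and i j
    assume x: "x \<in> carrier_mat (n * n) (n * n)" and ij: "i < n * n" "j < n * n"
    have "(l \<cdot>\<^sub>m x - ?T x) $$ (i, j) = l * x $$ (i, j) - ?T x $$ (i, j)"
      using x ij carrier_matD[OF Tc[of x]] by (simp del: mult_Suc mult_Suc_right)
    also have "l * x $$ (i, j) = (\<Sum>a<n * n. mone i a * (\<Sum>b<n * n. (l * x $$ (a, b)) * mone b j))"
      using ij by (simp only: sum_mone_left sum_mone_right)
    finally show "(l \<cdot>\<^sub>m x - ?T x) $$ (i, j) = (\<Sum>a<n * n. \<Sum>b<n * n. (l * mone i a * mone b j - c i j a b) * x $$ (a, b))"
      unfolding T[OF x ij] sum_distrib_left sum_subtractf[symmetric]
      by (simp only: left_diff_distrib right_diff_distrib mult_ac)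
  next
    fix x :: "complex mat" assume x: "x \<in> carrier_mat (n * n) (n * n)"
    show "l \<cdot>\<^sub>m x - ?T x \<in> carrier_mat (n * n) (n * n)" by (rule minus_carrier_mat[OF Tc])
    assume zero: "l \<cdot>\<^sub>m x - ?T x = 0\<^sub>m (n * n) (n * n)"
    have "x $$ (i, j) = 0" if ij: "i < n * n" "j < n * n" for i j
    proof -
      define i2 j1 where "i2 = i mod n" and "j1 = j div n"
      have dm: "i div n < n" "i2 < n" "j1 < n" "j mod n < n"
        using ij by (simp_all add: less_mult_imp_div_less i2_def j1_def)
      define y where "y k b = x $$ (k * n + i2, j1 * n + b)" for k b
      have "y (i div n) (j mod n) = 0"
      proof (rule no_large_eigenvalue[OF z \<sigma> l _ dm(1,4)])
        fix p q assume pq: "p < n" "q < n"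
        let ?a = "p * n + i2" and ?b = "j1 * n + q"
        have ab: "?a < n * n" "?b < n * n" by (intro product_index_less pq dm)+
        have d: "?a div n = p" "?a mod n = i2" "?b div n = j1" "?b mod n = q"
          using dm pq dmod by blast+
        have "(l \<cdot>\<^sub>m x - ?T x) $$ (?a, ?b) = l * x $$ (?a, ?b) - ?T x $$ (?a, ?b)"
          using x ab carrier_matD[OF Tc[of x]] by (simp del: mult_Suc mult_Suc_right)
        then have "l * x $$ (?a, ?b) = ?T x $$ (?a, ?b)"
          using ab by (simp add: zero del: mult_Suc mult_Suc_right)
        then show "l * y p q = (\<integral>t. mmul n (subF z1 t) (mmul n (mmul n g1 (mmul n y g1)) (subF z2 t)) p q \<partial>\<nu>)"
          unfolding T_op_entry(2)[OF z x ab] d y_def[abs_def] .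
      qed
      then show ?thesis by (simp only: y_def i2_def j1_def div_mult_mod_eq)
    qed
    then show "x = 0\<^sub>m (n * n) (n * n)" using x by (intro eq_matI) (auto simp del: mult_Suc mult_Suc_right)
  qed
qed

lemma omega_eq_omega_mat:
  assumes z: "Im z \<noteq> 0"
  shows "omega M \<phi> s d \<sigma> g1_mat g2_mat (z \<cdot>\<^sub>m e11 n - fmat n g0) = omega_mat z"
proof -
  have b: "z \<cdot>\<^sub>m e11 n - fmat n g0 = fmat n (base z)"
    by (auto simp: e11_def base_def)
  have B: "mat_tensor_op (fmat n (base z)) 1 - mat_tensor_op g1_mat s - mat_tensor_op g2_mat d
    = Matrix.mat n n (\<lambda>(i, j). base z i j *\<^sub>C 1 - g1 i j *\<^sub>C s - g2 i j *\<^sub>C d)"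
    by (auto simp: mat_tensor_op_def g1_mat_def g2_mat_def)
  have R: "inverse_in M (Matrix.mat n n (\<lambda>(i, j). base z i j *\<^sub>C 1 - g1 i j *\<^sub>C s - g2 i j *\<^sub>C d))
    = fmat n (resolvent z)"
    by (rule inverse_in_eq[OF resolvent_inverse[OF z] resolvent_M[OF z]])
  have P: "map_mat \<phi> (fmat n (resolvent z)) = Matrix.mat n n (\<lambda>(i, j). \<phi> (resolvent z i j))"
    by auto
  have "omega M \<phi> s d \<sigma> g1_mat g2_mat (fmat n (base z))
    = fmat n (base z) - complex_of_real (\<sigma>\<^sup>2) \<cdot>\<^sub>m
       fmat n (mmul n (mmul n g1 (\<lambda>i j. \<phi> (resolvent z i j))) g1)"
    unfolding omega_def B R P by (simp only: g1_mat_def mat_times_mmul)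
  also have "\<dots> = omega_mat z"
    unfolding omega_mat_def omega_fun_def subord_def mmul_assoc
    by (rule eq_matI) (simp_all add: mmul_def sum_distrib_left mult.assoc del: sum.lessThan_Suc)
  finally show ?thesis unfolding b .
qed

end

theorem proposition1:
  fixes P :: ncpoly and L :: "ncpoly mat" and \<gamma>0 \<gamma>1 \<gamma>2 :: "complex mat" and m :: nat
    and \<sigma> :: real and \<nu> :: "real measure"
    and M :: "'h::complex_hilbert_space bop set" and \<phi> :: "'h bop \<Rightarrow> complex"
    and s d :: "'h bop" and \<omega> :: "complex mat \<Rightarrow> complex mat" and z1 z2 :: complex
  assumes "nc_adjoint P = P"
    and "canonical_sa_linearization P L"
    and "m = dim_row L"
    and "\<gamma>0 = mat_coeff L []" and "\<gamma>1 = mat_coeff L [T1]" and "\<gamma>2 = mat_coeff L [T2]"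
    and "\<sigma> > 0"
    and "prob_space \<nu>" and "sets \<nu> = sets borel" and "\<exists>K. compact K \<and> (AE t in \<nu>. t \<in> K)"
    and "wstar_probability_space M \<phi>"
    and "s \<in> M" and "has_distribution \<phi> s (semicircle \<sigma>)"
    and "d \<in> M" and "has_distribution \<phi> d \<nu>"
    and "freely_independent \<phi> s d"
    and "\<omega> = omega M \<phi> s d \<sigma> \<gamma>1 \<gamma>2"
    and "z1 \<notin> \<real>" and "z2 \<notin> \<real>"
  shows "mat_op_spectrum (m * m)
      (T_op m \<nu> \<gamma>1 \<gamma>2 (\<omega> (z1 \<cdot>\<^sub>m e11 m - \<gamma>0)) (\<omega> (z2 \<cdot>\<^sub>m e11 m - \<gamma>0)))
    \<subseteq> ball 0 (1 / \<sigma>\<^sup>2)"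
proof -
  interpret wstar_space M \<phi> by unfold_locales (rule assms)
  have s: "selfadjoint s" "\<And>k. \<phi> (s ^ k) = complex_of_real (\<integral>t. t ^ k \<partial>semicircle \<sigma>)"
    and d: "selfadjoint d" "\<And>k. \<phi> (d ^ k) = complex_of_real (\<integral>t. t ^ k \<partial>\<nu>)"
    using assms(13,15) unfolding has_distribution_def by auto
  \<comment> \<open>the total mass of the semicircle law is read off from the state\<close>
  have "complex_of_real (\<integral>t. t ^ 0 \<partial>semicircle \<sigma>) = 1" using s(2)[of 0] by simp
  then have m0: "(\<integral>t. t ^ 0 \<partial>semicircle \<sigma>) = 1" by (simp only: of_real_eq_1_iff)
  interpret nu: prob_space \<nu> by (rule assms)
  interpret free_semicircular_perturbation M \<phi> s d \<sigma> \<nu>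
  proof unfold_locales
    show "\<phi> (s ^ Suc k) = of_real (\<sigma>\<^sup>2) * (\<Sum>i<k. \<phi> (s ^ i) * \<phi> (s ^ (k - 1 - i)))" for k
      unfolding s(2) semicircle_moment_convolution[OF assms(7) m0] by simp
  qed (use assms s d in simp_all)
  obtain K where K: "L \<in> carrier_mat (Suc K) (Suc K)" "L $$ (0, 0) = 0"
    "\<And>i j. i < Suc K \<Longrightarrow> j < Suc K \<Longrightarrow> L $$ (j, i) = nc_adjoint (L $$ (i, j))"
    "bounded_below K (\<lambda>i j. affine_eval s d (L $$ (Suc i, Suc j)))"
    using canonical_sa_linearization_structure[OF assms(2)] by blast
  define g where "g w i j = Poly_Mapping.lookup (L $$ (i, j)) w" for w i j
  define X where "X i j = affine_eval s d (L $$ (i, j))" for i j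
  have g_herm: "g w j i = cnj (g w i j)" if "i < Suc K" "j < Suc K" "rev w = w" for w i j
    unfolding g_def K(3)[OF that(1,2)] nc_adjoint.rep_eq that(3) ..
  interpret hermitian_pencil M \<phi> s d \<sigma> \<nu> K "g []" "g [T1]" "g [T2]" X
  proof unfold_locales
    show "X i j = g [] i j *\<^sub>C 1 + g [T1] i j *\<^sub>C s + g [T2] i j *\<^sub>C d" for i j
      by (simp add: X_def affine_eval_def g_def)
    show "is_adjoint (X i j) (X j i)" if "i < Suc K" "j < Suc K" for i j
      unfolding X_def K(3)[OF that] by (rule affine_eval_adjoint[OF s(1) d(1)])
    show "X 0 0 = 0" by (simp add: X_def K(2))
    show "bounded_below K (\<lambda>i j. X (Suc i) (Suc j))" unfolding X_def by (rule K(4))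
  qed (auto intro: g_herm)
  have m: "m = Suc K" using K(1) assms(3) by auto
  have \<gamma>: "\<gamma>0 = fmat m (g [])" "\<gamma>1 = g1_mat" "\<gamma>2 = g2_mat"
    using K(1) by (auto simp: assms(4-6) mat_coeff_def g_def g1_mat_def g2_mat_def m)
  have \<omega>: "\<omega> (z \<cdot>\<^sub>m e11 m - \<gamma>0) = omega_mat z" if "z \<notin> \<real>" for z
    using omega_eq_omega_mat[of z] that unfolding assms(17) \<gamma> m by (simp add: complex_is_Real_iff)
  have Im: "Im z1 \<noteq> 0" "Im z2 \<noteq> 0" using assms(18,19) by (simp_all add: complex_is_Real_iff)
  show ?thesis
  proof
    fix l assume "l \<in> mat_op_spectrum (m * m) (T_op m \<nu> \<gamma>1 \<gamma>2 (\<omega> (z1 \<cdot>\<^sub>m e11 m - \<gamma>0)) (\<omega> (z2 \<cdot>\<^sub>m e11 m - \<gamma>0)))"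
    then have "\<not> 1 / \<sigma>\<^sup>2 \<le> cmod l"
      using T_op_resolvent_bijective[OF Im assms(7), of l]
      unfolding mat_op_spectrum_def \<omega>[OF assms(18)] \<omega>[OF assms(19)] unfolding \<gamma> m by blast
    then show "l \<in> ball 0 (1 / \<sigma>\<^sup>2)" by simp
  qed
qed

end
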